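(* Let $\mathcal{T}_\alpha=(\mathcal{K}_\alpha,\mathcal{F})$, with weights $c,r,s$, be a $\chi$-complete weighted magnetic triangulation. Then the magnetic Laplace operator $\Delta_\alpha=T_\alpha^2$ is essentially self-adjoint on $\mathcal{C}^c(\mathcal{V})\oplus\mathcal{C}^c_{skew}(\mathcal{E})\oplus\mathcal{C}^c_{skew}(\mathcal{F})$, as an operator in the Hilbert space $l^2(\mathcal{T}_\alpha)=l^2(\mathcal{V})\oplus l^2(\mathcal{E})\oplus l^2(\mathcal{F})$.
   Context: Magnetic triangulation. A graph $(\mathcal{V},\mathcal{E})$ consists of an at most countable set $\mathcal{V}$ and a symmetric set $\mathcal{E}\subset\mathcal{V}\times\mathcal{V}$ of (oriented) edges without loops ($(x,x)\notin\mathcal{E}$); it is assumed connected and locally finite (each vertex has finitely many neighbours). For $e=(x,y)\in\mathcal{E}$ put $e^-=x$, $e^+=y$; $x\sim y$ means $(x,y)\in\mathcal{E}$. A magnetic potential is a function $\alpha:\mathcal{E}\to\mathbb{R}$ with $\alpha(x,y)=-\alpha(y,x)$, and $\mathcal{K}_\alpha=(\mathcal{V},\mathcal{E},\alpha)$. A symmetric set of triangular faces is a set $\mathcal{F}\subset\mathcal{V}^3$, stable under all permutations of the three entries, such that $(x,y,z)\in\mathcal{F}$ implies that $x,y,z$ are pairwise adjacent (not every 3-cycle needs to be a face). $\mathcal{T}_\alpha=(\mathcal{K}_\alpha,\mathcal{F})$ is a magnetic triangulation. For an edge $(x,y)$ put $\mathcal{F}_{xy}=\{z\in\mathcal{V}:(x,y,z)\in\mathcal{F}\}$.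 Weights: $c:\mathcal{V}\to(0,\infty)$; $r:\mathcal{E}\to(0,\infty)$ symmetric; $s:\mathcal{F}\to(0,\infty)$ invariant under all permutations. Spaces: $\mathcal{C}(\mathcal{V})$ is the set of functions $\mathcal{V}\to\mathbb{C}$; $\mathcal{C}_{skew}(\mathcal{E})$ is the set of $\varphi:\mathcal{E}\to\mathbb{C}$ with $\varphi(x,y)=-\varphi(y,x)$; $\mathcal{C}_{skew}(\mathcal{F})$ is the set of $\psi:\mathcal{F}\to\mathbb{C}$ that are alternating under permutations of the entries. A superscript $c$ denotes the subspace of finitely supported functions. The Hilbert spaces $l^2(\mathcal{V}),l^2(\mathcal{E}),l^2(\mathcal{F})$ consist of the elements of these spaces with finite norm for $\langle f_1,f_2\rangle=\sum_x c(x)f_1(x)\overline{f_2(x)}$, $\langle\varphi_1,\varphi_2\rangle=\frac12\sum_{e\in\mathcal{E}}r(e)\varphi_1(e)\overline{\varphi_2(e)}$, $\langle\psi_1,\psi_2\rangle=\frac16\sum_{(x,y,z)\in\mathcal{F}}s(x,y,z)\psi_1(x,y,z)\overline{\psi_2(x,y,z)}$. Operators: $d^0_\alpha g(x,y)=e^{\frac{i\alpha(y,x)}{2}}g(y)-e^{\frac{i\alpha(x,y)}{2}}g(x)$; $\delta^0_\alpha\varphi(x)=\frac1{c(x)}\sum_{e\in\mathcal{E},\,e^+=x}r(e)e^{i\alpha(e)/2}\varphi(e)$; $d^1_\alpha\varphi(x,y,z)=e^{\frac i6(\alpha(x,z)+\alpha(y,z))}\varphi(x,y)+e^{\frac i6(\alpha(y,x)+\alpha(z,x))}\varphi(y,z)+e^{\frac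 i6(\alpha(z,y)+\alpha(x,y))}\varphi(z,x)$; $\delta^1_\alpha\psi(x,y)=\frac1{r(x,y)}\sum_{t\in\mathcal{F}_{xy}}s(x,y,t)e^{\frac i6(\alpha(t,x)+\alpha(t,y))}\psi(x,y,t)$. The magnetic Gauss-Bonnet operator is $T_\alpha(f,\varphi,\psi)=(\delta^0_\alpha\varphi,\ d^0_\alpha f+\delta^1_\alpha\psi,\ d^1_\alpha\varphi)$ from $\mathcal{C}^c(\mathcal{V})\oplus\mathcal{C}^c_{skew}(\mathcal{E})\oplus\mathcal{C}^c_{skew}(\mathcal{F})$ to itself; $\Delta_\alpha=T_\alpha^2$ has the same domain. $\chi$-completeness: let $d^0f(x,y)=f(y)-f(x)$. The weighted triangulation is $\chi$-complete if there are a constant $C>0$, an increasing sequence of finite sets $(B_n)_{n\in\mathbb{N}}$ with $\mathcal{V}=\bigcup_nB_n$, and functions $\chi_n\in\mathcal{C}^c(\mathcal{V})$ with $0\le\chi_n\le1$ and $\chi_n=1$ on $B_n$, such that for all $n$: for all $x\in\mathcal{V}$, $\frac1{c(x)}\sum_{e\in\mathcal{E},\,e^+=x}r(e)|d^0\chi_n(e)|^2\le C$; and for all $(x,y)\in\mathcal{E}$, $\frac1{r(x,y)}\sum_{t\in\mathcal{F}_{xy}}s(x,y,t)\,|d^0\chi_n(t,x)+d^0\chi_n(t,y)|^2\le C$. *)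

theory Defs
  imports "HOL-Analysis.Analysis" "HOL-Library.Function_Algebras"
begin

section \<open>Unbounded operators\<close>

text \<open>A Hilbert space is given by a carrier \<open>H\<close> and an inner product \<open>ip\<close>, linear in its first
  argument. Operators are identified with their graphs.\<close>

definition ip_norm :: "('h \<Rightarrow> 'h \<Rightarrow> complex) \<Rightarrow> 'h \<Rightarrow> real" where
  "ip_norm ip u = sqrt (Re (ip u u))"

definition dense_in :: "'h set \<Rightarrow> ('h \<Rightarrow> 'h \<Rightarrow> complex) \<Rightarrow> 'h::ab_group_add set \<Rightarrow> bool" where
  "dense_in H ip D \<longleftrightarrow> D \<subseteq> H \<and> (\<forall>u\<in>H. \<forall>\<epsilon>>0. \<exists>v\<in>D. ip_norm ip (v - u) < \<epsilon>)"

definition graph_on :: "'h set \<Rightarrow> ('h \<Rightarrow> 'h) \<Rightarrow> ('h \<times> 'h) set" where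
  "graph_on D A = {(u, A u) |u. u \<in> D}"

definition graph_closure ::
    "'h set \<Rightarrow> ('h \<Rightarrow> 'h \<Rightarrow> complex) \<Rightarrow> ('h::ab_group_add \<times> 'h) set \<Rightarrow> ('h \<times> 'h) set" where
  "graph_closure H ip G = {(u, w). u \<in> H \<and> w \<in> H \<and>
     (\<exists>a b. (\<forall>n::nat. (a n, b n) \<in> G) \<and>
        (\<lambda>n. ip_norm ip (a n - u)) \<longlonglongrightarrow> 0 \<and> (\<lambda>n. ip_norm ip (b n - w)) \<longlonglongrightarrow> 0)}"

definition adjoint_graph ::
    "'h set \<Rightarrow> ('h \<Rightarrow> 'h \<Rightarrow> complex) \<Rightarrow> ('h \<times> 'h) set \<Rightarrow> ('h \<times> 'h) set" where
  "adjoint_graph H ip G = {(v, w). v \<in> H \<and> w \<in> H \<and> (\<forall>(u, z)\<in>G. ip z v = ip u w)}"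

definition self_adjoint_graph ::
    "'h set \<Rightarrow> ('h \<Rightarrow> 'h \<Rightarrow> complex) \<Rightarrow> ('h::ab_group_add \<times> 'h) set \<Rightarrow> bool" where
  "self_adjoint_graph H ip G \<longleftrightarrow> dense_in H ip (Domain G) \<and> adjoint_graph H ip G = G"

definition symmetric_operator ::
    "'h set \<Rightarrow> ('h \<Rightarrow> 'h \<Rightarrow> complex) \<Rightarrow> 'h::ab_group_add set \<Rightarrow> ('h \<Rightarrow> 'h) \<Rightarrow> bool" where
  "symmetric_operator H ip D A \<longleftrightarrow> dense_in H ip D \<and> A ` D \<subseteq> H \<and>
     (\<forall>u\<in>D. \<forall>v\<in>D. ip (A u) v = ip u (A v))"

definition essentially_self_adjoint ::
    "'h set \<Rightarrow> ('h \<Rightarrow> 'h \<Rightarrow> complex) \<Rightarrow> 'h::ab_group_add set \<Rightarrow> ('h \<Rightarrow> 'h) \<Rightarrow> bool" where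
  "essentially_self_adjoint H ip D A \<longleftrightarrow>
     symmetric_operator H ip D A \<and> self_adjoint_graph H ip (graph_closure H ip (graph_on D A))"


section \<open>Weighted magnetic triangulations\<close>

text \<open>Values of the potential and of the weights off the vertex, edge and face sets are irrelevant.\<close>

record 'v triangulation =
  verts :: "'v set"
  edges :: "('v \<times> 'v) set"
  faces :: "('v \<times> 'v \<times> 'v) set"
  pot :: "'v \<times> 'v \<Rightarrow> real"
  cw :: "'v \<Rightarrow> real"
  rw :: "'v \<times> 'v \<Rightarrow> real"
  sw :: "'v \<times> 'v \<times> 'v \<Rightarrow> real"

text \<open>Invariance under permutations of three entries is expressed on a transposition and a
  3-cycle, which generate the symmetric group.\<close>

locale weighted_magnetic_triangulation =
  fixes T :: "'v triangulation"
  assumes countable_verts: "countable (verts T)"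
    and edges_subset: "edges T \<subseteq> verts T \<times> verts T"
    and edges_sym: "sym (edges T)"
    and no_loops: "irrefl (edges T)"
    and connected: "\<And>x y. x \<in> verts T \<Longrightarrow> y \<in> verts T \<Longrightarrow> (x, y) \<in> (edges T)\<^sup>*"
    and locally_finite: "\<And>x. x \<in> verts T \<Longrightarrow> finite {y. (x, y) \<in> edges T}"
    and pot_skew: "\<And>x y. (x, y) \<in> edges T \<Longrightarrow> pot T (x, y) = - pot T (y, x)"
    and faces_adjacent: "\<And>x y z. (x, y, z) \<in> faces T \<Longrightarrow>
          (x, y) \<in> edges T \<and> (y, z) \<in> edges T \<and> (x, z) \<in> edges T"
    and faces_swap: "\<And>x y z. (x, y, z) \<in> faces T \<Longrightarrow> (y, x, z) \<in> faces T"
    and faces_cycle: "\<And>x y z. (x, y, z) \<in> faces T \<Longrightarrow> (y, z, x) \<in> faces T"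
    and cw_pos: "\<And>x. x \<in> verts T \<Longrightarrow> cw T x > 0"
    and rw_pos: "\<And>e. e \<in> edges T \<Longrightarrow> rw T e > 0"
    and rw_sym: "\<And>x y. (x, y) \<in> edges T \<Longrightarrow> rw T (x, y) = rw T (y, x)"
    and sw_pos: "\<And>t. t \<in> faces T \<Longrightarrow> sw T t > 0"
    and sw_swap: "\<And>x y z. (x, y, z) \<in> faces T \<Longrightarrow> sw T (y, x, z) = sw T (x, y, z)"
    and sw_cycle: "\<And>x y z. (x, y, z) \<in> faces T \<Longrightarrow> sw T (y, z, x) = sw T (x, y, z)"

definition face_verts :: "'v triangulation \<Rightarrow> 'v \<Rightarrow> 'v \<Rightarrow> 'v set" where
  "face_verts T x y = {z \<in> verts T. (x, y, z) \<in> faces T}"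

text \<open>Functions on vertices, edges and faces are total functions vanishing off the respective set,
  so that each has a unique representative.\<close>

definition C_verts :: "'v triangulation \<Rightarrow> ('v \<Rightarrow> complex) set" where
  "C_verts T = {f. \<forall>x. x \<notin> verts T \<longrightarrow> f x = 0}"

definition C_edges :: "'v triangulation \<Rightarrow> ('v \<times> 'v \<Rightarrow> complex) set" where
  "C_edges T = {\<phi>. (\<forall>e. e \<notin> edges T \<longrightarrow> \<phi> e = 0) \<and>
     (\<forall>x y. (x, y) \<in> edges T \<longrightarrow> \<phi> (x, y) = - \<phi> (y, x))}"

definition C_faces :: "'v triangulation \<Rightarrow> ('v \<times> 'v \<times> 'v \<Rightarrow> complex) set" where
  "C_faces T = {\<psi>. (\<forall>t. t \<notin> faces T \<longrightarrow> \<psi> t = 0) \<and>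
     (\<forall>x y z. (x, y, z) \<in> faces T \<longrightarrow>
        \<psi> (y, x, z) = - \<psi> (x, y, z) \<and> \<psi> (y, z, x) = \<psi> (x, y, z))}"

definition finitely_supported :: "('a \<Rightarrow> complex) \<Rightarrow> bool" where
  "finitely_supported f \<longleftrightarrow> finite {x. f x \<noteq> 0}"

definition Cc_verts :: "'v triangulation \<Rightarrow> ('v \<Rightarrow> complex) set" where
  "Cc_verts T = {f \<in> C_verts T. finitely_supported f}"

definition Cc_edges :: "'v triangulation \<Rightarrow> ('v \<times> 'v \<Rightarrow> complex) set" where
  "Cc_edges T = {\<phi> \<in> C_edges T. finitely_supported \<phi>}"

definition Cc_faces :: "'v triangulation \<Rightarrow> ('v \<times> 'v \<times> 'v \<Rightarrow> complex) set" where
  "Cc_faces T = {\<psi> \<in> C_faces T. finitely_supported \<psi>}"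

definition l2_verts :: "'v triangulation \<Rightarrow> ('v \<Rightarrow> complex) set" where
  "l2_verts T = {f \<in> C_verts T. (\<lambda>x. cw T x * (cmod (f x))\<^sup>2) summable_on verts T}"

definition l2_edges :: "'v triangulation \<Rightarrow> ('v \<times> 'v \<Rightarrow> complex) set" where
  "l2_edges T = {\<phi> \<in> C_edges T. (\<lambda>e. rw T e * (cmod (\<phi> e))\<^sup>2) summable_on edges T}"

definition l2_faces :: "'v triangulation \<Rightarrow> ('v \<times> 'v \<times> 'v \<Rightarrow> complex) set" where
  "l2_faces T = {\<psi> \<in> C_faces T. (\<lambda>t. sw T t * (cmod (\<psi> t))\<^sup>2) summable_on faces T}"

definition ip_verts :: "'v triangulation \<Rightarrow> ('v \<Rightarrow> complex) \<Rightarrow> ('v \<Rightarrow> complex) \<Rightarrow> complex" where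
  "ip_verts T f g = (\<Sum>\<^sub>\<infinity>x\<in>verts T. complex_of_real (cw T x) * f x * cnj (g x))"

definition ip_edges ::
    "'v triangulation \<Rightarrow> ('v \<times> 'v \<Rightarrow> complex) \<Rightarrow> ('v \<times> 'v \<Rightarrow> complex) \<Rightarrow> complex" where
  "ip_edges T \<phi> \<phi>' = 1/2 * (\<Sum>\<^sub>\<infinity>e\<in>edges T. complex_of_real (rw T e) * \<phi> e * cnj (\<phi>' e))"

definition ip_faces ::
    "'v triangulation \<Rightarrow> ('v \<times> 'v \<times> 'v \<Rightarrow> complex) \<Rightarrow> ('v \<times> 'v \<times> 'v \<Rightarrow> complex) \<Rightarrow> complex" where
  "ip_faces T \<psi> \<psi>' = 1/6 * (\<Sum>\<^sub>\<infinity>t\<in>faces T. complex_of_real (sw T t) * \<psi> t * cnj (\<psi>' t))"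

type_synonym 'v cochain =
  "('v \<Rightarrow> complex) \<times> ('v \<times> 'v \<Rightarrow> complex) \<times> ('v \<times> 'v \<times> 'v \<Rightarrow> complex)"

definition Cc_triang :: "'v triangulation \<Rightarrow> 'v cochain set" where
  "Cc_triang T = Cc_verts T \<times> Cc_edges T \<times> Cc_faces T"

definition l2_triang :: "'v triangulation \<Rightarrow> 'v cochain set" where
  "l2_triang T = l2_verts T \<times> l2_edges T \<times> l2_faces T"

fun ip_triang :: "'v triangulation \<Rightarrow> 'v cochain \<Rightarrow> 'v cochain \<Rightarrow> complex" where
  "ip_triang T (f, \<phi>, \<psi>) (f', \<phi>', \<psi>') = ip_verts T f f' + ip_edges T \<phi> \<phi>' + ip_faces T \<psi> \<psi>'"


section \<open>The magnetic Gauss-Bonnet operator and Laplacian\<close>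

definition d0_mag :: "'v triangulation \<Rightarrow> ('v \<Rightarrow> complex) \<Rightarrow> 'v \<times> 'v \<Rightarrow> complex" where
  "d0_mag T g = (\<lambda>(x, y). if (x, y) \<in> edges T
     then exp (\<i> * complex_of_real (pot T (y, x)) / 2) * g y - exp (\<i> * complex_of_real (pot T (x, y)) / 2) * g x else 0)"

definition delta0_mag :: "'v triangulation \<Rightarrow> ('v \<times> 'v \<Rightarrow> complex) \<Rightarrow> 'v \<Rightarrow> complex" where
  "delta0_mag T \<phi> = (\<lambda>x. if x \<in> verts T
     then complex_of_real (1 / cw T x) * (\<Sum>e\<in>{e \<in> edges T. snd e = x}.
        complex_of_real (rw T e) * exp (\<i> * complex_of_real (pot T e) / 2) * \<phi> e)
     else 0)"

definition d1_mag :: "'v triangulation \<Rightarrow> ('v \<times> 'v \<Rightarrow> complex) \<Rightarrow> 'v \<times> 'v \<times> 'v \<Rightarrow> complex" where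
  "d1_mag T \<phi> = (\<lambda>(x, y, z). if (x, y, z) \<in> faces T
     then exp (\<i> / 6 * complex_of_real (pot T (x, z) + pot T (y, z))) * \<phi> (x, y)
        + exp (\<i> / 6 * complex_of_real (pot T (y, x) + pot T (z, x))) * \<phi> (y, z)
        + exp (\<i> / 6 * complex_of_real (pot T (z, y) + pot T (x, y))) * \<phi> (z, x)
     else 0)"

definition delta1_mag :: "'v triangulation \<Rightarrow> ('v \<times> 'v \<times> 'v \<Rightarrow> complex) \<Rightarrow> 'v \<times> 'v \<Rightarrow> complex" where
  "delta1_mag T \<psi> = (\<lambda>(x, y). if (x, y) \<in> edges T
     then complex_of_real (1 / rw T (x, y)) * (\<Sum>t\<in>face_verts T x y.
        complex_of_real (sw T (x, y, t)) * exp (\<i> / 6 * complex_of_real (pot T (t, x) + pot T (t, y))) * \<psi> (x, y, t))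
     else 0)"

fun gauss_bonnet :: "'v triangulation \<Rightarrow> 'v cochain \<Rightarrow> 'v cochain" where
  "gauss_bonnet T (f, \<phi>, \<psi>) =
     (delta0_mag T \<phi>, \<lambda>e. d0_mag T f e + delta1_mag T \<psi> e, d1_mag T \<phi>)"

definition magnetic_laplacian :: "'v triangulation \<Rightarrow> 'v cochain \<Rightarrow> 'v cochain" where
  "magnetic_laplacian T = gauss_bonnet T \<circ> gauss_bonnet T"


section \<open>Completeness\<close>

definition d0 :: "('v \<Rightarrow> complex) \<Rightarrow> 'v \<times> 'v \<Rightarrow> complex" where
  "d0 f = (\<lambda>(x, y). f y - f x)"

definition chi_complete :: "'v triangulation \<Rightarrow> bool" where
  "chi_complete T \<longleftrightarrow> (\<exists>(C::real) (B :: nat \<Rightarrow> 'v set) (chi :: nat \<Rightarrow> 'v \<Rightarrow> complex).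
     C > 0 \<and> incseq B \<and> (\<forall>n. finite (B n)) \<and> verts T = (\<Union>n. B n) \<and>
     (\<forall>n. chi n \<in> Cc_verts T \<and> (\<forall>x\<in>verts T. chi n x \<in> complex_of_real ` {0..1}) \<and>
          (\<forall>x\<in>B n. chi n x = 1) \<and>
          (\<forall>x\<in>verts T. 1 / cw T x *
             (\<Sum>e\<in>{e \<in> edges T. snd e = x}. rw T e * (cmod (d0 (chi n) e))\<^sup>2) \<le> C) \<and>
          (\<forall>(x, y)\<in>edges T. 1 / rw T (x, y) *
             (\<Sum>t\<in>face_verts T x y.
                sw T (x, y, t) * (cmod (d0 (chi n) (t, x) + d0 (chi n) (t, y)))\<^sup>2) \<le> C)))"

end

(* A symmetric nonnegative operator is essentially self-adjoint once its adjoint does not have the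
   eigenvalue -mu for one mu > 0. An eigencochain u = (f, phi, psi) solves T(T u) = -mu u pointwise,
   and the even part (f, psi) decouples from the odd part phi. Testing against a cutoff of u gives
   J + mu N = commutators, where N and J are the cut-off energies of u and T u.

   For the even part the cutoff is the square of chi on vertices, of the endpoint mean on edges and of
   the median on faces: every commutator is then bounded by J/2 plus a multiple of C |u|^2.
   For the odd part (median replaced by the average) this fails at the lower vertex x of an edge with
   increment d = chi(y) - chi(x) > 0, since T u is not square-summable and chi(x) may vanish. The
   remaining term Z is the sum of r d^4 |f(x)|^2 over such edges. Where d^2 times
   the total weight of the adjacent faces is at most a multiple of r, the equation on the edge
   expresses f(x) through phi(e), f(y) and psi. On the other edges the face condition
   forces most apexes t to have chi(t) near the midpoint, and the weighted sixth power of d is dominated by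
   terms that the face condition bounds by Z/2. Both together bound Z by J and the tail of the
   norm of phi, which vanishes along the exhaustion. *)

theory Submission
  imports Defs
begin

section \<open>A criterion for essential self-adjointness\<close>

text \<open>In each commutator one factor is a component of u, which is square-summable, and the
  other a component of T u, of which only the cut-off energy J is at hand. So the difference of two
  squared cutoffs must be bounded by the cutoff on the cell that carries T u, times a quantity
  controlled by completeness. In the even part that cell is the edge, and the face cutoff has to
  vanish as soon as the mean on one of its edges does; this dictates the median. In the odd part the
  cells are vertices and faces, and the mean on an edge is not bounded by the value at its lower
  endpoint. The face condition does not cure this directly: it bounds second differences a(x) + a(y)
  - 2a(t), not single increments against face weights. It is therefore used twice in a face: if t is
  near the midpoint of the edge yx, then y is far from the midpoint of tx, an edge with the same
  lower vertex x. Since one \<mu> suffices, constants only have to allow absorption: 2056 = 2 (4 +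
  1024) makes the part of the bound on Z that contains Z itself equal to Z/2, and \<mu> is so large
  that Z adds at most J/4.\<close>

text \<open>The space is a carrier inside a larger vector space, because the square-summable
  cochains depend on the triangulation, which is a term.\<close>

locale hilbert_space_on = vector_space scale
  for scale :: "complex \<Rightarrow> 'h::ab_group_add \<Rightarrow> 'h" (infixr \<open>\<odot>\<close> 75) +
  fixes H :: "'h set" and ip :: "'h \<Rightarrow> 'h \<Rightarrow> complex"
  assumes subspace_H: "subspace H"
    and ip_add_left: "x \<in> H \<Longrightarrow> y \<in> H \<Longrightarrow> z \<in> H \<Longrightarrow> ip (x + y) z = ip x z + ip y z"
    and ip_scale_left: "x \<in> H \<Longrightarrow> z \<in> H \<Longrightarrow> ip (k \<odot> x) z = k * ip x z"
    and ip_commute: "x \<in> H \<Longrightarrow> y \<in> H \<Longrightarrow> ip y x = cnj (ip x y)"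
    and ip_self_nonneg: "x \<in> H \<Longrightarrow> 0 \<le> Re (ip x x)"
    and ip_self_zero: "x \<in> H \<Longrightarrow> Re (ip x x) = 0 \<Longrightarrow> x = 0"
    and complete: "(\<And>n. a n \<in> H) \<Longrightarrow>
          (\<And>\<epsilon>. \<epsilon> > 0 \<Longrightarrow> \<exists>N. \<forall>m\<ge>N. \<forall>n\<ge>N. ip_norm ip (a m - a n) < \<epsilon>) \<Longrightarrow>
          \<exists>l\<in>H. (\<lambda>n. ip_norm ip (a n - l)) \<longlonglongrightarrow> 0"
begin

lemmas H_closed [simp, intro] =
  subspace_0[OF subspace_H] subspace_add[OF subspace_H] subspace_diff[OF subspace_H]
  subspace_scale[OF subspace_H]

section \<open>Geometry of the inner product\<close>

lemma ip_add_right: "x \<in> H \<Longrightarrow> y \<in> H \<Longrightarrow> z \<in> H \<Longrightarrow> ip z (x + y) = ip z x + ip z y"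
  using ip_commute[of "x + y" z] ip_commute[of x z] ip_commute[of y z] by (simp add: ip_add_left)

lemma ip_scale_right: "x \<in> H \<Longrightarrow> z \<in> H \<Longrightarrow> ip z (k \<odot> x) = cnj k * ip z x"
  using ip_commute[of "k \<odot> x" z] ip_commute[of x z] by (simp add: ip_scale_left)

lemma ip_diff_left: "x \<in> H \<Longrightarrow> y \<in> H \<Longrightarrow> z \<in> H \<Longrightarrow> ip (x - y) z = ip x z - ip y z"
  using ip_add_left[of "x - y" y z] by simp

lemma ip_diff_right: "x \<in> H \<Longrightarrow> y \<in> H \<Longrightarrow> z \<in> H \<Longrightarrow> ip z (x - y) = ip z x - ip z y"
  using ip_add_right[of "x - y" y z] by simp

abbreviation nrm :: "'h \<Rightarrow> real" where "nrm \<equiv> ip_norm ip"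

lemma nrm_sq: "x \<in> H \<Longrightarrow> (nrm x)\<^sup>2 = Re (ip x x)"
  by (simp add: ip_norm_def ip_self_nonneg)

lemma nrm_nonneg: "x \<in> H \<Longrightarrow> 0 \<le> nrm x"
  by (simp add: ip_norm_def ip_self_nonneg)

lemma nrm_eq_0: "x \<in> H \<Longrightarrow> nrm x = 0 \<Longrightarrow> x = 0"
  using nrm_sq[of x] ip_self_zero[of x] by simp

lemma nrm_zero [simp]: "nrm 0 = 0"
  using ip_scale_left[of 0 0 0] by (simp add: ip_norm_def)

text \<open>The one expansion behind the rest of the geometry: t = 1 and t = -1 give the triangle
  inequality and the parallelogram law, x = 0 gives homogeneity, and the best t gives
  Cauchy-Schwarz.\<close>

lemma nrm_sq_add_scale:
  assumes "x \<in> H" "y \<in> H"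
  shows "(nrm (x + t \<odot> y))\<^sup>2 = (nrm x)\<^sup>2 + 2 * Re (cnj t * ip x y) + (cmod t)\<^sup>2 * (nrm y)\<^sup>2"
proof -
  have "ip (x + t \<odot> y) (x + t \<odot> y) = ip x x + cnj t * ip x y + t * ip y x + t * cnj t * ip y y"
    using assms by (simp add: ip_add_left ip_add_right ip_scale_left ip_scale_right algebra_simps)
  moreover have "t * ip y x = cnj (cnj t * ip x y)"
    using assms by (metis complex_cnj_cnj complex_cnj_mult ip_commute)
  moreover have "Re (t * cnj t * ip y y) = (cmod t)\<^sup>2 * Re (ip y y)"
    by (simp add: complex_norm_square[symmetric] flip: of_real_power)
  ultimately show ?thesis
    using assms by (simp add: nrm_sq)
qed

text \<open>The chosen scalar minimises the distance from x to the line through y. The gain is used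
  for Cauchy-Schwarz and to see that a residual of minimal norm is orthogonal to the
  subspace.\<close>

lemma nrm_sq_diff_optimal_scale:
  assumes "x \<in> H" "y \<in> H" "y \<noteq> 0"
  shows "(nrm (x + (- ip x y / (nrm y)\<^sup>2) \<odot> y))\<^sup>2 = (nrm x)\<^sup>2 - (cmod (ip x y))\<^sup>2 / (nrm y)\<^sup>2"
proof -
  define k where "k = ip x y"
  define Y where "Y = (nrm y)\<^sup>2"
  have Y: "Y > 0"
    using assms nrm_eq_0 Y_def by force
  have "Re (cnj (- k / Y) * k) = - (cmod k)\<^sup>2 / Y"
  proof -
    have "cnj (- k / Y) * k = complex_of_real (- (cmod k)\<^sup>2 / Y)"
      by (simp only: of_real_divide of_real_minus complex_norm_square) simp
    then show ?thesis
      by (simp only: Re_complex_of_real)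
  qed
  moreover have "(cmod (- k / Y))\<^sup>2 * Y = (cmod k)\<^sup>2 / Y"
    using Y by (simp add: norm_divide power_divide power2_eq_square)
  ultimately show ?thesis
    using nrm_sq_add_scale[OF assms(1,2), of "- k / Y"]
    by (simp only: k_def[symmetric] Y_def[symmetric] of_real_power[symmetric])
qed

lemma cauchy_schwarz:
  assumes "x \<in> H" "y \<in> H"
  shows "cmod (ip x y) \<le> nrm x * nrm y"
proof (cases "y = 0")
  case True
  then show ?thesis
    using assms ip_scale_right[of 0 x 0] by simp
next
  case False
  then have "(nrm y)\<^sup>2 > 0"
    using assms nrm_eq_0 by force
  moreover have "0 \<le> (nrm x)\<^sup>2 - (cmod (ip x y))\<^sup>2 / (nrm y)\<^sup>2"
    using nrm_sq_diff_optimal_scale[OF assms False] by (metis zero_le_power2)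
  ultimately have "(cmod (ip x y))\<^sup>2 \<le> (nrm x * nrm y)\<^sup>2"
    by (simp add: field_simps power_mult_distrib)
  then show ?thesis
    by (rule power2_le_imp_le) (simp add: assms nrm_nonneg)
qed

lemma nrm_scale:
  assumes "x \<in> H"
  shows "nrm (k \<odot> x) = cmod k * nrm x"
proof (rule power2_eq_imp_eq)
  show "(nrm (k \<odot> x))\<^sup>2 = (cmod k * nrm x)\<^sup>2"
    using nrm_sq_add_scale[of 0 x k] ip_scale_left[of 0 x 0] assms by (simp add: power_mult_distrib)
qed (simp_all add: assms nrm_nonneg)

lemma nrm_triangle:
  assumes "x \<in> H" "y \<in> H"
  shows "nrm (x + y) \<le> nrm x + nrm y"
proof (rule power2_le_imp_le)
  have "(nrm (x + y))\<^sup>2 = (nrm x)\<^sup>2 + 2 * Re (ip x y) + (nrm y)\<^sup>2"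
    using nrm_sq_add_scale[OF assms, of 1] by simp
  moreover have "Re (ip x y) \<le> nrm x * nrm y"
    using cauchy_schwarz[OF assms] complex_Re_le_cmod order_trans by blast
  ultimately show "(nrm (x + y))\<^sup>2 \<le> (nrm x + nrm y)\<^sup>2"
    by (simp add: power2_sum)
qed (simp add: assms nrm_nonneg)

lemma nrm_minus_commute: "x \<in> H \<Longrightarrow> y \<in> H \<Longrightarrow> nrm (x - y) = nrm (y - x)"
  using nrm_scale[of "y - x" "-1"] by simp

lemma nrm_triangle_diff: "x \<in> H \<Longrightarrow> y \<in> H \<Longrightarrow> z \<in> H \<Longrightarrow> nrm (x - z) \<le> nrm (x - y) + nrm (y - z)"
  using nrm_triangle[of "x - y" "y - z"] by simp

lemma tendsto_ip_left:
  assumes "\<And>n. a n \<in> H" "x \<in> H" "y \<in> H" "(\<lambda>n. nrm (a n - x)) \<longlonglongrightarrow> 0"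
  shows "(\<lambda>n. ip (a n) y) \<longlonglongrightarrow> ip x y"
proof (rule LIM_zero_cancel, rule Lim_null_comparison)
  show "\<forall>\<^sub>F n in sequentially. norm (ip (a n) y - ip x y) \<le> nrm (a n - x) * nrm y"
    using cauchy_schwarz[of "a _ - x" y] assms by (simp add: ip_diff_left)
  show "(\<lambda>n. nrm (a n - x) * nrm y) \<longlonglongrightarrow> 0"
    using tendsto_mult_right[OF assms(4), of "nrm y"] by simp
qed

lemma tendsto_ip_right:
  assumes "\<And>n. a n \<in> H" "x \<in> H" "y \<in> H" "(\<lambda>n. nrm (a n - x)) \<longlonglongrightarrow> 0"
  shows "(\<lambda>n. ip y (a n)) \<longlonglongrightarrow> ip y x"
proof -
  have "(\<lambda>n. cnj (ip (a n) y)) \<longlonglongrightarrow> cnj (ip x y)"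
    by (intro tendsto_cnj tendsto_ip_left assms)
  moreover have "cnj (ip (a n) y) = ip y (a n)" "cnj (ip x y) = ip y x" for n
    using assms by (auto intro: ip_commute[symmetric])
  ultimately show ?thesis by simp
qed

section \<open>Approximation from a subspace with trivial orthogonal complement\<close>

lemma parallelogram:
  assumes "x \<in> H" "y \<in> H"
  shows "(nrm (x - y))\<^sup>2 = 2 * (nrm x)\<^sup>2 + 2 * (nrm y)\<^sup>2 - 4 * (nrm ((1/2) \<odot> (x + y)))\<^sup>2"
proof -
  have "(nrm (x - y))\<^sup>2 = (nrm x)\<^sup>2 - 2 * Re (ip x y) + (nrm y)\<^sup>2"
    using nrm_sq_add_scale[OF assms, of "-1"] by simp
  moreover have "(nrm (x + y))\<^sup>2 = (nrm x)\<^sup>2 + 2 * Re (ip x y) + (nrm y)\<^sup>2"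
    using nrm_sq_add_scale[OF assms, of 1] by simp
  moreover have "4 * (nrm ((1/2) \<odot> (x + y)))\<^sup>2 = (nrm (x + y))\<^sup>2"
    using assms by (subst nrm_scale) (auto simp: power_mult_distrib power2_eq_square norm_divide)
  ultimately show ?thesis by simp
qed

text \<open>Two almost optimal points have a midpoint in R that cannot beat \<delta>, so the
  parallelogram law leaves no room for their distance.\<close>

lemma minimizing_sequence_Cauchy:
  assumes R: "subspace R" "R \<subseteq> H" and y: "y \<in> H"
    and r: "\<And>n. r n \<in> R" "\<And>n. (nrm (y - r n))\<^sup>2 < \<delta> + 1 / real (Suc n)"
    and lower: "\<And>q. q \<in> R \<Longrightarrow> \<delta> \<le> (nrm (y - q))\<^sup>2"
    and "\<epsilon> > 0"
  shows "\<exists>N. \<forall>m\<ge>N. \<forall>n\<ge>N. nrm (r m - r n) < \<epsilon>"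
proof -
  obtain N where N: "inverse (real (Suc N)) < \<epsilon>\<^sup>2 / 4"
    using reals_Archimedean[of "\<epsilon>\<^sup>2 / 4"] assms by auto
  have rH: "r n \<in> H" for n
    using r R by auto
  have "nrm (r m - r n) < \<epsilon>" if "m \<ge> N" "n \<ge> N" for m n
  proof -
    have q: "(1/2) \<odot> (r m + r n) \<in> R"
      using r R by (intro subspace_scale subspace_add) auto
    \<comment> \<open>The midpoint of two residuals is the residual of the midpoint, so the lower
      bound \<delta> applies to the last term of the parallelogram law.\<close>
    have "(1/2) \<odot> ((y - r n) + (y - r m)) = (1/2 + 1/2) \<odot> y - (1/2) \<odot> (r m + r n)"
      by (simp only: scale_right_distrib scale_right_diff_distrib scale_left_distrib) simp
    then have "(1/2) \<odot> ((y - r n) + (y - r m)) = y - (1/2) \<odot> (r m + r n)"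
      by simp
    then have "(nrm (r m - r n))\<^sup>2 = 2 * (nrm (y - r n))\<^sup>2 + 2 * (nrm (y - r m))\<^sup>2
        - 4 * (nrm (y - (1/2) \<odot> (r m + r n)))\<^sup>2"
      using parallelogram[of "y - r n" "y - r m"] rH y by simp
    also have "\<dots> < 2 / real (Suc n) + 2 / real (Suc m)"
      using r(2)[of n] r(2)[of m] lower[OF q] by simp
    also have "\<dots> \<le> 4 * inverse (real (Suc N))"
    proof -
      have "1 / real (Suc k) \<le> inverse (real (Suc N))" if "k \<ge> N" for k
        using that by (simp add: divide_simps)
      from this[of n] this[of m] that show ?thesis by simp
    qed
    also have "\<dots> < \<epsilon>\<^sup>2"
      using N by simp
    finally show ?thesis
      using \<open>\<epsilon> > 0\<close> by (simp add: power_less_imp_less_base)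
  qed
  then show ?thesis by blast
qed

text \<open>R need not be closed, so the best approximation p is taken in H as the limit of a
  minimising sequence; y - p is orthogonal to R, hence zero, and the minimising sequence itself
  tends to y.\<close>

lemma subspace_approximation:
  assumes R: "subspace R" "R \<subseteq> H"
    and orth: "\<And>z. z \<in> H \<Longrightarrow> (\<And>r. r \<in> R \<Longrightarrow> ip r z = 0) \<Longrightarrow> z = 0"
    and y: "y \<in> H"
  shows "\<exists>r. (\<forall>n::nat. r n \<in> R) \<and> (\<lambda>n. nrm (r n - y)) \<longlonglongrightarrow> 0"
proof -
  define \<delta> where "\<delta> = (INF q\<in>R. (nrm (y - q))\<^sup>2)"
  have ne: "R \<noteq> {}"
    using R subspace_0 by blast
  have bdd: "bdd_below ((\<lambda>q. (nrm (y - q))\<^sup>2) ` R)"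
    by (rule bdd_belowI[of _ 0]) auto
  have lower: "\<delta> \<le> (nrm (y - q))\<^sup>2" if "q \<in> R" for q
    unfolding \<delta>_def using bdd that by (rule cINF_lower)
  have "\<exists>q\<in>R. (nrm (y - q))\<^sup>2 < \<delta> + 1 / real (Suc n)" for n
    using cINF_less_iff[OF ne bdd, of "\<delta> + 1 / real (Suc n)"] unfolding \<delta>_def by simp
  then obtain r where r: "\<And>n. r n \<in> R" "\<And>n. (nrm (y - r n))\<^sup>2 < \<delta> + 1 / real (Suc n)"
    by metis
  have rH: "r n \<in> H" for n
    using r R by auto
  have "\<exists>p\<in>H. (\<lambda>n. nrm (r n - p)) \<longlonglongrightarrow> 0"
    using minimizing_sequence_Cauchy[OF R y r lower] by (intro complete rH) blast
  then obtain p where p: "p \<in> H" "(\<lambda>n. nrm (r n - p)) \<longlonglongrightarrow> 0"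
    by blast
  define z where "z = y - p"
  have z: "z \<in> H"
    using y p by (simp add: z_def)
  have conv: "(\<lambda>n. nrm (y - r n)) \<longlonglongrightarrow> nrm z"
  proof (rule LIM_zero_cancel, rule Lim_null_comparison[OF _ p(2)])
    have "norm (nrm (y - r n) - nrm z) \<le> nrm (r n - p)" for n
      using nrm_triangle_diff[of y "r n" p] nrm_triangle_diff[of y p "r n"] nrm_minus_commute[of p "r n"]
        y p rH by (simp add: z_def)
    then show "\<forall>\<^sub>F n in sequentially. norm (nrm (y - r n) - nrm z) \<le> nrm (r n - p)"
      by simp
  qed
  have "(nrm z)\<^sup>2 \<le> \<delta>"
  proof (rule LIMSEQ_le)
    show "(\<lambda>n. (nrm (y - r n))\<^sup>2) \<longlonglongrightarrow> (nrm z)\<^sup>2"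
      using conv by (intro tendsto_intros)
    show "(\<lambda>n. \<delta> + 1 / real (Suc n)) \<longlonglongrightarrow> \<delta>"
      using tendsto_add[OF tendsto_const LIMSEQ_inverse_real_of_nat, of \<delta>] by (simp add: inverse_eq_divide)
    show "\<exists>N. \<forall>n\<ge>N. (nrm (y - r n))\<^sup>2 \<le> \<delta> + 1 / real (Suc n)"
      using r(2) less_imp_le by blast
  qed
  \<comment> \<open>Perturbing z by an element of R amounts to perturbing every \<open>r n\<close>
    inside R, so the lower bound survives the limit although p may lie outside R.\<close>
  moreover have "\<delta> \<le> (nrm (z + t \<odot> q))\<^sup>2" if "q \<in> R" for t q
  proof (rule LIMSEQ_le_const)
    show "(\<lambda>n. (nrm (y - r n + t \<odot> q))\<^sup>2) \<longlonglongrightarrow> (nrm (z + t \<odot> q))\<^sup>2"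
    proof (intro tendsto_power, rule LIM_zero_cancel, rule Lim_null_comparison[OF _ p(2)])
      have qH: "t \<odot> q \<in> H"
        using that R by auto
      have "norm (nrm (y - r n + t \<odot> q) - nrm (z + t \<odot> q)) \<le> nrm (r n - p)" for n
        using nrm_triangle_diff[of "y + t \<odot> q" "r n" p] nrm_triangle_diff[of "y + t \<odot> q" p "r n"]
          nrm_minus_commute[of p "r n"] y p rH qH by (simp add: z_def algebra_simps)
      then show "\<forall>\<^sub>F n in sequentially. norm (nrm (y - r n + t \<odot> q) - nrm (z + t \<odot> q)) \<le> nrm (r n - p)"
        by simp
    qed
    have "y - r n + t \<odot> q = y - (r n - t \<odot> q)" "r n - t \<odot> q \<in> R" for n
      using r that R by (auto intro: subspace_diff subspace_scale)
    then show "\<exists>N. \<forall>n\<ge>N. \<delta> \<le> (nrm (y - r n + t \<odot> q))\<^sup>2"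
      using lower by metis
  qed
  ultimately have minimal: "(nrm z)\<^sup>2 \<le> (nrm (z + t \<odot> q))\<^sup>2" if "q \<in> R" for t q
    using that order_trans by blast
  have "ip q z = 0" if "q \<in> R" for q
  proof (cases "q = 0")
    case True
    then show ?thesis
      using ip_scale_left[of 0 z 0] z by simp
  next
    case False
    have q: "q \<in> H"
      using that R by auto
    then have "(nrm q)\<^sup>2 > 0"
      using False nrm_eq_0 by force
    moreover have "(cmod (ip z q))\<^sup>2 / (nrm q)\<^sup>2 \<le> 0"
      using minimal[OF that, of "- ip z q / (nrm q)\<^sup>2"] nrm_sq_diff_optimal_scale[OF z q False] by simp
    ultimately have "ip z q = 0"
      by (simp add: divide_le_0_iff)
    then show ?thesis
      using ip_commute[OF z q] by simp
  qed
  then have "z = 0"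
    using orth z by blast
  then show ?thesis
    using r p by (auto simp: z_def)
qed

text \<open>A nonnegative symmetric operator \<open>A\<close> is essentially self-adjoint as soon as
  \<open>A\<^sup>* + \<mu>\<close> is injective for one \<open>\<mu> > 0\<close>: then \<open>A + \<mu>\<close> has dense range and is
  bounded below, so its closure is onto.\<close>

lemma essentially_self_adjointI:
  assumes sym: "symmetric_operator H ip D A"
    and D: "subspace D"
    and A_add: "\<And>x y. x \<in> D \<Longrightarrow> y \<in> D \<Longrightarrow> A (x + y) = A x + A y"
    and A_scale: "\<And>k x. x \<in> D \<Longrightarrow> A (k \<odot> x) = k \<odot> A x"
    and A_nonneg: "\<And>x. x \<in> D \<Longrightarrow> 0 \<le> Re (ip (A x) x)"
    and \<mu>: "(\<mu>::real) > 0"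
    and ker: "\<And>u. u \<in> H \<Longrightarrow> (\<And>x. x \<in> D \<Longrightarrow> ip (A x) u = - complex_of_real \<mu> * ip x u) \<Longrightarrow> u = 0"
  shows "essentially_self_adjoint H ip D A"
proof -
  define G where "G = graph_on D A"
  let ?\<mu> = "complex_of_real \<mu>"
  have DH: "x \<in> H" "A x \<in> H" if "x \<in> D" for x
    using sym that by (auto simp: symmetric_operator_def dense_in_def)
  have symD: "ip (A x) y = ip x (A y)" if "x \<in> D" "y \<in> D" for x y
    using sym that by (auto simp: symmetric_operator_def)
  have mem_adj: "(v, w) \<in> adjoint_graph H ip G \<longleftrightarrow> v \<in> H \<and> w \<in> H \<and> (\<forall>x\<in>D. ip (A x) v = ip x w)" for v w
    by (auto simp: adjoint_graph_def G_def graph_on_def)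
  define B where "B x = A x + ?\<mu> \<odot> x" for x
  have BH: "B x \<in> H" if "x \<in> D" for x
    using DH that by (simp add: B_def)
  \<comment> \<open>Nonnegativity of A gives a bounded inverse of A + \<mu>; it turns convergence of
    \<open>B (a n)\<close> into convergence of \<open>a n\<close> below.\<close>
  have lower: "\<mu> * nrm x \<le> nrm (B x)" if "x \<in> D" for x
  proof (cases "x = 0")
    case False
    have pos: "nrm x > 0"
      using DH[OF that] nrm_eq_0[of x] nrm_nonneg[of x] False by fastforce
    have "\<mu> * (nrm x)\<^sup>2 \<le> Re (ip (B x) x)"
      using DH[OF that] A_nonneg[OF that] by (simp add: B_def ip_add_left ip_scale_left nrm_sq)
    also have "\<dots> \<le> nrm (B x) * nrm x"
      using cauchy_schwarz[OF BH DH(1)] that complex_Re_le_cmod order_trans by blast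
    finally show ?thesis
      using pos by (simp add: power2_eq_square)
  qed (use BH[OF that] nrm_nonneg in simp)
  have B_diff: "B (x - y) = B x - B y" if "x \<in> D" "y \<in> D" for x y
  proof -
    have "A (x - y) = A x - A y"
      using A_add[of "x - y" y] that subspace_diff[OF D] by (simp add: algebra_simps)
    then show ?thesis
      by (simp add: B_def scale_right_diff_distrib)
  qed
  have sub_R: "subspace (B ` D)"
  proof (rule subspaceI)
    show "0 \<in> B ` D"
      using subspace_0[OF D] A_scale[of 0 0] by (auto simp: B_def intro!: image_eqI[of _ _ 0])
    show "x + y \<in> B ` D" if xy: "x \<in> B ` D" "y \<in> B ` D" for x y
    proof -
      obtain x' y' where "x' \<in> D" "y' \<in> D" "x = B x'" "y = B y'"
        using xy by auto
      then have "x + y = B (x' + y')" "x' + y' \<in> D"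
        using A_add D by (auto simp: B_def scale_right_distrib intro: subspace_add)
      then show ?thesis by blast
    qed
    show "k \<odot> x \<in> B ` D" if x: "x \<in> B ` D" for k x
    proof -
      obtain x' where "x' \<in> D" "x = B x'"
        using x by auto
      then have "k \<odot> x = B (k \<odot> x')" "k \<odot> x' \<in> D"
        using A_scale D by (auto simp: B_def scale_right_distrib mult.commute intro: subspace_scale)
      then show ?thesis by blast
    qed
  qed
  have orth: "z = 0" if z: "z \<in> H" "\<And>q. q \<in> B ` D \<Longrightarrow> ip q z = 0" for z
  proof (rule ker[OF z(1)])
    fix x assume x: "x \<in> D"
    have "ip (B x) z = 0"
      using z x by auto
    then show "ip (A x) z = - ?\<mu> * ip x z"
      using DH[OF x] z by (simp add: B_def ip_add_left ip_scale_left add_eq_0_iff2)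
  qed
  \<comment> \<open>Symmetry of A passes to limits in the second argument.\<close>
  have closure_sub: "graph_closure H ip G \<subseteq> adjoint_graph H ip G"
  proof (rule subrelI)
    fix v w assume "(v, w) \<in> graph_closure H ip G"
    then obtain a b where vw: "v \<in> H" "w \<in> H" and ab: "\<And>n. (a n, b n) \<in> G"
      and lim: "(\<lambda>n. nrm (a n - v)) \<longlonglongrightarrow> 0" "(\<lambda>n. nrm (b n - w)) \<longlonglongrightarrow> 0"
      unfolding graph_closure_def by blast
    have aD: "a n \<in> D" "b n = A (a n)" for n
      using ab[of n] by (auto simp: G_def graph_on_def)
    have "ip (A x) v = ip x w" if x: "x \<in> D" for x
    proof (rule LIMSEQ_unique)
      show "(\<lambda>n. ip (A x) (a n)) \<longlonglongrightarrow> ip (A x) v"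
        using aD DH x vw lim by (intro tendsto_ip_right) auto
      show "(\<lambda>n. ip (A x) (a n)) \<longlonglongrightarrow> ip x w"
        using tendsto_ip_right[of b w x] aD DH x vw lim symD by simp
    qed
    then show "(v, w) \<in> adjoint_graph H ip G"
      using vw by (simp add: mem_adj)
  qed
  \<comment> \<open>For (v, w) in the adjoint the equation (A + \<mu>) p = w + \<mu> v is solved in
    the closure; the closure lies in the adjoint, so v - p is in the kernel excluded by
    \<open>ker\<close>, and (v, w) is the pair that was constructed.\<close>
  have adj_sub: "adjoint_graph H ip G \<subseteq> graph_closure H ip G"
  proof (rule subrelI)
    fix v w assume vw: "(v, w) \<in> adjoint_graph H ip G"
    then have vwH: "v \<in> H" "w \<in> H"
      by (auto simp: mem_adj)
    then have target: "w + ?\<mu> \<odot> v \<in> H"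
      by simp
    have "B ` D \<subseteq> H"
      using BH by blast
    from subspace_approximation[OF sub_R this orth target]
    obtain r where r: "\<And>n. r n \<in> B ` D" "(\<lambda>n. nrm (r n - (w + ?\<mu> \<odot> v))) \<longlonglongrightarrow> 0"
      by blast
    have "\<exists>x. x \<in> D \<and> r n = B x" for n
      using r(1)[of n] by blast
    then obtain a where a: "\<And>n. a n \<in> D" "\<And>n. r n = B (a n)"
      by metis
    have "\<exists>p\<in>H. (\<lambda>n. nrm (a n - p)) \<longlonglongrightarrow> 0"
    proof (rule complete)
      show "a n \<in> H" for n
        using a DH by blast
      fix \<epsilon> :: real assume "\<epsilon> > 0"
      then have "\<forall>\<^sub>F n in sequentially. nrm (r n - (w + ?\<mu> \<odot> v)) < \<mu> * \<epsilon> / 2"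
        using order_tendstoD(2)[OF r(2), of "\<mu> * \<epsilon> / 2"] \<mu> by simp
      then obtain N where N: "\<And>n. n \<ge> N \<Longrightarrow> nrm (r n - (w + ?\<mu> \<odot> v)) < \<mu> * \<epsilon> / 2"
        unfolding eventually_sequentially by blast
      have "nrm (a m - a n) < \<epsilon>" if mn: "m \<ge> N" "n \<ge> N" for m n
      proof -
        have H: "r m \<in> H" "r n \<in> H"
          using a BH by auto
        have "\<mu> * nrm (a m - a n) \<le> nrm (r m - r n)"
          using lower[of "a m - a n"] B_diff[of "a m" "a n"] a subspace_diff[OF D] by simp
        also have "\<dots> \<le> nrm (r m - (w + ?\<mu> \<odot> v)) + nrm (r n - (w + ?\<mu> \<odot> v))"
          using nrm_triangle_diff[OF H(1) target H(2)] nrm_minus_commute[OF target H(2)] by simp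
        also have "\<dots> < \<mu> * \<epsilon>"
          using N[OF mn(1)] N[OF mn(2)] by simp
        finally show ?thesis
          using \<mu> by simp
      qed
      then show "\<exists>N. \<forall>m\<ge>N. \<forall>n\<ge>N. nrm (a m - a n) < \<epsilon>"
        by blast
    qed
    then obtain p where p: "p \<in> H" "(\<lambda>n. nrm (a n - p)) \<longlonglongrightarrow> 0"
      by blast
    \<comment> \<open>The only possible limit of \<open>A (a n)\<close>, since
      \<open>B (a n)\<close> tends to \<open>w + ?\<mu> \<odot> v\<close> and \<open>a n\<close> to
      p.\<close>
    define q where "q = w + ?\<mu> \<odot> v - ?\<mu> \<odot> p"
    have q: "q \<in> H"
      using target p by (simp add: q_def)
    have limA: "(\<lambda>n. nrm (A (a n) - q)) \<longlonglongrightarrow> 0"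
    proof (rule Lim_null_comparison)
      show "\<forall>\<^sub>F n in sequentially. norm (nrm (A (a n) - q)) \<le> nrm (r n - (w + ?\<mu> \<odot> v)) + \<mu> * nrm (a n - p)"
      proof (rule always_eventually, rule allI)
        fix n
        have H: "a n \<in> H" "A (a n) \<in> H" "r n \<in> H"
          using a DH BH by auto
        have "A (a n) - q = (r n - (w + ?\<mu> \<odot> v)) + (- ?\<mu>) \<odot> (a n - p)"
          unfolding q_def a(2) B_def by (simp add: scale_right_diff_distrib)
        moreover have "nrm ((- ?\<mu>) \<odot> (a n - p)) = \<mu> * nrm (a n - p)"
          using H p \<mu> by (subst nrm_scale) auto
        ultimately have "nrm (A (a n) - q) \<le> nrm (r n - (w + ?\<mu> \<odot> v)) + \<mu> * nrm (a n - p)"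
          using nrm_triangle[of "r n - (w + ?\<mu> \<odot> v)" "(- ?\<mu>) \<odot> (a n - p)"] H target p
          by (simp del: scale_minus_left)
        then show "norm (nrm (A (a n) - q)) \<le> nrm (r n - (w + ?\<mu> \<odot> v)) + \<mu> * nrm (a n - p)"
          using nrm_nonneg[of "A (a n) - q"] H q by simp
      qed
      show "(\<lambda>n. nrm (r n - (w + ?\<mu> \<odot> v)) + \<mu> * nrm (a n - p)) \<longlonglongrightarrow> 0"
        using tendsto_add[OF r(2) tendsto_mult_left[OF p(2), of \<mu>]] by simp
    qed
    have pq: "(p, q) \<in> graph_closure H ip G"
      unfolding graph_closure_def mem_Collect_eq case_prod_conv
    proof (intro conjI exI)
      show "\<forall>n. (a n, A (a n)) \<in> G"
        using a by (auto simp: G_def graph_on_def)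
    qed (use p q limA in auto)
    then have pq': "(p, q) \<in> adjoint_graph H ip G"
      using closure_sub by blast
    have "v - p = 0"
    proof (rule ker)
      show "v - p \<in> H"
        using vwH p by simp
      fix x assume x: "x \<in> D"
      have "ip (A x) (v - p) = ip x w - ip x q"
        using vw pq' x DH[OF x] vwH p by (simp add: mem_adj ip_diff_right)
      also have "\<dots> = - ?\<mu> * ip x (v - p)"
        using DH[OF x] vwH p
        by (simp add: q_def ip_diff_right ip_add_right ip_scale_right algebra_simps)
      finally show "ip (A x) (v - p) = - ?\<mu> * ip x (v - p)" .
    qed
    then have "v = p" "w = q"
      by (auto simp: q_def)
    then show "(v, w) \<in> graph_closure H ip G"
      using pq by simp
  qed
  have cl: "graph_closure H ip G = adjoint_graph H ip G"
    using closure_sub adj_sub by blast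
  \<comment> \<open>An operator and its closure have the same adjoint; with \<open>cl\<close> this
    makes the closure equal to its own adjoint.\<close>
  have "adjoint_graph H ip (graph_closure H ip G) = adjoint_graph H ip G"
  proof
    have "(x, A x) \<in> graph_closure H ip G" if "x \<in> D" for x
      using that DH[OF that] symD by (auto simp: cl mem_adj)
    then show "adjoint_graph H ip (graph_closure H ip G) \<subseteq> adjoint_graph H ip G"
      by (auto simp: adjoint_graph_def G_def graph_on_def)
    show "adjoint_graph H ip G \<subseteq> adjoint_graph H ip (graph_closure H ip G)"
    proof (rule subrelI)
      fix v w assume vw: "(v, w) \<in> adjoint_graph H ip G"
      have "ip z v = ip u w" if uz: "(u, z) \<in> graph_closure H ip G" for u z
      proof -
        obtain a b where uzH: "u \<in> H" "z \<in> H" and ab: "\<And>n. (a n, b n) \<in> G"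
          and lim: "(\<lambda>n. nrm (a n - u)) \<longlonglongrightarrow> 0" "(\<lambda>n. nrm (b n - z)) \<longlonglongrightarrow> 0"
          using uz unfolding graph_closure_def by blast
        have aD: "a n \<in> D" "b n = A (a n)" for n
          using ab[of n] by (auto simp: G_def graph_on_def)
        show ?thesis
        proof (rule LIMSEQ_unique)
          show "(\<lambda>n. ip (b n) v) \<longlonglongrightarrow> ip z v"
            using aD DH uzH vw lim by (intro tendsto_ip_left) (auto simp: mem_adj)
          show "(\<lambda>n. ip (b n) v) \<longlonglongrightarrow> ip u w"
            using tendsto_ip_left[of a u w] aD DH uzH vw lim by (simp add: mem_adj)
        qed
      qed
      then show "(v, w) \<in> adjoint_graph H ip (graph_closure H ip G)"
        using vw by (auto simp: adjoint_graph_def)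
    qed
  qed
  then have "adjoint_graph H ip (graph_closure H ip G) = graph_closure H ip G"
    using cl by simp
  moreover have "dense_in H ip (Domain (graph_closure H ip G))"
  proof -
    have "D \<subseteq> Domain (graph_closure H ip G)"
    proof
      fix x assume "x \<in> D"
      then have "(x, A x) \<in> graph_closure H ip G"
        using DH symD by (simp add: cl mem_adj)
      then show "x \<in> Domain (graph_closure H ip G)"
        by blast
    qed
    moreover have "Domain (graph_closure H ip G) \<subseteq> H"
      by (auto simp: graph_closure_def)
    moreover have "dense_in H ip D"
      using sym by (simp add: symmetric_operator_def)
    ultimately show ?thesis
      unfolding dense_in_def by blast
  qed
  ultimately show ?thesis
    using sym by (simp add: essentially_self_adjoint_def self_adjoint_graph_def G_def)
qed

end

section \<open>Weighted square-summable functions\<close>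

text \<open>Nothing is asked off the index set, nor any symmetry: vanishing, skewness and
  alternation are imposed separately, so one theory serves vertices, edges and faces.\<close>

definition wl2 :: "('i \<Rightarrow> real) \<Rightarrow> 'i set \<Rightarrow> ('i \<Rightarrow> complex) set" where
  "wl2 w I = {f. (\<lambda>i. w i * (cmod (f i))\<^sup>2) summable_on I}"

definition wsq :: "('i \<Rightarrow> real) \<Rightarrow> 'i set \<Rightarrow> ('i \<Rightarrow> complex) \<Rightarrow> real" where
  "wsq w I f = (\<Sum>\<^sub>\<infinity>i\<in>I. w i * (cmod (f i))\<^sup>2)"

definition wip :: "('i \<Rightarrow> real) \<Rightarrow> 'i set \<Rightarrow> ('i \<Rightarrow> complex) \<Rightarrow> ('i \<Rightarrow> complex) \<Rightarrow> complex" where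
  "wip w I f g = (\<Sum>\<^sub>\<infinity>i\<in>I. complex_of_real (w i) * f i * cnj (g i))"

lemma cmod_add_sq_le: "(cmod (a + b))\<^sup>2 \<le> 2 * (cmod a)\<^sup>2 + 2 * (cmod b)\<^sup>2"
proof -
  have "(cmod (a + b))\<^sup>2 \<le> (cmod a + cmod b)\<^sup>2"
    by (intro power_mono norm_triangle_ineq) auto
  also have "\<dots> \<le> 2 * (cmod a)\<^sup>2 + 2 * (cmod b)\<^sup>2"
    using zero_le_power2[of "cmod a - cmod b"] by (simp add: power2_eq_square algebra_simps)
  finally show ?thesis .
qed

locale weighted_index =
  fixes w :: "'i \<Rightarrow> real" and I :: "'i set"
  assumes w_pos: "i \<in> I \<Longrightarrow> 0 < w i"
begin

lemma w_nonneg: "i \<in> I \<Longrightarrow> 0 \<le> w i"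
  using w_pos less_imp_le by blast

lemma wl2_zero [simp]: "0 \<in> wl2 w I"
  by (simp add: wl2_def)

lemma wl2_scale: "f \<in> wl2 w I \<Longrightarrow> (\<lambda>i. k * f i) \<in> wl2 w I"
  using summable_on_cmult_right[of "\<lambda>i. w i * (cmod (f i))\<^sup>2" I "(cmod k)\<^sup>2"]
  by (simp add: wl2_def norm_mult power_mult_distrib algebra_simps)

lemma wl2_add:
  assumes "f \<in> wl2 w I" "g \<in> wl2 w I"
  shows "f + g \<in> wl2 w I"
proof -
  have "(\<lambda>i. 2 * (w i * (cmod (f i))\<^sup>2) + 2 * (w i * (cmod (g i))\<^sup>2)) summable_on I"
    using assms by (intro summable_on_add summable_on_cmult_right) (auto simp: wl2_def)
  then have "(\<lambda>i. w i * (cmod (f i + g i))\<^sup>2) summable_on I"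
  proof (rule summable_on_comparison_test)
    fix i assume i: "i \<in> I"
    show "w i * (cmod (f i + g i))\<^sup>2 \<le> 2 * (w i * (cmod (f i))\<^sup>2) + 2 * (w i * (cmod (g i))\<^sup>2)"
      using mult_left_mono[OF cmod_add_sq_le w_nonneg[OF i], of "f i" "g i"] by (simp add: algebra_simps)
    show "0 \<le> w i * (cmod (f i + g i))\<^sup>2"
      using w_nonneg[OF i] by simp
  qed
  then show ?thesis
    by (simp add: wl2_def)
qed

lemma wl2_diff:
  assumes "f \<in> wl2 w I" "g \<in> wl2 w I"
  shows "f - g \<in> wl2 w I"
proof -
  have "f - g = f + (\<lambda>i. (-1) * g i)"
    by auto
  then show ?thesis
    using wl2_add[OF assms(1) wl2_scale[OF assms(2), of "-1"]] by (simp only:)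
qed

lemma wip_summable:
  assumes "f \<in> wl2 w I" "g \<in> wl2 w I"
  shows "(\<lambda>i. complex_of_real (w i) * f i * cnj (g i)) summable_on I"
proof (rule abs_summable_summable, rule Infinite_Sum.abs_summable_on_comparison_test')
  show "(\<lambda>i. w i * (cmod (f i))\<^sup>2 + w i * (cmod (g i))\<^sup>2) summable_on I"
    using assms by (intro summable_on_add) (auto simp: wl2_def)
  fix i assume i: "i \<in> I"
  have "cmod (f i) * cmod (g i) \<le> (cmod (f i))\<^sup>2 + (cmod (g i))\<^sup>2"
    using sum_squares_bound[of "cmod (f i)" "cmod (g i)"] mult_nonneg_nonneg[of "cmod (f i)" "cmod (g i)"]
    by (simp del: mult_nonneg_nonneg zero_le_mult_iff)
  from mult_left_mono[OF this w_nonneg[OF i]]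
  show "norm (complex_of_real (w i) * f i * cnj (g i)) \<le> w i * (cmod (f i))\<^sup>2 + w i * (cmod (g i))\<^sup>2"
    using w_nonneg[OF i] by (simp add: norm_mult algebra_simps)
qed

lemma wip_add_left:
  assumes "f \<in> wl2 w I" "g \<in> wl2 w I" "h \<in> wl2 w I"
  shows "wip w I (f + g) h = wip w I f h + wip w I g h"
  using infsum_add[OF wip_summable[OF assms(1,3)] wip_summable[OF assms(2,3)]]
  by (simp add: wip_def algebra_simps)

lemma wip_scale_left: "wip w I (\<lambda>i. k * f i) h = k * wip w I f h"
  using infsum_cmult_right'[of k "\<lambda>i. complex_of_real (w i) * f i * cnj (h i)" I]
  by (simp add: wip_def algebra_simps)

lemma wip_commute: "wip w I g f = cnj (wip w I f g)"
  by (simp add: wip_def mult.commute mult.left_commute flip: infsum_cnj)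

lemma wip_self:
  assumes "f \<in> wl2 w I"
  shows "wip w I f f = complex_of_real (wsq w I f)"
proof -
  have "complex_of_real (w i) * f i * cnj (f i) = complex_of_real (w i * (cmod (f i))\<^sup>2)" for i
    by (simp add: complex_norm_square mult.assoc flip: of_real_power)
  then show ?thesis
    unfolding wip_def wsq_def
    by (simp only:, intro infsumI has_sum_of_real has_sum_infsum) (use assms in \<open>simp add: wl2_def\<close>)
qed

lemma wsq_nonneg [simp]: "0 \<le> wsq w I f"
  unfolding wsq_def by (intro infsum_nonneg) (simp add: w_nonneg)

lemma sum_le_wsq: "f \<in> wl2 w I \<Longrightarrow> finite F \<Longrightarrow> F \<subseteq> I \<Longrightarrow> (\<Sum>i\<in>F. w i * (cmod (f i))\<^sup>2) \<le> wsq w I f"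
  unfolding wsq_def wl2_def by (intro finite_sum_le_infsum) (auto simp: w_nonneg)

lemma wsq_eq_0: "f \<in> wl2 w I \<Longrightarrow> wsq w I f = 0 \<Longrightarrow> i \<in> I \<Longrightarrow> f i = 0"
  using nonneg_infsum_le_0D[of "\<lambda>i. w i * (cmod (f i))\<^sup>2" I i] w_pos[of i] w_nonneg
  by (simp add: wsq_def wl2_def)

section \<open>Completeness and tails of the weighted spaces\<close>

lemma wl2_bounded:
  assumes "\<And>F. finite F \<Longrightarrow> F \<subseteq> I \<Longrightarrow> (\<Sum>i\<in>F. w i * (cmod (f i))\<^sup>2) \<le> b"
  shows "f \<in> wl2 w I" "wsq w I f \<le> b"
proof -
  have "(\<lambda>i. w i * (cmod (f i))\<^sup>2) summable_on I"
    using assms by (intro nonneg_bdd_above_summable_on bdd_aboveI2[where M = b]) (auto simp: w_nonneg)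
  then show "f \<in> wl2 w I" "wsq w I f \<le> b"
    using assms by (auto simp: wl2_def wsq_def intro: infsum_le_finite_sums)
qed

text \<open>The limit is built pointwise. Pointwise convergence and the value zero off I are part of
  the conclusion because skewness, alternation and vanishing off the cells are inherited by the
  limit through them.\<close>

lemma wl2_complete:
  assumes f: "\<And>n::nat. f n \<in> wl2 w I"
    and cauchy: "\<And>\<epsilon>. \<epsilon> > 0 \<Longrightarrow> \<exists>N. \<forall>m\<ge>N. \<forall>n\<ge>N. wsq w I (f m - f n) < \<epsilon>"
  shows "\<exists>g\<in>wl2 w I. (\<forall>i\<in>I. (\<lambda>n. f n i) \<longlonglongrightarrow> g i) \<and> (\<forall>i. i \<notin> I \<longrightarrow> g i = 0) \<and>
           (\<lambda>n. wsq w I (f n - g)) \<longlonglongrightarrow> 0"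
proof -
  have "Cauchy (\<lambda>n. f n i)" if i: "i \<in> I" for i
  proof (rule metric_CauchyI)
    fix e :: real assume "e > 0"
    then have "w i * e\<^sup>2 > 0"
      using w_pos[OF i] by simp
    from cauchy[OF this] obtain N where N: "\<And>m n. m \<ge> N \<Longrightarrow> n \<ge> N \<Longrightarrow> wsq w I (f m - f n) < w i * e\<^sup>2"
      by blast
    have "dist (f m i) (f n i) < e" if "m \<ge> N" "n \<ge> N" for m n
    proof -
      have "w i * (cmod ((f m - f n) i))\<^sup>2 < w i * e\<^sup>2"
        using N[OF that] sum_le_wsq[OF wl2_diff[OF f[of m] f[of n]], of "{i}"] i by simp
      then have "(cmod (f m i - f n i))\<^sup>2 < e\<^sup>2"
        using w_pos[OF i] by simp
      then show ?thesis
        using \<open>e > 0\<close> by (auto simp: dist_norm intro: power_less_imp_less_base)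
    qed
    then show "\<exists>N. \<forall>m\<ge>N. \<forall>n\<ge>N. dist (f m i) (f n i) < e"
      by blast
  qed
  then have "\<forall>i. \<exists>l. i \<in> I \<longrightarrow> (\<lambda>n. f n i) \<longlonglongrightarrow> l"
    using Cauchy_convergent convergent_def by blast
  then obtain l where l: "\<And>i. i \<in> I \<Longrightarrow> (\<lambda>n. f n i) \<longlonglongrightarrow> l i"
    by metis
  define g where "g i = (if i \<in> I then l i else 0)" for i
  have g: "(\<lambda>n. f n i) \<longlonglongrightarrow> g i" if "i \<in> I" for i
    using l that by (simp add: g_def)
  \<comment> \<open>With n fixed and m tending to infinity in a finite partial sum, the Cauchy bound
    survives; the partial sums then bound the whole series.\<close>
  have close: "f n - g \<in> wl2 w I \<and> wsq w I (f n - g) \<le> \<epsilon>"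
    if N: "\<And>m n. m \<ge> N \<Longrightarrow> n \<ge> N \<Longrightarrow> wsq w I (f m - f n) < \<epsilon>" and n: "n \<ge> N" for N n \<epsilon>
  proof -
    have "(\<Sum>i\<in>F. w i * (cmod ((f n - g) i))\<^sup>2) \<le> \<epsilon>" if F: "finite F" "F \<subseteq> I" for F
    proof (rule LIMSEQ_le_const2)
      show "(\<lambda>m. \<Sum>i\<in>F. w i * (cmod ((f n - f m) i))\<^sup>2) \<longlonglongrightarrow> (\<Sum>i\<in>F. w i * (cmod ((f n - g) i))\<^sup>2)"
        using F g by (auto intro!: tendsto_intros)
      have "(\<Sum>i\<in>F. w i * (cmod ((f n - f m) i))\<^sup>2) \<le> \<epsilon>" if "m \<ge> N" for m
        using sum_le_wsq[OF wl2_diff[OF f[of n] f[of m]] F] N[OF n that] by simp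
      then show "\<exists>N. \<forall>m\<ge>N. (\<Sum>i\<in>F. w i * (cmod ((f n - f m) i))\<^sup>2) \<le> \<epsilon>"
        by blast
    qed
    then show ?thesis
      using wl2_bounded[of "f n - g" \<epsilon>] by blast
  qed
  have "g \<in> wl2 w I"
  proof -
    obtain N where "\<And>m n. m \<ge> N \<Longrightarrow> n \<ge> N \<Longrightarrow> wsq w I (f m - f n) < 1"
      using cauchy[of 1] by auto
    then have "f N - g \<in> wl2 w I"
      using close by blast
    then have "f N - (f N - g) \<in> wl2 w I"
      by (rule wl2_diff[OF f])
    moreover have "f N - (f N - g) = g"
      by (simp add: fun_eq_iff)
    ultimately show ?thesis
      by (simp only:)
  qed
  moreover have "(\<lambda>n. wsq w I (f n - g)) \<longlonglongrightarrow> 0"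
  proof (rule LIMSEQ_I)
    fix \<epsilon> :: real assume "\<epsilon> > 0"
    then have "\<epsilon> / 2 > 0" by simp
    from cauchy[OF this] obtain N where "\<And>m n. m \<ge> N \<Longrightarrow> n \<ge> N \<Longrightarrow> wsq w I (f m - f n) < \<epsilon> / 2"
      by blast
    from close[OF this] have "norm (wsq w I (f n - g) - 0) < \<epsilon>" if "n \<ge> N" for n
      using that \<open>\<epsilon> > 0\<close> by fastforce
    then show "\<exists>N. \<forall>n\<ge>N. norm (wsq w I (f n - g) - 0) < \<epsilon>"
      by blast
  qed
  ultimately show ?thesis
    using g by (intro bexI[of _ g]) (auto simp: g_def)
qed

text \<open>Stated for all finite sets above F0, because tail sets have to be enlarged to sets
  closed under permutations of the entries.\<close>

lemma wl2_tail:
  assumes "f \<in> wl2 w I" "\<epsilon> > 0"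
  shows "\<exists>F0. finite F0 \<and> F0 \<subseteq> I \<and>
    (\<forall>F. finite F \<longrightarrow> F0 \<subseteq> F \<longrightarrow> F \<subseteq> I \<longrightarrow> wsq w I f - \<epsilon> < (\<Sum>i\<in>F. w i * (cmod (f i))\<^sup>2))"
proof -
  obtain F0 where F0: "finite F0" "F0 \<subseteq> I"
    "dist (\<Sum>i\<in>F0. w i * (cmod (f i))\<^sup>2) (wsq w I f) \<le> \<epsilon> / 2"
    using infsum_finite_approximation[of "\<lambda>i. w i * (cmod (f i))\<^sup>2" I "\<epsilon> / 2"] assms
    by (auto simp: wl2_def wsq_def)
  have "wsq w I f - \<epsilon> < (\<Sum>i\<in>F. w i * (cmod (f i))\<^sup>2)" if F: "finite F" "F0 \<subseteq> F" "F \<subseteq> I" for F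
  proof -
    have "(\<Sum>i\<in>F0. w i * (cmod (f i))\<^sup>2) \<le> (\<Sum>i\<in>F. w i * (cmod (f i))\<^sup>2)"
      using F by (intro sum_mono2) (auto simp: w_nonneg)
    then show ?thesis
      using F0(3) \<open>\<epsilon> > 0\<close> unfolding dist_real_def by linarith
  qed
  then show ?thesis
    using F0 by blast
qed

lemma wsq_truncation:
  assumes f: "f \<in> wl2 w I" and F: "finite F" "F \<subseteq> I"
  shows "wsq w I ((\<lambda>i. of_bool (i \<in> F) * f i) - f) = wsq w I f - (\<Sum>i\<in>F. w i * (cmod (f i))\<^sup>2)"
proof -
  have "wsq w I ((\<lambda>i. of_bool (i \<in> F) * f i) - f)
      = (\<Sum>\<^sub>\<infinity>i\<in>I. w i * (cmod (f i))\<^sup>2 - (if i \<in> F then w i * (cmod (f i))\<^sup>2 else 0))"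
    unfolding wsq_def by (intro infsum_cong) auto
  also have "\<dots> = wsq w I f - (\<Sum>\<^sub>\<infinity>i\<in>I. if i \<in> F then w i * (cmod (f i))\<^sup>2 else 0)"
  proof -
    have F_summable: "(\<lambda>i. if i \<in> F then w i * (cmod (f i))\<^sup>2 else 0) summable_on I"
      using F summable_on_cong_neutral[of F I "\<lambda>i. w i * (cmod (f i))\<^sup>2"
        "\<lambda>i. if i \<in> F then w i * (cmod (f i))\<^sup>2 else 0"] by auto
    have "(\<lambda>i. w i * (cmod (f i))\<^sup>2 - (if i \<in> F then w i * (cmod (f i))\<^sup>2 else 0)) summable_on I"
      using f unfolding wl2_def mem_Collect_eq by (rule summable_on_comparison_test) (auto simp: w_nonneg)
    from infsum_add[OF this F_summable] show ?thesis
      by (simp add: wsq_def)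
  qed
  also have "(\<Sum>\<^sub>\<infinity>i\<in>I. if i \<in> F then w i * (cmod (f i))\<^sup>2 else 0) = (\<Sum>i\<in>F. w i * (cmod (f i))\<^sup>2)"
    using F infsum_cong_neutral[of F I "\<lambda>i. w i * (cmod (f i))\<^sup>2"
        "\<lambda>i. if i \<in> F then w i * (cmod (f i))\<^sup>2 else 0"] by auto
  finally show ?thesis .
qed

end

section \<open>The Hilbert space of a weighted triangulation\<close>

fun scale_cochain :: "complex \<Rightarrow> 'v cochain \<Rightarrow> 'v cochain" where
  "scale_cochain k (f, \<phi>, \<psi>) = (\<lambda>x. k * f x, \<lambda>e. k * \<phi> e, \<lambda>t. k * \<psi> t)"

interpretation cochain: vector_space scale_cochain
  by unfold_locales (auto simp: plus_fun_def algebra_simps)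

declare ip_triang.simps [simp del]

text \<open>Restricting by vertices keeps all orientations of a cell together, so truncated cochains
  stay skew or alternating and finite sums may be reindexed by swaps and cycles.\<close>

definition edges_in :: "'v triangulation \<Rightarrow> 'v set \<Rightarrow> ('v \<times> 'v) set" where
  "edges_in T X = {(x, y) \<in> edges T. x \<in> X \<and> y \<in> X}"

definition faces_in :: "'v triangulation \<Rightarrow> 'v set \<Rightarrow> ('v \<times> 'v \<times> 'v) set" where
  "faces_in T X = {(x, y, z) \<in> faces T. x \<in> X \<and> y \<in> X \<and> z \<in> X}"

lemma finite_edges_in [simp]: "finite X \<Longrightarrow> finite (edges_in T X)"
  by (rule finite_subset[of _ "X \<times> X"]) (auto simp: edges_in_def)

lemma finite_faces_in [simp]: "finite X \<Longrightarrow> finite (faces_in T X)"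
  by (rule finite_subset[of _ "X \<times> X \<times> X"]) (auto simp: faces_in_def)

lemma edges_in_subset: "edges_in T X \<subseteq> edges T"
  by (auto simp: edges_in_def)

lemma faces_in_subset: "faces_in T X \<subseteq> faces T"
  by (auto simp: faces_in_def)

context weighted_magnetic_triangulation
begin

lemma edge_swap: "(x, y) \<in> edges T \<Longrightarrow> (y, x) \<in> edges T"
  using edges_sym by (rule symD)

lemma edge_verts: "(x, y) \<in> edges T \<Longrightarrow> x \<in> verts T" "(x, y) \<in> edges T \<Longrightarrow> y \<in> verts T"
  using edges_subset by auto

lemma face_edges:
  "(x, y, z) \<in> faces T \<Longrightarrow> (x, y) \<in> edges T"
  "(x, y, z) \<in> faces T \<Longrightarrow> (y, z) \<in> edges T"
  "(x, y, z) \<in> faces T \<Longrightarrow> (x, z) \<in> edges T"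
  "(x, y, z) \<in> faces T \<Longrightarrow> (z, x) \<in> edges T"
  using faces_adjacent edge_swap by blast+

lemma face_perm:
  assumes "(x, y, z) \<in> faces T"
  shows "(y, x, z) \<in> faces T" "(y, z, x) \<in> faces T" "(z, x, y) \<in> faces T" "(x, z, y) \<in> faces T"
    "(z, y, x) \<in> faces T"
  using faces_swap faces_cycle assms by blast+

section \<open>The three summands and their Hilbert sum\<close>

sublocale V: weighted_index "cw T" "verts T"
  by unfold_locales (rule cw_pos)

text \<open>The factors 1/2 and 1/6 of the inner products are absorbed into the weights.\<close>

sublocale E: weighted_index "\<lambda>e. rw T e / 2" "edges T"
  by unfold_locales (simp add: rw_pos)

sublocale F: weighted_index "\<lambda>t. sw T t / 6" "faces T"
  by unfold_locales (simp add: sw_pos)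

lemma l2_verts_eq: "l2_verts T = C_verts T \<inter> wl2 (cw T) (verts T)"
  by (auto simp: l2_verts_def wl2_def)

lemma l2_edges_eq: "l2_edges T = C_edges T \<inter> wl2 (\<lambda>e. rw T e / 2) (edges T)"
  using summable_on_cmult_right'[of "1/2::real" "\<lambda>e. rw T e * (cmod (\<phi> e))\<^sup>2" "edges T" for \<phi>]
  by (auto simp: l2_edges_def wl2_def)

lemma l2_faces_eq: "l2_faces T = C_faces T \<inter> wl2 (\<lambda>t. sw T t / 6) (faces T)"
  using summable_on_cmult_right'[of "1/6::real" "\<lambda>t. sw T t * (cmod (\<psi> t))\<^sup>2" "faces T" for \<psi>]
  by (auto simp: l2_faces_def wl2_def)

lemma ip_triang_eq: "ip_triang T (f, \<phi>, \<psi>) (f', \<phi>', \<psi>') = wip (cw T) (verts T) f f'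
    + wip (\<lambda>e. rw T e / 2) (edges T) \<phi> \<phi>' + wip (\<lambda>t. sw T t / 6) (faces T) \<psi> \<psi>'"
proof -
  have "ip_edges T \<phi> \<phi>' = wip (\<lambda>e. rw T e / 2) (edges T) \<phi> \<phi>'"
    unfolding ip_edges_def wip_def infsum_cmult_right'[symmetric] by (intro infsum_cong) simp
  moreover have "ip_faces T \<psi> \<psi>' = wip (\<lambda>t. sw T t / 6) (faces T) \<psi> \<psi>'"
    unfolding ip_faces_def wip_def infsum_cmult_right'[symmetric] by (intro infsum_cong) simp
  ultimately show ?thesis
    by (simp add: ip_triang.simps ip_verts_def wip_def)
qed

abbreviation sqV :: "('v \<Rightarrow> complex) \<Rightarrow> real" where
  "sqV \<equiv> wsq (cw T) (verts T)"

abbreviation sqE :: "('v \<times> 'v \<Rightarrow> complex) \<Rightarrow> real" where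
  "sqE \<equiv> wsq (\<lambda>e. rw T e / 2) (edges T)"

abbreviation sqF :: "('v \<times> 'v \<times> 'v \<Rightarrow> complex) \<Rightarrow> real" where
  "sqF \<equiv> wsq (\<lambda>t. sw T t / 6) (faces T)"

definition sqnorm :: "'v cochain \<Rightarrow> real" where
  "sqnorm u = sqV (fst u) + sqE (fst (snd u))
    + sqF (snd (snd u))"

lemma l2_triang_iff: "u \<in> l2_triang T \<longleftrightarrow>
    fst u \<in> C_verts T \<and> fst (snd u) \<in> C_edges T \<and> snd (snd u) \<in> C_faces T \<and>
    fst u \<in> wl2 (cw T) (verts T) \<and> fst (snd u) \<in> wl2 (\<lambda>e. rw T e / 2) (edges T) \<and>
    snd (snd u) \<in> wl2 (\<lambda>t. sw T t / 6) (faces T)"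
  by (cases u) (auto simp: l2_triang_def l2_verts_eq l2_edges_eq l2_faces_eq)

lemma ip_triang_self: "u \<in> l2_triang T \<Longrightarrow> ip_triang T u u = complex_of_real (sqnorm u)"
  by (cases u) (auto simp: l2_triang_iff ip_triang_eq sqnorm_def V.wip_self E.wip_self F.wip_self)

lemma ip_norm_triang: "u \<in> l2_triang T \<Longrightarrow> ip_norm (ip_triang T) u = sqrt (sqnorm u)"
  by (simp add: ip_norm_def ip_triang_self)

lemma sqnorm_nonneg [simp]: "0 \<le> sqnorm u"
  by (simp add: sqnorm_def)

lemma C_off:
  "f \<in> C_verts T \<Longrightarrow> x \<notin> verts T \<Longrightarrow> f x = 0"
  "\<phi> \<in> C_edges T \<Longrightarrow> e \<notin> edges T \<Longrightarrow> \<phi> e = 0"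
  "\<psi> \<in> C_faces T \<Longrightarrow> t \<notin> faces T \<Longrightarrow> \<psi> t = 0"
  unfolding C_verts_def C_edges_def C_faces_def by blast+

text \<open>Valid for all pairs, since the edge set is symmetric and the cochain vanishes off it;
  rewriting then carries no membership condition.\<close>

lemma C_edges_skew:
  assumes "\<phi> \<in> C_edges T"
  shows "\<phi> (y, x) = - \<phi> (x, y)"
proof (cases "(y, x) \<in> edges T")
  case True
  then show ?thesis
    using assms unfolding C_edges_def by blast
next
  case False
  then have "(x, y) \<notin> edges T"
    using edge_swap by blast
  then show ?thesis
    using False C_off(2)[OF assms] by simp
qed

lemma C_faces_alternating:
  assumes "\<psi> \<in> C_faces T"
  shows "\<psi> (y, x, z) = - \<psi> (x, y, z)" "\<psi> (y, z, x) = \<psi> (x, y, z)"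
proof -
  have "\<psi> (y, x, z) = - \<psi> (x, y, z) \<and> \<psi> (y, z, x) = \<psi> (x, y, z)"
  proof (cases "(x, y, z) \<in> faces T")
    case True
    then show ?thesis
      using assms unfolding C_faces_def by blast
  next
    case False
    then have "(y, x, z) \<notin> faces T" "(y, z, x) \<notin> faces T"
      using face_perm by blast+
    then show ?thesis
      using False C_off(3)[OF assms] by simp
  qed
  then show "\<psi> (y, x, z) = - \<psi> (x, y, z)" "\<psi> (y, z, x) = \<psi> (x, y, z)"
    by blast+
qed

lemma C_edges_mult:
  assumes "\<phi> \<in> C_edges T" "\<And>x y. (x, y) \<in> edges T \<Longrightarrow> \<theta> (x, y) = \<theta> (y, x)"
  shows "(\<lambda>e. \<theta> e * \<phi> e) \<in> C_edges T"
  unfolding C_edges_def mem_Collect_eq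
proof (intro conjI allI impI)
  fix x y assume "(x, y) \<in> edges T"
  then show "\<theta> (x, y) * \<phi> (x, y) = - (\<theta> (y, x) * \<phi> (y, x))"
    using assms(2)[of x y] C_edges_skew[OF assms(1), of y x] by simp
qed (simp add: C_off(2)[OF assms(1)])

lemma C_faces_mult:
  assumes "\<psi> \<in> C_faces T"
    and "\<And>x y z. (x, y, z) \<in> faces T \<Longrightarrow> \<theta> (y, x, z) = \<theta> (x, y, z) \<and> \<theta> (y, z, x) = \<theta> (x, y, z)"
  shows "(\<lambda>t. \<theta> t * \<psi> t) \<in> C_faces T"
  unfolding C_faces_def mem_Collect_eq
proof (intro conjI allI impI)
  fix x y z assume "(x, y, z) \<in> faces T"
  from assms(2)[OF this]
  show "\<theta> (y, x, z) * \<psi> (y, x, z) = - (\<theta> (x, y, z) * \<psi> (x, y, z))"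
    "\<theta> (y, z, x) * \<psi> (y, z, x) = \<theta> (x, y, z) * \<psi> (x, y, z)"
    using C_faces_alternating[OF assms(1), where x = x and y = y and z = z] by simp_all
qed (simp add: C_off(3)[OF assms(1)])

lemma edges_in_swap: "(x, y) \<in> edges_in T X \<Longrightarrow> (y, x) \<in> edges_in T X"
  by (auto simp: edges_in_def edge_swap)

lemma faces_in_perm:
  assumes "(x, y, z) \<in> faces_in T X"
  shows "(y, x, z) \<in> faces_in T X" "(y, z, x) \<in> faces_in T X" "(z, x, y) \<in> faces_in T X"
    "(x, z, y) \<in> faces_in T X" "(z, y, x) \<in> faces_in T X"
  using assms face_perm[of x y z] by (simp_all add: faces_in_def)

lemma C_verts_add: "f \<in> C_verts T \<Longrightarrow> g \<in> C_verts T \<Longrightarrow> f + g \<in> C_verts T"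
  by (simp add: C_verts_def)

lemma C_edges_add: "f \<in> C_edges T \<Longrightarrow> g \<in> C_edges T \<Longrightarrow> f + g \<in> C_edges T"
  by (simp add: C_edges_def)

lemma C_faces_add: "f \<in> C_faces T \<Longrightarrow> g \<in> C_faces T \<Longrightarrow> f + g \<in> C_faces T"
  by (simp add: C_faces_def)

lemma C_verts_scale: "f \<in> C_verts T \<Longrightarrow> (\<lambda>x. k * f x) \<in> C_verts T"
  by (simp add: C_verts_def)

lemma C_edges_scale: "f \<in> C_edges T \<Longrightarrow> (\<lambda>x. k * f x) \<in> C_edges T"
  by (auto simp: C_edges_def)

lemma C_faces_scale: "f \<in> C_faces T \<Longrightarrow> (\<lambda>x. k * f x) \<in> C_faces T"
  by (auto simp: C_faces_def)

lemma C_edges_limit: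
  assumes "\<And>n::nat. f n \<in> C_edges T" "\<And>e. e \<in> edges T \<Longrightarrow> (\<lambda>n. f n e) \<longlonglongrightarrow> g e"
    and "\<And>e. e \<notin> edges T \<Longrightarrow> g e = 0"
  shows "g \<in> C_edges T"
proof -
  have "g (x, y) = - g (y, x)" if xy: "(x, y) \<in> edges T" for x y
  proof (rule LIMSEQ_unique)
    show "(\<lambda>n. f n (x, y)) \<longlonglongrightarrow> g (x, y)"
      using assms(2)[OF xy] .
    have "(\<lambda>n. f n (x, y)) = (\<lambda>n. - f n (y, x))"
      using assms(1) xy by (auto simp: C_edges_def)
    then show "(\<lambda>n. f n (x, y)) \<longlonglongrightarrow> - g (y, x)"
      using tendsto_minus[OF assms(2)[OF edge_swap[OF xy]]] by simp
  qed
  then show ?thesis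
    using assms(3) by (auto simp: C_edges_def)
qed

lemma C_faces_limit:
  assumes "\<And>n::nat. f n \<in> C_faces T" "\<And>t. t \<in> faces T \<Longrightarrow> (\<lambda>n. f n t) \<longlonglongrightarrow> g t"
    and "\<And>t. t \<notin> faces T \<Longrightarrow> g t = 0"
  shows "g \<in> C_faces T"
proof -
  have "g (y, x, z) = - g (x, y, z) \<and> g (y, z, x) = g (x, y, z)" if t: "(x, y, z) \<in> faces T" for x y z
  proof (intro conjI; rule LIMSEQ_unique)
    show "(\<lambda>n. f n (y, x, z)) \<longlonglongrightarrow> g (y, x, z)" "(\<lambda>n. f n (y, z, x)) \<longlonglongrightarrow> g (y, z, x)"
      using assms(2) face_perm[OF t] by auto
    have "(\<lambda>n. f n (y, x, z)) = (\<lambda>n. - f n (x, y, z))" "(\<lambda>n. f n (y, z, x)) = (\<lambda>n. f n (x, y, z))"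
      using assms(1) t by (auto simp: C_faces_def)
    then show "(\<lambda>n. f n (y, x, z)) \<longlonglongrightarrow> - g (x, y, z)" "(\<lambda>n. f n (y, z, x)) \<longlonglongrightarrow> g (x, y, z)"
      using tendsto_minus[OF assms(2)[OF t]] assms(2)[OF t] by simp_all
  qed
  then show ?thesis
    using assms(3) by (auto simp: C_faces_def)
qed

lemma l2_triang_add: "u \<in> l2_triang T \<Longrightarrow> v \<in> l2_triang T \<Longrightarrow> u + v \<in> l2_triang T"
  by (cases u, cases v)
    (simp add: l2_triang_iff C_verts_add C_edges_add C_faces_add V.wl2_add E.wl2_add F.wl2_add)

lemma l2_triang_scale: "u \<in> l2_triang T \<Longrightarrow> scale_cochain k u \<in> l2_triang T"
  by (cases u)
    (simp add: l2_triang_iff C_verts_scale C_edges_scale C_faces_scale V.wl2_scale E.wl2_scale F.wl2_scale)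

lemma l2_triang_diff: "u \<in> l2_triang T \<Longrightarrow> v \<in> l2_triang T \<Longrightarrow> u - v \<in> l2_triang T"
  using l2_triang_add[of u "scale_cochain (-1) v"] l2_triang_scale[of v "-1"]
    cochain.scale_minus_left[of 1 v] cochain.scale_one[of v] by simp

lemma l2_triang_complete:
  assumes a: "\<And>n. a n \<in> l2_triang T"
    and cauchy: "\<And>\<epsilon>. \<epsilon> > 0 \<Longrightarrow> \<exists>N. \<forall>m\<ge>N. \<forall>n\<ge>N. ip_norm (ip_triang T) (a m - a n) < \<epsilon>"
  shows "\<exists>l\<in>l2_triang T. (\<lambda>n. ip_norm (ip_triang T) (a n - l)) \<longlonglongrightarrow> 0"
proof -
  have *: "\<exists>N. \<forall>m\<ge>N. \<forall>n\<ge>N. sqnorm (a m - a n) < \<epsilon>" if "\<epsilon> > 0" for \<epsilon>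
  proof -
    obtain N where "\<And>m n. m \<ge> N \<Longrightarrow> n \<ge> N \<Longrightarrow> sqrt (sqnorm (a m - a n)) < sqrt \<epsilon>"
      using cauchy[of "sqrt \<epsilon>"] \<open>\<epsilon> > 0\<close> by (auto simp: ip_norm_triang a l2_triang_diff)
    then show ?thesis
      by (intro exI[of _ N]) simp
  qed
  note mem = a[unfolded l2_triang_iff]
  have "\<exists>N. \<forall>m\<ge>N. \<forall>n\<ge>N. sqV (fst (a m) - fst (a n)) < \<epsilon>" (is ?A)
    "\<exists>N. \<forall>m\<ge>N. \<forall>n\<ge>N. sqE (fst (snd (a m)) - fst (snd (a n))) < \<epsilon>" (is ?B)
    "\<exists>N. \<forall>m\<ge>N. \<forall>n\<ge>N. sqF (snd (snd (a m)) - snd (snd (a n))) < \<epsilon>" (is ?C)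
    if eps: "\<epsilon> > 0" for \<epsilon>
  proof -
    obtain N where N: "\<And>m n. m \<ge> N \<Longrightarrow> n \<ge> N \<Longrightarrow> sqnorm (a m - a n) < \<epsilon>"
      using *[OF eps] by blast
    have "sqV (fst (a m) - fst (a n)) < \<epsilon> \<and>
      sqE (fst (snd (a m)) - fst (snd (a n))) < \<epsilon> \<and>
      sqF (snd (snd (a m)) - snd (snd (a n))) < \<epsilon>" if "m \<ge> N" "n \<ge> N" for m n
      using N[OF that] V.wsq_nonneg[of "fst (a m) - fst (a n)"]
        E.wsq_nonneg[of "fst (snd (a m)) - fst (snd (a n))"]
        F.wsq_nonneg[of "snd (snd (a m)) - snd (snd (a n))"]
      unfolding sqnorm_def fst_diff snd_diff by (intro conjI; linarith)
    then show ?A ?B ?C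
      by blast+
  qed
  note cauchy' = this
  obtain f where f: "f \<in> wl2 (cw T) (verts T)" "\<forall>i. i \<notin> verts T \<longrightarrow> f i = 0"
    "(\<lambda>n. sqV (fst (a n) - f)) \<longlonglongrightarrow> 0"
    using V.wl2_complete[of "\<lambda>n. fst (a n)", OF _ cauchy'(1)] mem by blast
  obtain \<phi> where \<phi>: "\<phi> \<in> wl2 (\<lambda>e. rw T e / 2) (edges T)" "\<forall>i. i \<notin> edges T \<longrightarrow> \<phi> i = 0"
    "\<forall>i\<in>edges T. (\<lambda>n. fst (snd (a n)) i) \<longlonglongrightarrow> \<phi> i"
    "(\<lambda>n. sqE (fst (snd (a n)) - \<phi>)) \<longlonglongrightarrow> 0"
    using E.wl2_complete[of "\<lambda>n. fst (snd (a n))", OF _ cauchy'(2)] mem by blast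
  obtain \<psi> where \<psi>: "\<psi> \<in> wl2 (\<lambda>t. sw T t / 6) (faces T)" "\<forall>i. i \<notin> faces T \<longrightarrow> \<psi> i = 0"
    "\<forall>i\<in>faces T. (\<lambda>n. snd (snd (a n)) i) \<longlonglongrightarrow> \<psi> i"
    "(\<lambda>n. sqF (snd (snd (a n)) - \<psi>)) \<longlonglongrightarrow> 0"
    using F.wl2_complete[of "\<lambda>n. snd (snd (a n))", OF _ cauchy'(3)] mem by blast
  have l: "(f, \<phi>, \<psi>) \<in> l2_triang T"
  proof -
    have "\<phi> \<in> C_edges T"
      by (rule C_edges_limit[of "\<lambda>n. fst (snd (a n))"]) (use \<phi> mem in auto)
    moreover have "\<psi> \<in> C_faces T"
      by (rule C_faces_limit[of "\<lambda>n. snd (snd (a n))"]) (use \<psi> mem in auto)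
    ultimately show ?thesis
      using f \<phi> \<psi> by (simp add: l2_triang_iff C_verts_def)
  qed
  have "(\<lambda>n. sqnorm (a n - (f, \<phi>, \<psi>))) \<longlonglongrightarrow> 0 + 0 + 0"
    unfolding sqnorm_def using f(3) \<phi>(4) \<psi>(4) by (intro tendsto_add) simp_all
  from tendsto_real_sqrt[OF this] show ?thesis
    using l a by (intro bexI[OF _ l]) (simp add: ip_norm_triang l2_triang_diff)
qed

lemma hilbert_space_on_triang: "hilbert_space_on scale_cochain (l2_triang T) (ip_triang T)"
proof
  show "cochain.subspace (l2_triang T)"
    by (rule cochain.subspaceI)
      (auto simp: l2_triang_add l2_triang_scale, simp add: l2_triang_iff C_verts_def C_edges_def C_faces_def)
  fix u v z :: "'v cochain" and k :: complex
  assume u: "u \<in> l2_triang T"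
  show "ip_triang T (scale_cochain k u) z = k * ip_triang T u z"
    by (cases u, cases z)
      (simp add: ip_triang_eq V.wip_scale_left E.wip_scale_left F.wip_scale_left algebra_simps)
  show "0 \<le> Re (ip_triang T u u)"
    using u by (simp add: ip_triang_self)
  show "ip_triang T v u = cnj (ip_triang T u v)"
    by (cases u, cases v) (simp add: ip_triang_eq flip: V.wip_commute E.wip_commute F.wip_commute)
  show "ip_triang T (u + v) z = ip_triang T u z + ip_triang T v z"
    if "v \<in> l2_triang T" "z \<in> l2_triang T"
    using u that by (cases u, cases v, cases z)
      (simp add: ip_triang_eq l2_triang_iff V.wip_add_left E.wip_add_left F.wip_add_left)
  show "u = 0" if "Re (ip_triang T u u) = 0"
  proof -
    have "sqnorm u = 0"
      using u that by (simp add: ip_triang_self)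
    then have "sqV (fst u) = 0" "sqE (fst (snd u)) = 0"
      "sqF (snd (snd u)) = 0"
      using V.wsq_nonneg[of "fst u"] E.wsq_nonneg[of "fst (snd u)"] F.wsq_nonneg[of "snd (snd u)"]
      unfolding sqnorm_def by linarith+
    note z = this
    note u' = u[unfolded l2_triang_iff]
    have "fst u x = 0" for x
      using V.wsq_eq_0[of "fst u" x] z u' by (cases "x \<in> verts T") (auto simp: C_off)
    moreover have "fst (snd u) e = 0" for e
      using E.wsq_eq_0[of "fst (snd u)" e] z u' by (cases "e \<in> edges T") (auto simp: C_off)
    moreover have "snd (snd u) t = 0" for t
      using F.wsq_eq_0[of "snd (snd u)" t] z u' by (cases "t \<in> faces T") (auto simp: C_off)
    ultimately show "u = 0"
      by (cases u) (auto simp: fun_eq_iff zero_prod_def)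
  qed
qed (rule l2_triang_complete)

section \<open>Density of the finitely supported cochains\<close>

lemma Cc_subset_l2: "Cc_triang T \<subseteq> l2_triang T"
proof -
  have fin: "f \<in> wl2 w I" if "finite {i. f i \<noteq> 0}" for f :: "'i \<Rightarrow> complex" and w I
  proof -
    have "(\<lambda>i. w i * (cmod (f i))\<^sup>2) summable_on (I \<inter> {i. f i \<noteq> 0})"
      using that by (intro summable_on_finite) auto
    then show ?thesis
      unfolding wl2_def mem_Collect_eq by (subst summable_on_cong_neutral) auto
  qed
  show ?thesis
    by (auto simp: l2_triang_iff Cc_triang_def Cc_verts_def Cc_edges_def Cc_faces_def
        finitely_supported_def intro: fin)
qed

lemma dense_Cc: "dense_in (l2_triang T) (ip_triang T) (Cc_triang T)"
  unfolding dense_in_def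
proof (intro conjI ballI allI impI Cc_subset_l2)
  fix u :: "'v cochain" and \<epsilon> :: real
  assume u: "u \<in> l2_triang T" and "\<epsilon> > 0"
  obtain f \<phi> \<psi> where u_eq: "u = (f, \<phi>, \<psi>)"
    by (cases u)
  have f: "f \<in> C_verts T" "f \<in> wl2 (cw T) (verts T)"
    and \<phi>: "\<phi> \<in> C_edges T" "\<phi> \<in> wl2 (\<lambda>e. rw T e / 2) (edges T)"
    and \<psi>: "\<psi> \<in> C_faces T" "\<psi> \<in> wl2 (\<lambda>t. sw T t / 6) (faces T)"
    using u by (auto simp: u_eq l2_triang_iff)
  \<comment> \<open>One third of the squared error for each of the three components.\<close>
  define \<delta> where "\<delta> = \<epsilon>\<^sup>2 / 3"
  have "\<delta> > 0"
    using \<open>\<epsilon> > 0\<close> by (simp add: \<delta>_def)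
  obtain V0 where V0: "finite V0" "V0 \<subseteq> verts T" "\<And>F. finite F \<Longrightarrow> V0 \<subseteq> F \<Longrightarrow> F \<subseteq> verts T \<Longrightarrow>
      sqV f - \<delta> < (\<Sum>i\<in>F. cw T i * (cmod (f i))\<^sup>2)"
    using V.wl2_tail[OF f(2) \<open>\<delta> > 0\<close>] by blast
  obtain E0 where E0: "finite E0" "E0 \<subseteq> edges T" "\<And>F. finite F \<Longrightarrow> E0 \<subseteq> F \<Longrightarrow> F \<subseteq> edges T \<Longrightarrow>
      sqE \<phi> - \<delta> < (\<Sum>i\<in>F. rw T i / 2 * (cmod (\<phi> i))\<^sup>2)"
    using E.wl2_tail[OF \<phi>(2) \<open>\<delta> > 0\<close>] by blast
  obtain F0 where F0: "finite F0" "F0 \<subseteq> faces T" "\<And>F. finite F \<Longrightarrow> F0 \<subseteq> F \<Longrightarrow> F \<subseteq> faces T \<Longrightarrow>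
      sqF \<psi> - \<delta> < (\<Sum>i\<in>F. sw T i / 6 * (cmod (\<psi> i))\<^sup>2)"
    using F.wl2_tail[OF \<psi>(2) \<open>\<delta> > 0\<close>] by blast
  \<comment> \<open>The tail sets are not symmetric. They are enlarged to all cells spanned by their
    vertices, so that the truncation \<open>v\<close> is again a cochain.\<close>
  define X where "X = V0 \<union> fst ` E0 \<union> snd ` E0 \<union> (\<Union>(x, y, z)\<in>F0. {x, y, z})"
  have X: "finite X"
    using V0 E0 F0 by (auto simp: X_def)
  define v where "v = ((\<lambda>x. of_bool (x \<in> X \<inter> verts T) * f x),
    (\<lambda>e. of_bool (e \<in> edges_in T X) * \<phi> e), (\<lambda>t. of_bool (t \<in> faces_in T X) * \<psi> t))"
  have "E0 \<subseteq> edges_in T X"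
    using E0 by (force simp: X_def edges_in_def)
  moreover have "F0 \<subseteq> faces_in T X"
    using F0 by (fastforce simp: X_def faces_in_def)
  moreover have "V0 \<subseteq> X \<inter> verts T"
    using V0 by (auto simp: X_def)
  ultimately have "sqnorm (v - u) < \<delta> + \<delta> + \<delta>"
    using V0(3)[of "X \<inter> verts T"] E0(3)[of "edges_in T X"] F0(3)[of "faces_in T X"] X
      V.wsq_truncation[OF f(2), of "X \<inter> verts T"] E.wsq_truncation[OF \<phi>(2), of "edges_in T X"]
      F.wsq_truncation[OF \<psi>(2), of "faces_in T X"]
    by (simp add: sqnorm_def v_def u_eq edges_in_subset faces_in_subset)
  then have "sqnorm (v - u) < \<epsilon>\<^sup>2"
    by (simp add: \<delta>_def)
  then have "sqrt (sqnorm (v - u)) < \<epsilon>"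
    using \<open>\<epsilon> > 0\<close> real_sqrt_less_iff[of "sqnorm (v - u)" "\<epsilon>\<^sup>2"] by simp
  moreover have "v \<in> Cc_triang T"
  proof -
    have "(\<lambda>e. of_bool (e \<in> edges_in T X) * \<phi> e) \<in> C_edges T"
      by (rule C_edges_mult[OF \<phi>(1)]) (simp only: of_bool_eq_iff, use edges_in_swap in blast)
    moreover have "(\<lambda>t. of_bool (t \<in> faces_in T X) * \<psi> t) \<in> C_faces T"
      by (rule C_faces_mult[OF \<psi>(1)]) (simp only: of_bool_eq_iff, use faces_in_perm in blast)
    moreover have "(\<lambda>x. of_bool (x \<in> X \<inter> verts T) * f x) \<in> C_verts T"
      by (simp add: C_verts_def)
    moreover have "finitely_supported (\<lambda>x. of_bool (x \<in> X \<inter> verts T) * f x)"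
      "finitely_supported (\<lambda>e. of_bool (e \<in> edges_in T X) * \<phi> e)"
      "finitely_supported (\<lambda>t. of_bool (t \<in> faces_in T X) * \<psi> t)"
      using X unfolding finitely_supported_def by simp_all
    ultimately show ?thesis
      by (simp add: Cc_triang_def v_def Cc_verts_def Cc_edges_def Cc_faces_def)
  qed
  ultimately show "\<exists>v\<in>Cc_triang T. ip_norm (ip_triang T) (v - u) < \<epsilon>"
    using u Cc_subset_l2 by (intro bexI[of _ v]) (auto simp: ip_norm_triang l2_triang_diff)
qed

end

section \<open>Green's formulas\<close>

text \<open>Only two properties of the phases enter the proof: they have modulus one, and passing
  from \<delta> to d conjugates them, by skewness of the potential. The magnetic field is invisible
  in all estimates.\<close>

definition edge_phase :: "'v triangulation \<Rightarrow> 'v \<times> 'v \<Rightarrow> complex" where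
  "edge_phase T e = exp (\<i> * complex_of_real (pot T e) / 2)"

definition face_phase :: "'v triangulation \<Rightarrow> 'v \<Rightarrow> 'v \<Rightarrow> 'v \<Rightarrow> complex" where
  "face_phase T x y t = exp (\<i> / 6 * complex_of_real (pot T (t, x) + pot T (t, y)))"

lemma norm_edge_phase [simp]: "cmod (edge_phase T e) = 1"
  by (simp add: edge_phase_def)

lemma norm_face_phase [simp]: "cmod (face_phase T x y t) = 1"
  by (simp add: face_phase_def)

lemma face_phase_swap: "face_phase T y x t = face_phase T x y t"
  by (simp add: face_phase_def add.commute)

context weighted_magnetic_triangulation
begin

lemma edge_phase_swap:
  assumes "(x, y) \<in> edges T"
  shows "edge_phase T (y, x) = cnj (edge_phase T (x, y))"
  using pot_skew[OF edge_swap[OF assms]] by (simp add: edge_phase_def exp_cnj)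

lemma d0_mag_eq: "(x, y) \<in> edges T \<Longrightarrow>
    d0_mag T g (x, y) = cnj (edge_phase T (x, y)) * g y - edge_phase T (x, y) * g x"
  using edge_phase_swap[of x y] by (simp add: d0_mag_def edge_phase_def)

lemma delta0_mag_eq: "x \<in> verts T \<Longrightarrow>
    complex_of_real (cw T x) * delta0_mag T \<phi> x =
      (\<Sum>e\<in>{e \<in> edges T. snd e = x}. complex_of_real (rw T e) * edge_phase T e * \<phi> e)"
  using cw_pos[of x] by (simp add: delta0_mag_def edge_phase_def)

lemma face_phase_cnj:
  assumes "(x, y, z) \<in> faces T"
  shows "exp (\<i> / 6 * complex_of_real (pot T (x, z) + pot T (y, z))) = cnj (face_phase T x y z)"
  using pot_skew[OF face_edges(3)[OF assms]] pot_skew[OF face_edges(2)[OF assms]]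
  by (simp add: face_phase_def exp_cnj algebra_simps add_divide_distrib diff_divide_distrib)

lemma d1_mag_eq: "(x, y, z) \<in> faces T \<Longrightarrow> d1_mag T \<phi> (x, y, z) =
    cnj (face_phase T x y z) * \<phi> (x, y) + cnj (face_phase T y z x) * \<phi> (y, z)
      + cnj (face_phase T z x y) * \<phi> (z, x)"
  using face_phase_cnj[of x y z] face_phase_cnj[of y z x] face_phase_cnj[of z x y] face_perm[of x y z]
  by (simp add: d1_mag_def)

lemma delta1_mag_eq: "(x, y) \<in> edges T \<Longrightarrow>
    complex_of_real (rw T (x, y)) * delta1_mag T \<psi> (x, y) =
      (\<Sum>t\<in>face_verts T x y. complex_of_real (sw T (x, y, t)) * face_phase T x y t * \<psi> (x, y, t))"
  using rw_pos[of "(x, y)"] by (simp add: delta1_mag_def face_phase_def)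

lemma finite_edges_to [simp]: "x \<in> verts T \<Longrightarrow> finite {e \<in> edges T. snd e = x}"
proof -
  assume "x \<in> verts T"
  then have "finite ((\<lambda>y. (y, x)) ` {y. (x, y) \<in> edges T})"
    by (intro finite_imageI locally_finite)
  then show ?thesis
    by (rule rev_finite_subset) (auto simp: image_iff intro: edge_swap)
qed

lemma finite_face_verts [simp]: "(x, y) \<in> edges T \<Longrightarrow> finite (face_verts T x y)"
  using locally_finite[of x] edge_verts(1)[of x y]
  by (rule_tac finite_subset[of _ "{y. (x, y) \<in> edges T}"]) (auto simp: face_verts_def dest: face_edges)

lemma face_verts_iff: "t \<in> face_verts T x y \<longleftrightarrow> (x, y, t) \<in> faces T"
  by (auto simp: face_verts_def dest: face_edges edge_verts)

lemma face_verts_swap: "face_verts T y x = face_verts T x y"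
  using face_perm(1) unfolding set_eq_iff face_verts_iff by blast

lemma d0_mag_C: "d0_mag T f \<in> C_edges T"
proof -
  have "d0_mag T f (x, y) = - d0_mag T f (y, x)" if "(x, y) \<in> edges T" for x y
    using that edge_swap[OF that] by (simp add: d0_mag_def)
  moreover have "d0_mag T f e = 0" if "e \<notin> edges T" for e
    using that by (cases e) (simp add: d0_mag_def)
  ultimately show ?thesis
    unfolding C_edges_def by blast
qed

lemma delta0_mag_C: "delta0_mag T \<phi> \<in> C_verts T"
  by (simp add: C_verts_def delta0_mag_def)

lemma d1_mag_C:
  assumes "\<phi> \<in> C_edges T"
  shows "d1_mag T \<phi> \<in> C_faces T"
  unfolding C_faces_def mem_Collect_eq
proof (intro conjI allI impI)
  fix x y z assume t: "(x, y, z) \<in> faces T"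
  note t' = face_perm[OF t]
  show "d1_mag T \<phi> (y, x, z) = - d1_mag T \<phi> (x, y, z)"
    unfolding d1_mag_eq[OF t] d1_mag_eq[OF t'(1)] face_phase_swap[of T y x z] face_phase_swap[of T x z y]
      face_phase_swap[of T z y x] C_edges_skew[OF assms, of y x] C_edges_skew[OF assms, of x z]
      C_edges_skew[OF assms, of z y]
    by (simp add: algebra_simps)
  show "d1_mag T \<phi> (y, z, x) = d1_mag T \<phi> (x, y, z)"
    unfolding d1_mag_eq[OF t] d1_mag_eq[OF t'(2)] by (simp add: algebra_simps)
qed (auto simp: d1_mag_def)

lemma delta1_mag_C:
  assumes "\<psi> \<in> C_faces T"
  shows "delta1_mag T \<psi> \<in> C_edges T"
  unfolding C_edges_def mem_Collect_eq
proof (intro conjI allI impI)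
  fix x y assume e: "(x, y) \<in> edges T"
  have "complex_of_real (sw T (y, x, t)) * face_phase T y x t * \<psi> (y, x, t) =
      - (complex_of_real (sw T (x, y, t)) * face_phase T x y t * \<psi> (x, y, t))"
    if "t \<in> face_verts T x y" for t
    using that C_faces_alternating(1)[OF assms, of y x t] sw_swap[of x y t] face_phase_swap[of T y x t]
    by (simp add: face_verts_iff)
  then have "complex_of_real (rw T (y, x)) * delta1_mag T \<psi> (y, x) =
      - (complex_of_real (rw T (x, y)) * delta1_mag T \<psi> (x, y))"
    unfolding delta1_mag_eq[OF e] delta1_mag_eq[OF edge_swap[OF e]] face_verts_swap[of y x]
    by (simp flip: sum_negf)
  then show "delta1_mag T \<psi> (x, y) = - delta1_mag T \<psi> (y, x)"
    using rw_sym[OF e] rw_pos[OF e] by (metis minus_mult_right mult_cancel_left of_real_eq_0_iff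
        order_less_irrefl minus_minus)
qed (auto simp: delta1_mag_def)

lemma d0_mag_zero [simp]: "d0_mag T 0 = 0"
  by (auto simp: d0_mag_def fun_eq_iff)

lemma delta0_mag_zero [simp]: "delta0_mag T 0 = 0"
  by (auto simp: delta0_mag_def fun_eq_iff)

lemma d1_mag_zero [simp]: "d1_mag T 0 = 0"
  by (auto simp: d1_mag_def fun_eq_iff)

lemma delta1_mag_zero [simp]: "delta1_mag T 0 = 0"
  by (auto simp: delta1_mag_def fun_eq_iff)

lemma zero_in_C: "0 \<in> C_verts T" "0 \<in> C_edges T" "0 \<in> C_faces T"
  by (auto simp: C_verts_def C_edges_def C_faces_def)

section \<open>Discrete integration by parts on a finite vertex set\<close>

text \<open>The Gauss-Bonnet operator moves supports by at most one edge, also across faces, whose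
  vertices are pairwise adjacent.\<close>

definition neighbourhood :: "'v set \<Rightarrow> 'v set" where
  "neighbourhood S = (S \<inter> verts T) \<union> (\<Union>x\<in>S \<inter> verts T. {y. (x, y) \<in> edges T})"

lemma finite_neighbourhood [simp]: "finite S \<Longrightarrow> finite (neighbourhood S)"
  by (auto simp: neighbourhood_def locally_finite)

lemma neighbourhood_subset: "neighbourhood S \<subseteq> verts T"
  using edge_verts unfolding neighbourhood_def by blast

lemma neighbourhood_edge: "(x, y) \<in> edges T \<Longrightarrow> x \<in> S \<Longrightarrow> x \<in> neighbourhood S \<and> y \<in> neighbourhood S"
  using edge_verts unfolding neighbourhood_def by blast

lemma wip_finite_sum:
  assumes "finite F" "F \<subseteq> I" "\<And>i. i \<in> I - F \<Longrightarrow> f i * cnj (g i) = 0"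
  shows "wip w I f g = (\<Sum>i\<in>F. complex_of_real (w i) * f i * cnj (g i))"
proof -
  have "wip w I f g = (\<Sum>\<^sub>\<infinity>i\<in>F. complex_of_real (w i) * f i * cnj (g i))"
    unfolding wip_def using assms by (intro infsum_cong_neutral) (auto simp: mult.assoc)
  then show ?thesis
    using assms by simp
qed

text \<open>Summing over edges by endpoint leaves boundary terms on edges that enter X from outside.
  Only the product is assumed to vanish there: the finite support comes sometimes from the cochain
  and sometimes from the function it is tested against.\<close>

lemma sum_delta0_mag:
  assumes X: "finite X" "X \<subseteq> verts T"
    and vanish: "\<And>x y. (x, y) \<in> edges T \<Longrightarrow> y \<in> X \<Longrightarrow> x \<notin> X \<Longrightarrow> \<theta> (x, y) * g y = 0"
  shows "(\<Sum>x\<in>X. complex_of_real (cw T x) * delta0_mag T \<theta> x * g x) =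
    (\<Sum>e\<in>edges_in T X. complex_of_real (rw T e) * edge_phase T e * \<theta> e * g (snd e))"
proof -
  let ?h = "\<lambda>e. complex_of_real (rw T e) * edge_phase T e * \<theta> e * g (snd e)"
  have "complex_of_real (cw T x) * delta0_mag T \<theta> x * g x = (\<Sum>e\<in>{e \<in> edges_in T X. snd e = x}. ?h e)"
    if x: "x \<in> X" for x
  proof -
    have "complex_of_real (cw T x) * delta0_mag T \<theta> x * g x = (\<Sum>e\<in>{e \<in> edges T. snd e = x}. ?h e)"
      using x X by (subst delta0_mag_eq) (auto simp: sum_distrib_right)
    also have "\<dots> = (\<Sum>e\<in>{e \<in> edges_in T X. snd e = x}. ?h e)"
    proof (rule sum.mono_neutral_right)
      show "\<forall>e\<in>{e \<in> edges T. snd e = x} - {e \<in> edges_in T X. snd e = x}. ?h e = 0"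
        using x vanish by (fastforce simp: edges_in_def)
    qed (use x X in \<open>auto simp: edges_in_def\<close>)
    finally show ?thesis .
  qed
  then have "(\<Sum>x\<in>X. complex_of_real (cw T x) * delta0_mag T \<theta> x * g x) =
      (\<Sum>x\<in>X. \<Sum>e\<in>{e \<in> edges_in T X. snd e = x}. ?h e)"
    by (rule sum.cong[OF refl])
  also have "\<dots> = (\<Sum>e\<in>edges_in T X. ?h e)"
    by (intro sum.group finite_edges_in X) (auto simp: edges_in_def)
  finally show ?thesis .
qed

lemma sum_edges_in_swap: "(\<Sum>e\<in>edges_in T X. h (snd e, fst e)) = (\<Sum>e\<in>edges_in T X. h e)"
  by (rule sum.reindex_bij_witness[of _ "\<lambda>e. (snd e, fst e)" "\<lambda>e. (snd e, fst e)"])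
    (auto intro: edges_in_swap)

lemma sum_faces_in_cycle: "(\<Sum>(x, y, z)\<in>faces_in T X. h (y, z, x)) = (\<Sum>t\<in>faces_in T X. h t)"
  by (rule sum.reindex_bij_witness[of _ "\<lambda>(x, y, z). (z, x, y)" "\<lambda>(x, y, z). (y, z, x)"])
    (auto intro: faces_in_perm)

text \<open>Skewness makes the two terms of the difference correspond to the two orientations; the
  resulting 2 cancels the 1/2 in the edge inner product.\<close>

lemma sum_d0_mag:
  assumes "\<phi> \<in> C_edges T"
  shows "(\<Sum>e\<in>edges_in T X. complex_of_real (rw T e) * \<phi> e * cnj (d0_mag T f e)) =
    2 * (\<Sum>e\<in>edges_in T X. complex_of_real (rw T e) * edge_phase T e * \<phi> e * cnj (f (snd e)))"
proof -
  let ?h = "\<lambda>e. complex_of_real (rw T e) * edge_phase T e * \<phi> e * cnj (f (snd e))"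
  have "complex_of_real (rw T e) * \<phi> e * cnj (d0_mag T f e) = ?h e + ?h (snd e, fst e)"
    if e: "e \<in> edges_in T X" for e
  proof -
    obtain x y where xy: "e = (x, y)" "(x, y) \<in> edges T"
      using e by (auto simp: edges_in_def)
    show ?thesis
      unfolding xy(1) using rw_sym[OF xy(2)] C_edges_skew[OF assms, of y x]
      by (simp add: d0_mag_eq[OF xy(2)] edge_phase_swap[OF xy(2)] algebra_simps)
  qed
  then show ?thesis
    using sum_edges_in_swap[of ?h X] by (simp add: sum.distrib)
qed

text \<open>Faces are grouped by the edge formed by their leading two entries; the hypothesis
  removes the apexes outside X.\<close>

lemma sum_delta1_mag:
  assumes X: "finite X"
    and vanish: "\<And>x y t. (x, y, t) \<in> faces T \<Longrightarrow> x \<in> X \<Longrightarrow> y \<in> X \<Longrightarrow> t \<notin> X \<Longrightarrow> \<psi> (x, y, t) * g (x, y) = 0"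
  shows "(\<Sum>e\<in>edges_in T X. complex_of_real (rw T e) * delta1_mag T \<psi> e * g e) =
    (\<Sum>(x, y, t)\<in>faces_in T X. complex_of_real (sw T (x, y, t)) * face_phase T x y t * \<psi> (x, y, t) * g (x, y))"
proof -
  let ?h = "\<lambda>(x, y, t). complex_of_real (sw T (x, y, t)) * face_phase T x y t * \<psi> (x, y, t) * g (x, y)"
  let ?\<pi> = "\<lambda>(x, y, t::'v). (x, y)"
  have "complex_of_real (rw T e) * delta1_mag T \<psi> e * g e = (\<Sum>t\<in>{t \<in> faces_in T X. ?\<pi> t = e}. ?h t)"
    if e: "e \<in> edges_in T X" for e
  proof -
    obtain x y where xy: "e = (x, y)" "(x, y) \<in> edges T" "x \<in> X" "y \<in> X"
      using e by (auto simp: edges_in_def)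
    have "complex_of_real (rw T e) * delta1_mag T \<psi> e * g e = (\<Sum>t\<in>face_verts T x y. ?h (x, y, t))"
      unfolding xy(1) delta1_mag_eq[OF xy(2)] by (simp add: sum_distrib_right)
    also have "\<dots> = (\<Sum>t\<in>face_verts T x y \<inter> X. ?h (x, y, t))"
    proof (rule sum.mono_neutral_right)
      show "\<forall>t\<in>face_verts T x y - face_verts T x y \<inter> X. ?h (x, y, t) = 0"
        using xy vanish by (fastforce simp: face_verts_iff)
    qed (use xy in auto)
    also have "\<dots> = (\<Sum>t\<in>{t \<in> faces_in T X. ?\<pi> t = e}. ?h t)"
      by (rule sum.reindex_bij_witness[of _ "\<lambda>(x, y, t). t" "\<lambda>t. (x, y, t)"])
        (use xy in \<open>auto simp: faces_in_def face_verts_iff\<close>)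
    finally show ?thesis .
  qed
  then have "(\<Sum>e\<in>edges_in T X. complex_of_real (rw T e) * delta1_mag T \<psi> e * g e) =
      (\<Sum>e\<in>edges_in T X. \<Sum>t\<in>{t \<in> faces_in T X. ?\<pi> t = e}. ?h t)"
    by (rule sum.cong[OF refl])
  also have "\<dots> = (\<Sum>t\<in>faces_in T X. ?h t)"
    by (intro sum.group finite_edges_in finite_faces_in X)
      (auto simp: faces_in_def edges_in_def dest: face_edges)
  finally show ?thesis .
qed

text \<open>The three terms of the coboundary are cyclic images of one another, since sw and \<psi>
  are invariant under cycles; the 3 turns the 1/6 of the face inner product into the 1/2 of the edge
  inner product.\<close>

lemma sum_d1_mag:
  assumes "\<psi> \<in> C_faces T"
  shows "(\<Sum>t\<in>faces_in T X. complex_of_real (sw T t) * d1_mag T \<phi> t * cnj (\<psi> t)) =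
    3 * (\<Sum>(x, y, t)\<in>faces_in T X.
      complex_of_real (sw T (x, y, t)) * cnj (face_phase T x y t) * \<phi> (x, y) * cnj (\<psi> (x, y, t)))"
proof -
  let ?h = "\<lambda>(x, y, t). complex_of_real (sw T (x, y, t)) * cnj (face_phase T x y t) * \<phi> (x, y) * cnj (\<psi> (x, y, t))"
  have "(\<Sum>t\<in>faces_in T X. complex_of_real (sw T t) * d1_mag T \<phi> t * cnj (\<psi> t)) =
      (\<Sum>(x, y, z)\<in>faces_in T X. ?h (x, y, z) + ?h (y, z, x) + ?h (z, x, y))"
  proof (rule sum.cong[OF refl])
    fix t assume "t \<in> faces_in T X"
    then obtain x y z where txyz: "t = (x, y, z)" and t: "(x, y, z) \<in> faces T"
      by (auto simp: faces_in_def)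
    have "sw T (y, z, x) = sw T (x, y, z)" "sw T (z, x, y) = sw T (x, y, z)"
      using sw_cycle[OF t] sw_cycle[OF face_perm(2)[OF t]] by simp_all
    moreover have "\<psi> (y, z, x) = \<psi> (x, y, z)" "\<psi> (z, x, y) = \<psi> (x, y, z)"
      using C_faces_alternating(2)[OF assms, of y z x] C_faces_alternating(2)[OF assms, of z x y] by simp_all
    ultimately show "complex_of_real (sw T t) * d1_mag T \<phi> t * cnj (\<psi> t) =
        (case t of (x, y, z) \<Rightarrow> ?h (x, y, z) + ?h (y, z, x) + ?h (z, x, y))"
      by (simp add: txyz d1_mag_eq[OF t] algebra_simps)
  qed
  also have "\<dots> = (\<Sum>t\<in>faces_in T X. ?h t) + (\<Sum>(x, y, z)\<in>faces_in T X. ?h (y, z, x))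
      + (\<Sum>(x, y, z)\<in>faces_in T X. ?h (z, x, y))"
    by (simp add: case_prod_beta sum.distrib)
  also have "(\<Sum>(x, y, z)\<in>faces_in T X. ?h (z, x, y)) = (\<Sum>(x, y, z)\<in>faces_in T X. ?h (y, z, x))"
    using sum_faces_in_cycle[of "\<lambda>(x, y, z). ?h (y, z, x)" X] by (simp add: case_prod_beta)
  also have "(\<Sum>(x, y, z)\<in>faces_in T X. ?h (y, z, x)) = (\<Sum>t\<in>faces_in T X. ?h t)"
    by (rule sum_faces_in_cycle)
  finally show ?thesis by simp
qed

end

section \<open>The Gauss-Bonnet operator on finitely supported cochains\<close>

definition C_triang :: "'v triangulation \<Rightarrow> 'v cochain set" where
  "C_triang T = C_verts T \<times> C_edges T \<times> C_faces T"

definition supported_in :: "'v set \<Rightarrow> 'v cochain \<Rightarrow> bool" where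
  "supported_in S u \<longleftrightarrow> (\<forall>x. fst u x \<noteq> 0 \<longrightarrow> x \<in> S) \<and>
     (\<forall>x y. fst (snd u) (x, y) \<noteq> 0 \<longrightarrow> x \<in> S \<and> y \<in> S) \<and>
     (\<forall>x y z. snd (snd u) (x, y, z) \<noteq> 0 \<longrightarrow> x \<in> S \<and> y \<in> S \<and> z \<in> S)"

lemma supported_in_add:
  assumes "supported_in S u" "supported_in S' v"
  shows "supported_in (S \<union> S') (u + v)"
proof -
  have "a + b \<noteq> 0 \<Longrightarrow> a \<noteq> 0 \<or> b \<noteq> 0" for a b :: complex
    by auto
  then show ?thesis
    using assms unfolding supported_in_def fst_add snd_add plus_fun_apply by blast
qed

context weighted_magnetic_triangulation
begin

lemma Cc_subset_C: "Cc_triang T \<subseteq> C_triang T"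
  by (auto simp: Cc_triang_def C_triang_def Cc_verts_def Cc_edges_def Cc_faces_def)

text \<open>One finite vertex set controls all three components, which is the form in which supports
  propagate under the operator.\<close>

lemma Cc_triang_iff: "u \<in> Cc_triang T \<longleftrightarrow> u \<in> C_triang T \<and> (\<exists>S. finite S \<and> supported_in S u)"
proof (cases u)
  case (fields f \<phi> \<psi>)
  have "finite {x. f x \<noteq> 0} \<and> finite {e. \<phi> e \<noteq> 0} \<and> finite {t. \<psi> t \<noteq> 0} \<longleftrightarrow>
      (\<exists>S. finite S \<and> supported_in S u)"
  proof
    assume fin: "finite {x. f x \<noteq> 0} \<and> finite {e. \<phi> e \<noteq> 0} \<and> finite {t. \<psi> t \<noteq> 0}"
    define S where "S = {x. f x \<noteq> 0} \<union> fst ` {e. \<phi> e \<noteq> 0} \<union> snd ` {e. \<phi> e \<noteq> 0}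
      \<union> (\<Union>(x, y, z)\<in>{t. \<psi> t \<noteq> 0}. {x, y, z})"
    have "finite S"
      unfolding S_def using fin by (intro finite_UnI finite_imageI finite_UN_I) auto
    moreover have "supported_in S u"
      unfolding supported_in_def S_def fields by (auto simp: image_iff) force+
    ultimately show "\<exists>S. finite S \<and> supported_in S u"
      by blast
  next
    assume "\<exists>S. finite S \<and> supported_in S u"
    then obtain S where S: "finite S" "supported_in S u"
      by blast
    have "{x. f x \<noteq> 0} \<subseteq> S" "{e. \<phi> e \<noteq> 0} \<subseteq> S \<times> S" "{t. \<psi> t \<noteq> 0} \<subseteq> S \<times> S \<times> S"
      using S(2) by (auto simp: supported_in_def fields)
    then show "finite {x. f x \<noteq> 0} \<and> finite {e. \<phi> e \<noteq> 0} \<and> finite {t. \<psi> t \<noteq> 0}"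
      using S(1) by (meson finite_SigmaI finite_subset)
  qed
  then show ?thesis
    by (auto simp: fields Cc_triang_def C_triang_def Cc_verts_def Cc_edges_def Cc_faces_def
        finitely_supported_def)
qed

lemma gauss_bonnet_C: "u \<in> C_triang T \<Longrightarrow> gauss_bonnet T u \<in> C_triang T"
  using C_edges_add[OF d0_mag_C delta1_mag_C]
  by (cases u) (auto simp: C_triang_def delta0_mag_C d1_mag_C plus_fun_def)

lemma supported_in_gauss_bonnet:
  assumes u: "u \<in> C_triang T" "supported_in S u"
  shows "supported_in (neighbourhood S) (gauss_bonnet T u)"
proof (cases u)
  case (fields f \<phi> \<psi>)
  have f: "x \<in> S" if "f x \<noteq> 0" for x
    using u that by (auto simp: supported_in_def fields)
  have \<phi>: "x \<in> S \<and> y \<in> S" if "\<phi> (x, y) \<noteq> 0" for x y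
    using u that by (auto simp: supported_in_def fields)
  have \<psi>: "x \<in> S \<and> y \<in> S \<and> z \<in> S" if "\<psi> (x, y, z) \<noteq> 0" for x y z
    using u that by (auto simp: supported_in_def fields)
  have "x \<in> neighbourhood S" if nz: "delta0_mag T \<phi> x \<noteq> 0" for x
  proof -
    have "x \<in> verts T"
      using nz by (auto simp: delta0_mag_def split: if_splits)
    moreover have "\<exists>e\<in>{e \<in> edges T. snd e = x}. \<phi> e \<noteq> 0"
    proof (rule ccontr)
      assume "\<not> ?thesis"
      then have "delta0_mag T \<phi> x = 0"
        unfolding delta0_mag_def by (simp add: sum.neutral)
      then show False
        using nz by contradiction
    qed
    ultimately show ?thesis
      using \<phi> by (auto simp: neighbourhood_def)
  qed
  moreover have "x \<in> neighbourhood S \<and> y \<in> neighbourhood S"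
    if nz: "d0_mag T f (x, y) + delta1_mag T \<psi> (x, y) \<noteq> 0" for x y
  proof -
    have e: "(x, y) \<in> edges T"
      using nz by (auto simp: d0_mag_def delta1_mag_def split: if_splits)
    have "x \<in> S \<or> y \<in> S"
    proof (rule ccontr)
      assume no: "\<not> ?thesis"
      then have "f x = 0" "f y = 0" "\<psi> (x, y, t) = 0" for t
        using f \<psi> by blast+
      then have "d0_mag T f (x, y) + delta1_mag T \<psi> (x, y) = 0"
        by (simp add: d0_mag_def delta1_mag_def)
      then show False
        using nz by contradiction
    qed
    then show ?thesis
      using neighbourhood_edge[OF e, of S] neighbourhood_edge[OF edge_swap[OF e], of S] by blast
  qed
  moreover have "x \<in> neighbourhood S \<and> y \<in> neighbourhood S \<and> z \<in> neighbourhood S"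
    if nz: "d1_mag T \<phi> (x, y, z) \<noteq> 0" for x y z
  proof -
    have t: "(x, y, z) \<in> faces T"
      using nz by (auto simp: d1_mag_def split: if_splits)
    have "\<phi> (x, y) \<noteq> 0 \<or> \<phi> (y, z) \<noteq> 0 \<or> \<phi> (z, x) \<noteq> 0"
    proof (rule ccontr)
      assume "\<not> ?thesis"
      then have "d1_mag T \<phi> (x, y, z) = 0"
        by (simp add: d1_mag_def)
      then show False
        using nz by contradiction
    qed
    then have "x \<in> S \<or> y \<in> S \<or> z \<in> S"
      using \<phi> by blast
    then show ?thesis
      using neighbourhood_edge[of x y S] neighbourhood_edge[of x z S] neighbourhood_edge[of y x S]
        neighbourhood_edge[of y z S] neighbourhood_edge[of z x S] neighbourhood_edge[of z y S]
        face_edges[OF t] face_edges[OF face_perm(1)[OF t]] face_edges[OF face_perm(2)[OF t]] by blast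
  qed
  ultimately show ?thesis
    by (simp add: supported_in_def fields)
qed

lemma gauss_bonnet_Cc: "u \<in> Cc_triang T \<Longrightarrow> gauss_bonnet T u \<in> Cc_triang T"
  using gauss_bonnet_C supported_in_gauss_bonnet finite_neighbourhood
  unfolding Cc_triang_iff by blast

lemma gauss_bonnet_add: "gauss_bonnet T (u + v) = gauss_bonnet T u + gauss_bonnet T v"
  by (cases u, cases v)
    (auto simp: fun_eq_iff d0_mag_def delta0_mag_def d1_mag_def delta1_mag_def sum.distrib algebra_simps)

lemma gauss_bonnet_scale: "gauss_bonnet T (scale_cochain k u) = scale_cochain k (gauss_bonnet T u)"
  by (cases u)
    (auto simp: fun_eq_iff d0_mag_def delta0_mag_def d1_mag_def delta1_mag_def sum_distrib_left algebra_simps)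

text \<open>Only u has to be finitely supported; v is arbitrary, so the formula also applies to
  \<open>gauss_bonnet T u\<close> when that is not square-summable.\<close>

lemma ip_triang_supported:
  assumes u: "u \<in> C_triang T" "supported_in X u" and X: "finite X" "X \<subseteq> verts T"
  shows "ip_triang T u v = (\<Sum>x\<in>X. complex_of_real (cw T x) * fst u x * cnj (fst v x))
    + 1/2 * (\<Sum>e\<in>edges_in T X. complex_of_real (rw T e) * fst (snd u) e * cnj (fst (snd v) e))
    + 1/6 * (\<Sum>t\<in>faces_in T X. complex_of_real (sw T t) * snd (snd u) t * cnj (snd (snd v) t))"
proof -
  have "wip (cw T) (verts T) (fst u) (fst v) = (\<Sum>x\<in>X. complex_of_real (cw T x) * fst u x * cnj (fst v x))"
    using u X by (intro wip_finite_sum) (auto simp: supported_in_def)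
  moreover have "wip (\<lambda>e. rw T e / 2) (edges T) (fst (snd u)) (fst (snd v)) =
      1/2 * (\<Sum>e\<in>edges_in T X. complex_of_real (rw T e) * fst (snd u) e * cnj (fst (snd v) e))"
  proof -
    have "fst (snd u) e * cnj (fst (snd v) e) = 0" if "e \<in> edges T - edges_in T X" for e
      using that u(2) by (cases e) (auto simp: supported_in_def edges_in_def)
    then show ?thesis
      using X wip_finite_sum[of "edges_in T X" "edges T" "fst (snd u)" "fst (snd v)" "\<lambda>e. rw T e / 2"]
      by (simp add: edges_in_subset sum_distrib_left)
  qed
  moreover have "wip (\<lambda>t. sw T t / 6) (faces T) (snd (snd u)) (snd (snd v)) =
      1/6 * (\<Sum>t\<in>faces_in T X. complex_of_real (sw T t) * snd (snd u) t * cnj (snd (snd v) t))"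
  proof -
    have "snd (snd u) t * cnj (snd (snd v) t) = 0" if "t \<in> faces T - faces_in T X" for t
      using that u(2) by (cases t) (auto simp: supported_in_def faces_in_def)
    then show ?thesis
      using X wip_finite_sum[of "faces_in T X" "faces T" "snd (snd u)" "snd (snd v)" "\<lambda>t. sw T t / 6"]
      by (simp add: faces_in_subset sum_distrib_left)
  qed
  moreover have "ip_triang T u v = wip (cw T) (verts T) (fst u) (fst v)
      + wip (\<lambda>e. rw T e / 2) (edges T) (fst (snd u)) (fst (snd v))
      + wip (\<lambda>t. sw T t / 6) (faces T) (snd (snd u)) (snd (snd v))"
    by (cases u, cases v) (simp add: ip_triang_eq)
  ultimately show ?thesis
    by (simp only:)
qed

text \<open>Here v is any cochain, without support or summability condition. This turns adjoint
  relations into statements about the formal action of the operator.\<close>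

lemma gauss_bonnet_formally_symmetric:
  assumes u: "u \<in> Cc_triang T" and v: "v \<in> C_triang T"
  shows "ip_triang T (gauss_bonnet T u) v = ip_triang T u (gauss_bonnet T v)"
proof -
  obtain f \<phi> \<psi> where u_eq: "u = (f, \<phi>, \<psi>)"
    by (cases u)
  obtain f' \<phi>' \<psi>' where v_eq: "v = (f', \<phi>', \<psi>')"
    by (cases v)
  obtain S where S: "finite S" "supported_in S u" and uC: "u \<in> C_triang T"
    using u by (auto simp: Cc_triang_iff)
  have C: "\<phi> \<in> C_edges T" "\<psi> \<in> C_faces T" "\<phi>' \<in> C_edges T" "\<psi>' \<in> C_faces T"
    using uC v by (auto simp: C_triang_def u_eq v_eq)
  define X where "X = neighbourhood S"
  have X: "finite X" "X \<subseteq> verts T"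
    using S by (auto simp: X_def dest: subsetD[OF neighbourhood_subset])
  have f: "x \<in> S" if "f x \<noteq> 0" for x
    using S that by (auto simp: supported_in_def u_eq)
  have \<phi>: "x \<in> S \<and> y \<in> S \<and> (x, y) \<in> edges T" if "\<phi> (x, y) \<noteq> 0" for x y
    using S that C_off(2)[OF C(1), of "(x, y)"] by (auto simp: supported_in_def u_eq)
  have \<psi>: "x \<in> S \<and> y \<in> S \<and> z \<in> S \<and> (x, y, z) \<in> faces T" if "\<psi> (x, y, z) \<noteq> 0" for x y z
    using S that C_off(3)[OF C(2), of "(x, y, z)"] by (auto simp: supported_in_def u_eq)
  have "supported_in X u"
  proof -
    have "x \<in> X" if "f x \<noteq> 0" for x
      using f[OF that] uC that C_off(1)[of f x] by (auto simp: X_def neighbourhood_def C_triang_def u_eq)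
    moreover have "x \<in> X \<and> y \<in> X" if "\<phi> (x, y) \<noteq> 0" for x y
      using \<phi>[OF that] neighbourhood_edge[of x y S] by (simp add: X_def)
    moreover have "x \<in> X \<and> y \<in> X \<and> z \<in> X" if "\<psi> (x, y, z) \<noteq> 0" for x y z
      using \<psi>[OF that] neighbourhood_edge[of x y S] neighbourhood_edge[of x z S] face_edges[of x y z]
      by (simp add: X_def)
    ultimately show ?thesis
      by (simp add: supported_in_def u_eq)
  qed
  note sum_u = ip_triang_supported[OF uC this X, of "gauss_bonnet T v"]
  have "supported_in X (gauss_bonnet T u)"
    using supported_in_gauss_bonnet[OF uC S(2)] by (simp add: X_def)
  note sum_Tu = ip_triang_supported[OF gauss_bonnet_C[OF uC] this X, of v]
  let ?rw = "\<lambda>e. complex_of_real (rw T e)"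
  let ?sw = "\<lambda>t. complex_of_real (sw T t)"
  \<comment> \<open>Both inner products reduce to these four sums: P1, P2 for the vertex-edge
    pairing and Q1, Q2 for the edge-face pairing, each occurring once plain and once
    conjugated.\<close>
  define P1 where "P1 = (\<Sum>e\<in>edges_in T X. ?rw e * edge_phase T e * \<phi> e * cnj (f' (snd e)))"
  define P2 where "P2 = (\<Sum>e\<in>edges_in T X. ?rw e * edge_phase T e * \<phi>' e * cnj (f (snd e)))"
  define Q1 where "Q1 = (\<Sum>(x, y, t)\<in>faces_in T X.
    ?sw (x, y, t) * face_phase T x y t * \<psi> (x, y, t) * cnj (\<phi>' (x, y)))"
  define Q2 where "Q2 = (\<Sum>(x, y, t)\<in>faces_in T X.
    ?sw (x, y, t) * face_phase T x y t * \<psi>' (x, y, t) * cnj (\<phi> (x, y)))"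
  have 1: "(\<Sum>x\<in>X. complex_of_real (cw T x) * delta0_mag T \<phi> x * cnj (f' x)) = P1"
    unfolding P1_def
  proof (rule sum_delta0_mag[OF X])
    show "\<phi> (x, y) * cnj (f' y) = 0" if "x \<notin> X" for x y
      using that \<phi>[of x y] neighbourhood_edge[of x y S] by (auto simp: X_def)
  qed
  have 2: "(\<Sum>x\<in>X. complex_of_real (cw T x) * delta0_mag T \<phi>' x * cnj (f x)) = P2"
    unfolding P2_def
  proof (rule sum_delta0_mag[OF X])
    show "\<phi>' (x, y) * cnj (f y) = 0" if "(x, y) \<in> edges T" "x \<notin> X" for x y
      using that f[of y] neighbourhood_edge[OF edge_swap[of x y], of S] by (auto simp: X_def)
  qed
  have 3: "(\<Sum>e\<in>edges_in T X. ?rw e * delta1_mag T \<psi> e * cnj (\<phi>' e)) = Q1"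
    unfolding Q1_def
  proof (rule sum_delta1_mag[OF X(1)])
    show "\<psi> (x, y, t) * cnj (\<phi>' (x, y)) = 0" if "(x, y, t) \<in> faces T" "t \<notin> X" for x y t
      using that \<psi>[of x y t] neighbourhood_edge[of x t S] face_edges(3)[of x y t] by (auto simp: X_def)
  qed
  have 4: "(\<Sum>e\<in>edges_in T X. ?rw e * delta1_mag T \<psi>' e * cnj (\<phi> e)) = Q2"
    unfolding Q2_def
  proof (rule sum_delta1_mag[OF X(1)])
    show "\<psi>' (x, y, t) * cnj (\<phi> (x, y)) = 0" if "(x, y, t) \<in> faces T" "t \<notin> X" for x y t
      using that \<phi>[of x y] neighbourhood_edge[of x t S] face_edges(3)[of x y t] by (auto simp: X_def)
  qed
  have 5: "(\<Sum>e\<in>edges_in T X. ?rw e * \<phi> e * cnj (d0_mag T f' e)) = 2 * P1"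
    "(\<Sum>e\<in>edges_in T X. ?rw e * \<phi>' e * cnj (d0_mag T f e)) = 2 * P2"
    unfolding P1_def P2_def using C by (simp_all add: sum_d0_mag)
  have 6: "(\<Sum>t\<in>faces_in T X. ?sw t * d1_mag T \<phi> t * cnj (\<psi>' t)) = 3 * cnj Q2"
    "(\<Sum>t\<in>faces_in T X. ?sw t * d1_mag T \<phi>' t * cnj (\<psi> t)) = 3 * cnj Q1"
    unfolding Q1_def Q2_def sum_d1_mag[OF C(4)] sum_d1_mag[OF C(2)] cnj_sum
    by (auto intro!: sum.cong simp: algebra_simps)
  have "ip_triang T (gauss_bonnet T u) v = P1 + 1/2 * (cnj (2 * P2) + Q1) + 1/6 * (3 * cnj Q2)"
    unfolding sum_Tu 1[symmetric] 3[symmetric] 5(2)[symmetric] 6(1)[symmetric]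
    by (simp add: u_eq v_eq sum.distrib algebra_simps)
  moreover have "ip_triang T u (gauss_bonnet T v) = cnj P2 + 1/2 * (2 * P1 + cnj Q2) + 1/6 * cnj (3 * cnj Q1)"
    unfolding sum_u 2[symmetric] 4[symmetric] 5(1)[symmetric] 6(2)[symmetric]
    by (simp add: u_eq v_eq sum.distrib algebra_simps)
  ultimately show ?thesis
    by (simp add: add_divide_distrib)
qed

lemma subspace_Cc: "cochain.subspace (Cc_triang T)"
proof (rule cochain.subspaceI)
  show "0 \<in> Cc_triang T"
    unfolding Cc_triang_iff
    by (auto simp: zero_prod_def C_triang_def C_verts_def C_edges_def C_faces_def supported_in_def)
  show "u + v \<in> Cc_triang T" if uv: "u \<in> Cc_triang T" "v \<in> Cc_triang T" for u v
  proof -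
    obtain S S' where "finite S" "supported_in S u" "finite S'" "supported_in S' v"
      using uv by (auto simp: Cc_triang_iff)
    then have "finite (S \<union> S')" "supported_in (S \<union> S') (u + v)"
      by (simp_all add: supported_in_add)
    moreover have "u + v \<in> C_triang T"
      using uv Cc_subset_C by (cases u, cases v)
        (auto simp: C_triang_def intro!: C_verts_add C_edges_add C_faces_add)
    ultimately show ?thesis
      unfolding Cc_triang_iff by blast
  qed
  show "scale_cochain k u \<in> Cc_triang T" if u: "u \<in> Cc_triang T" for k u
  proof -
    obtain S where "finite S" "supported_in S u"
      using u by (auto simp: Cc_triang_iff)
    then have "finite S" "supported_in S (scale_cochain k u)"
      by (cases u, auto simp: supported_in_def)+
    moreover have "scale_cochain k u \<in> C_triang T"
      using u Cc_subset_C by (cases u)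
        (auto simp: C_triang_def intro!: C_verts_scale C_edges_scale C_faces_scale)
    ultimately show ?thesis
      unfolding Cc_triang_iff by blast
  qed
qed

lemma l2_subset_C: "l2_triang T \<subseteq> C_triang T"
  by (auto simp: l2_triang_iff C_triang_def)

section \<open>Reduction to the weak eigenvalue equation\<close>

text \<open>The eigenvalue equation of the adjoint with one Gauss-Bonnet operator moved to u. Both
  sides are finite sums because w has finite support.\<close>

definition weak_eigen :: "real \<Rightarrow> 'v cochain \<Rightarrow> bool" where
  "weak_eigen \<mu> u \<longleftrightarrow> (\<forall>w\<in>Cc_triang T.
    ip_triang T (gauss_bonnet T w) (gauss_bonnet T u) = - complex_of_real \<mu> * ip_triang T w u)"

text \<open>Moving one factor of the square across the inner product shows symmetry, gives
  nonnegativity as the squared norm of T u, and rewrites the kernel condition of the abstract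
  criterion as \<open>weak_eigen\<close>.\<close>

theorem essentially_self_adjoint_magnetic_laplacianI:
  assumes "(\<mu>::real) > 0"
    and ker: "\<And>u. u \<in> l2_triang T \<Longrightarrow> weak_eigen \<mu> u \<Longrightarrow> u = 0"
  shows "essentially_self_adjoint (l2_triang T) (ip_triang T) (Cc_triang T) (magnetic_laplacian T)"
proof -
  interpret hilbert_space_on scale_cochain "l2_triang T" "ip_triang T"
    by (rule hilbert_space_on_triang)
  have L: "magnetic_laplacian T w = gauss_bonnet T (gauss_bonnet T w)" for w
    by (simp add: magnetic_laplacian_def)
  have C: "w \<in> C_triang T" if "w \<in> Cc_triang T" for w
    using that Cc_subset_C by blast
  have green: "ip_triang T (magnetic_laplacian T w) u = ip_triang T (gauss_bonnet T w) (gauss_bonnet T u)"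
    if "w \<in> Cc_triang T" "u \<in> C_triang T" for w u
    unfolding L using that by (intro gauss_bonnet_formally_symmetric gauss_bonnet_Cc)
  show ?thesis
  proof (rule essentially_self_adjointI[OF _ subspace_Cc _ _ _ \<open>\<mu> > 0\<close>])
    show "symmetric_operator (l2_triang T) (ip_triang T) (Cc_triang T) (magnetic_laplacian T)"
      unfolding symmetric_operator_def
    proof (intro conjI ballI dense_Cc image_subsetI)
      fix u assume u: "u \<in> Cc_triang T"
      show "magnetic_laplacian T u \<in> l2_triang T"
        unfolding L using u Cc_subset_l2 by (blast intro: gauss_bonnet_Cc)
      fix v assume v: "v \<in> Cc_triang T"
      show "ip_triang T (magnetic_laplacian T u) v = ip_triang T u (magnetic_laplacian T v)"
        unfolding green[OF u C[OF v]] unfolding L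
        using u v by (intro gauss_bonnet_formally_symmetric gauss_bonnet_C C)
    qed
    show "magnetic_laplacian T (u + v) = magnetic_laplacian T u + magnetic_laplacian T v" for u v
      by (simp add: L gauss_bonnet_add)
    show "magnetic_laplacian T (scale_cochain k u) = scale_cochain k (magnetic_laplacian T u)" for k u
      by (simp add: L gauss_bonnet_scale)
    show "0 \<le> Re (ip_triang T (magnetic_laplacian T u) u)" if "u \<in> Cc_triang T" for u
    proof -
      have "gauss_bonnet T u \<in> l2_triang T"
        using gauss_bonnet_Cc[OF that] Cc_subset_l2 by blast
      then show ?thesis
        unfolding green[OF that C[OF that]] by (rule ip_self_nonneg)
    qed
    show "u = 0" if u: "u \<in> l2_triang T"
      "\<And>w. w \<in> Cc_triang T \<Longrightarrow> ip_triang T (magnetic_laplacian T w) u = - complex_of_real \<mu> * ip_triang T w u"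
    for u
    proof (rule ker[OF u(1)])
      have "u \<in> C_triang T"
        using u(1) l2_subset_C by blast
      then show "weak_eigen \<mu> u"
        using u(2) green by (simp add: weak_eigen_def)
    qed
  qed
qed

end

section \<open>Cutoff estimates\<close>

text \<open>For x = y = 0 the inequality of \<open>median_mean_bound\<close> forces the face cutoff
  to vanish whatever t is. The median does so; the average does not.\<close>

definition median :: "real \<Rightarrow> real \<Rightarrow> real \<Rightarrow> real" where
  "median x y z = max (min x y) (min (max x y) z)"

lemma median_perm: "median y x z = median x y z" "median y z x = median x y z"
  by (auto simp: median_def max_def min_def)

lemma abs_diff_squares:
  fixes u v :: real
  assumes "0 \<le> u" "0 \<le> v"
  shows "\<bar>u\<^sup>2 - v\<^sup>2\<bar> = \<bar>u - v\<bar> * (u + v)"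
  using assms by (simp add: power2_eq_square square_diff_square_factored abs_mult)

text \<open>The median is at distance at most |x + y - 2t|/2 from the mean of x and y and is at most
  twice that mean; the bound is the product of difference and sum. The mean appears on the right
  because T u lives on edges in the even part.\<close>

lemma median_mean_bound:
  fixes x y t :: real
  assumes "0 \<le> x" "0 \<le> y" "0 \<le> t"
  shows "\<bar>(median x y t)\<^sup>2 - ((x + y) / 2)\<^sup>2\<bar> \<le> 3/2 * ((x + y) / 2) * \<bar>x + y - 2 * t\<bar>"
proof -
  have "\<bar>median x y t - (x + y) / 2\<bar> \<le> \<bar>x + y - 2 * t\<bar> / 2" "0 \<le> median x y t" "median x y t \<le> x + y"
    using assms by (auto simp: median_def max_def min_def abs_if field_simps)
  then have "\<bar>median x y t - (x + y) / 2\<bar> * (median x y t + (x + y) / 2)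
      \<le> (\<bar>x + y - 2 * t\<bar> / 2) * (3 * ((x + y) / 2))"
    using assms by (intro mult_mono) (simp_all add: field_simps)
  moreover have "\<bar>(median x y t)\<^sup>2 - ((x + y) / 2)\<^sup>2\<bar> =
      \<bar>median x y t - (x + y) / 2\<bar> * (median x y t + (x + y) / 2)"
    using \<open>0 \<le> median x y t\<close> assms by (intro abs_diff_squares) simp_all
  ultimately show ?thesis
    by (simp add: mult.commute)
qed

text \<open>Average and mean differ by exactly |x + y - 2t|/6, and the mean is at most 3/2 of the
  average. Now the face cutoff stands on the right, as the odd part requires.\<close>

lemma average_mean_bound:
  fixes x y t :: real
  assumes "0 \<le> x" "0 \<le> y" "0 \<le> t"
  shows "\<bar>((x + y + t) / 3)\<^sup>2 - ((x + y) / 2)\<^sup>2\<bar> \<le> 1/2 * ((x + y + t) / 3) * \<bar>x + y - 2 * t\<bar>"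
proof -
  have "\<bar>((x + y + t) / 3)\<^sup>2 - ((x + y) / 2)\<^sup>2\<bar> =
      \<bar>(x + y + t) / 3 - (x + y) / 2\<bar> * ((x + y + t) / 3 + (x + y) / 2)"
    using assms by (intro abs_diff_squares) simp_all
  moreover have "\<bar>(x + y + t) / 3 - (x + y) / 2\<bar> = \<bar>x + y - 2 * t\<bar> / 6"
    by (simp add: abs_if field_simps)
  moreover have "(\<bar>x + y - 2 * t\<bar> / 6) * ((x + y + t) / 3 + (x + y) / 2)
      \<le> (\<bar>x + y - 2 * t\<bar> / 6) * (3 * ((x + y + t) / 3))"
    using assms by (intro mult_left_mono) (simp_all add: field_simps)
  ultimately have "\<bar>((x + y + t) / 3)\<^sup>2 - ((x + y) / 2)\<^sup>2\<bar> \<le> (\<bar>x + y - 2 * t\<bar> / 6) * (3 * ((x + y + t) / 3))"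
    by (simp only:)
  moreover have "u / 6 * (3 * v) = 1/2 * v * u" for u v :: real
    by simp
  ultimately show ?thesis
    by (simp only:)
qed

text \<open>The case t = x of the median bound: the median is then x and the second difference is y
  - x.\<close>

lemma mean_endpoint_bound:
  fixes x y :: real
  assumes "0 \<le> x" "0 \<le> y"
  shows "\<bar>x\<^sup>2 - ((x + y) / 2)\<^sup>2\<bar> \<le> 3/2 * ((x + y) / 2) * \<bar>y - x\<bar>"
  using median_mean_bound[of x y x] assms by (simp add: median_def max_def min_def algebra_simps split: if_splits)

text \<open>The last summand cannot be dropped: for \<open>x = 0\<close> it is the whole left-hand side.\<close>

lemma endpoint_mean_bound:
  fixes x y :: real
  assumes "0 \<le> x" "0 \<le> y"
  shows "\<bar>x\<^sup>2 - ((x + y) / 2)\<^sup>2\<bar> \<le> 5/4 * x * \<bar>y - x\<bar> + (max 0 (y - x))\<^sup>2 / 4"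
proof -
  define d where "d = y - x"
  have eq: "x\<^sup>2 - ((x + y) / 2)\<^sup>2 = - (x * d + d\<^sup>2 / 4)"
    by (simp add: d_def power2_eq_square field_simps)
  show ?thesis
  proof (cases "d \<ge> 0")
    case True
    then have "\<bar>x * d + d\<^sup>2 / 4\<bar> \<le> 5/4 * x * d + d\<^sup>2 / 4"
      using assms by (simp add: abs_of_nonneg)
    then show ?thesis
      using True assms unfolding eq abs_minus_cancel by (simp add: d_def[symmetric])
  next
    case False
    \<comment> \<open>On a falling edge the increment is at most x because y is nonnegative, so its
      square is absorbed; only a rising edge leaves a remainder.\<close>
    have "\<bar>d\<bar> \<le> x"
      using False assms by (simp add: d_def)
    then have "\<bar>d\<bar> * \<bar>d\<bar> \<le> x * \<bar>d\<bar>"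
      by (rule mult_right_mono) simp
    then have "d\<^sup>2 \<le> x * \<bar>d\<bar>"
      by (simp add: power2_eq_square)
    moreover have "\<bar>x * d + d\<^sup>2 / 4\<bar> \<le> x * \<bar>d\<bar> + d\<^sup>2 / 4"
      using assms abs_triangle_ineq[of "x * d" "d\<^sup>2 / 4"] by (simp add: abs_mult)
    moreover have "0 \<le> (max 0 (y - x))\<^sup>2 / 4"
      by simp
    ultimately show ?thesis
      unfolding eq abs_minus_cancel d_def[symmetric] by (simp only: mult.assoc)
  qed
qed

text \<open>If \<open>\<tau>\<close> is not near \<open>d/2\<close>, the first summand dominates; otherwise \<open>\<tau>\<close> is comparable to \<open>d\<close>
  but far from \<open>2d\<close>, and the second one does.\<close>

lemma midpoint_dichotomy:
  fixes d \<tau> :: real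
  assumes "d > 0"
  shows "d ^ 6 \<le> 4 * d ^ 4 * (d - 2 * \<tau>)\<^sup>2 + 1024 * (max 0 \<tau>) ^ 4 * (\<tau> - 2 * d)\<^sup>2"
proof (cases "\<bar>d - 2 * \<tau>\<bar> \<ge> d / 2")
  case True
  then have "(d / 2)\<^sup>2 \<le> (d - 2 * \<tau>)\<^sup>2"
    using assms by (simp add: abs_le_square_iff[symmetric])
  then have "4 * d ^ 4 * (d / 2)\<^sup>2 \<le> 4 * d ^ 4 * (d - 2 * \<tau>)\<^sup>2"
    by (intro mult_left_mono) auto
  moreover have "4 * d ^ 4 * (d / 2)\<^sup>2 = d ^ 6"
    by (simp add: power2_eq_square power4_eq_xxxx eval_nat_numeral)
  moreover have "0 \<le> 1024 * (max 0 \<tau>) ^ 4 * (\<tau> - 2 * d)\<^sup>2"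
    by simp
  ultimately show ?thesis
    by linarith
next
  case False
  then have \<tau>: "d / 4 < \<tau>" "\<tau> < 3 * d / 4"
    using assms by (auto simp: abs_if split: if_splits)
  \<comment> \<open>In this range \<tau> is at least d/4 and its distance to 2d is at least d; 1024
    is 4 times the 256 lost in the fourth power.\<close>
  have "(d / 4) ^ 4 \<le> (max 0 \<tau>) ^ 4"
    using assms \<tau> by (intro power_mono) auto
  moreover have "d\<^sup>2 \<le> (\<tau> - 2 * d)\<^sup>2"
    using assms \<tau> by (simp add: abs_le_square_iff[symmetric])
  ultimately have "(d / 4) ^ 4 * d\<^sup>2 \<le> (max 0 \<tau>) ^ 4 * (\<tau> - 2 * d)\<^sup>2"
    by (intro mult_mono) auto
  moreover have "1024 * ((d / 4) ^ 4 * d\<^sup>2) = 4 * d ^ 6"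
    by (simp add: power2_eq_square eval_nat_numeral)
  moreover have "0 \<le> d ^ 6" "0 \<le> 4 * d ^ 4 * (d - 2 * \<tau>)\<^sup>2"
    using assms by simp_all
  ultimately show ?thesis
    by linarith
qed

lemma young: "(x::real) * y \<le> \<epsilon> * x\<^sup>2 + y\<^sup>2 / (4 * \<epsilon>)" if "\<epsilon> > 0"
proof -
  have "0 \<le> (2 * \<epsilon> * x - y)\<^sup>2 / (4 * \<epsilon>)"
    using that by simp
  also have "\<dots> = \<epsilon> * x\<^sup>2 + y\<^sup>2 / (4 * \<epsilon>) - x * y"
    using that by (simp add: power2_eq_square field_simps)
  finally show ?thesis by simp
qed

lemma sum_three_squares_le: "((u::real) + v + w)\<^sup>2 \<le> 3 * (u\<^sup>2 + v\<^sup>2 + w\<^sup>2)"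
proof -
  have "0 \<le> (u - v)\<^sup>2 + (v - w)\<^sup>2 + (u - w)\<^sup>2"
    by simp
  then show ?thesis
    by (simp add: power2_eq_square algebra_simps)
qed

lemma weighted_Cauchy_Schwarz:
  fixes s G :: "'i \<Rightarrow> real"
  assumes "\<And>i. i \<in> I \<Longrightarrow> 0 \<le> s i"
  shows "(\<Sum>i\<in>I. s i * G i)\<^sup>2 \<le> (\<Sum>i\<in>I. s i) * (\<Sum>i\<in>I. s i * (G i)\<^sup>2)"
proof -
  have "(\<Sum>i\<in>I. sqrt (s i) * (sqrt (s i) * G i))\<^sup>2
      \<le> (\<Sum>i\<in>I. (sqrt (s i))\<^sup>2) * (\<Sum>i\<in>I. (sqrt (s i) * G i)\<^sup>2)"
    by (rule Cauchy_Schwarz_ineq_sum)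
  moreover have "(\<Sum>i\<in>I. sqrt (s i) * (sqrt (s i) * G i)) = (\<Sum>i\<in>I. s i * G i)"
    using assms by (intro sum.cong refl) (simp flip: mult.assoc)
  moreover have "(\<Sum>i\<in>I. (sqrt (s i))\<^sup>2) = (\<Sum>i\<in>I. s i)"
    using assms by (intro sum.cong refl) simp
  moreover have "(\<Sum>i\<in>I. (sqrt (s i) * G i)\<^sup>2) = (\<Sum>i\<in>I. s i * (G i)\<^sup>2)"
    using assms by (intro sum.cong refl) (simp add: power_mult_distrib)
  ultimately show ?thesis
    by simp
qed

lemma norm_diff_sums:
  assumes "\<And>i. i \<in> I \<Longrightarrow> cmod (f i - g i) \<le> h i"
  shows "cmod (sum f I - sum g I) \<le> sum h I"
  using assms by (simp add: sum_norm_le flip: sum_subtractf)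

lemma le_cmod_complex_of_real: "complex_of_real x = z \<Longrightarrow> x \<le> cmod z"
  by (metis abs_ge_self norm_of_real)

lemma of_real_cmod_square: "(complex_of_real (cmod z))\<^sup>2 = z * cnj z"
  using complex_norm_square[of z] by simp

section \<open>One cutoff and the summed completeness conditions\<close>

text \<open>A single \<chi>, made real-valued and with the divisions by c and r cleared. In the face
  condition the sum of the two differences seen from t has become the second difference a(x) + a(y)
  - 2a(t).\<close>

locale cutoff = weighted_magnetic_triangulation T
  for T :: "'v triangulation" +
  fixes a :: "'v \<Rightarrow> real" and C :: real
  assumes a_nonneg: "0 \<le> a x" and a_le_1: "a x \<le> 1"
    and finite_support: "finite {x. a x \<noteq> 0}"
    and C_pos: "C > 0"
    and vert_bound: "x \<in> verts T \<Longrightarrow>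
      (\<Sum>e\<in>{e \<in> edges T. snd e = x}. rw T e * (a (fst e) - a (snd e))\<^sup>2) \<le> C * cw T x"
    and face_bound: "(x, y) \<in> edges T \<Longrightarrow>
      (\<Sum>t\<in>face_verts T x y. sw T (x, y, t) * (a x + a y - 2 * a t)\<^sup>2) \<le> C * rw T (x, y)"
begin

text \<open>Two steps around the support: every cell that meets the support lies in S, so a cut-off
  cochain is supported in S and its image under the operator in X. All sums below run over cells
  inside X.\<close>

definition S where "S = neighbourhood {x. a x \<noteq> 0}"
definition X where "X = neighbourhood S"

abbreviation XE where "XE \<equiv> edges_in T X"
abbreviation XF where "XF \<equiv> faces_in T X"

lemma finite_S [simp]: "finite S" and finite_X [simp]: "finite X"
  by (simp_all add: S_def X_def finite_support)

lemma X_subset: "X \<subseteq> verts T"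
  unfolding X_def by (rule neighbourhood_subset)

lemma near_support:
  assumes "(x, y) \<in> edges T" "a x \<noteq> 0 \<or> a y \<noteq> 0"
  shows "x \<in> S" "y \<in> S" "x \<in> X" "y \<in> X"
proof -
  show "x \<in> S" "y \<in> S"
    using assms neighbourhood_edge[of x y "{x. a x \<noteq> 0}"] neighbourhood_edge[of y x "{x. a x \<noteq> 0}"]
      edge_swap[of x y] by (auto simp: S_def)
  then show "x \<in> X" "y \<in> X"
    using neighbourhood_edge[OF assms(1), of S] by (auto simp: X_def)
qed

lemma face_near_support:
  assumes "(x, y, t) \<in> faces T" "a x \<noteq> 0 \<or> a y \<noteq> 0 \<or> a t \<noteq> 0"
  shows "x \<in> S" "y \<in> S" "t \<in> S" "x \<in> X" "y \<in> X" "t \<in> X"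
  using near_support[of x y] near_support[of x t] near_support[of y t] face_edges[OF assms(1)] assms(2)
  by auto

text \<open>Positive exactly when the second endpoint is the lower one, the case that leaves a
  remainder in the odd part.\<close>

definition diff where "diff e = a (fst e) - a (snd e)"
definition mean where "mean e = (a (fst e) + a (snd e)) / 2"

text \<open>The second difference at the apex t, symmetric only in x and y. In contrast
  \<open>avg\<close> and \<open>med\<close> are symmetric in all three entries, so multiplying by
  them preserves alternation.\<close>

definition kap where "kap = (\<lambda>(x, y, t). a x + a y - 2 * a t)"
definition avg where "avg = (\<lambda>(x, y, t). (a x + a y + a t) / 3)"
definition med where "med = (\<lambda>(x, y, t). median (a x) (a y) (a t))"

text \<open>The vertex condition, integrated against g by grouping the edges according to the
  endpoint where g is evaluated.\<close>

lemma sum_diff_le: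
  assumes "\<And>x. 0 \<le> g x"
  shows "(\<Sum>e\<in>XE. rw T e * (diff e)\<^sup>2 * g (snd e)) \<le> C * (\<Sum>x\<in>X. cw T x * g x)"
proof -
  have "(\<Sum>e\<in>XE. rw T e * (diff e)\<^sup>2 * g (snd e)) =
      (\<Sum>x\<in>X. \<Sum>e\<in>{e \<in> XE. snd e = x}. rw T e * (diff e)\<^sup>2 * g (snd e))"
    by (intro sum.group[symmetric]) (simp_all, auto simp: edges_in_def)
  also have "\<dots> \<le> (\<Sum>x\<in>X. C * (cw T x * g x))"
  proof (rule sum_mono)
    fix x assume "x \<in> X"
    then have x: "x \<in> verts T"
      using X_subset by blast
    have "(\<Sum>e\<in>{e \<in> XE. snd e = x}. rw T e * (diff e)\<^sup>2 * g (snd e)) =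
        (\<Sum>e\<in>{e \<in> XE. snd e = x}. rw T e * (diff e)\<^sup>2) * g x"
      by (simp add: sum_distrib_right)
    also have "\<dots> \<le> (\<Sum>e\<in>{e \<in> edges T. snd e = x}. rw T e * (diff e)\<^sup>2) * g x"
    proof (intro mult_right_mono assms sum_mono2)
      show "0 \<le> rw T e * (diff e)\<^sup>2" if "e \<in> {e \<in> edges T. snd e = x} - {e \<in> XE. snd e = x}" for e
        using that rw_pos[of e] by simp
    qed (use x edges_in_subset in auto)
    also have "\<dots> \<le> C * cw T x * g x"
      using vert_bound[OF x] by (intro mult_right_mono assms) (simp add: diff_def)
    finally show "(\<Sum>e\<in>{e \<in> XE. snd e = x}. rw T e * (diff e)\<^sup>2 * g (snd e)) \<le> C * (cw T x * g x)"
      by (simp add: mult.assoc)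
  qed
  finally show ?thesis
    by (simp add: sum_distrib_left)
qed

definition apexes where "apexes e = {t \<in> X. (fst e, snd e, t) \<in> faces T}"

lemma finite_apexes [simp]: "finite (apexes e)"
  by (simp add: apexes_def)

lemma sum_apexes:
  "(\<Sum>e\<in>XE. \<Sum>t\<in>apexes e. h (fst e, snd e, t)) = (\<Sum>t\<in>XF. h t)"
proof -
  have "(\<Sum>e\<in>XE. \<Sum>t\<in>apexes e. h (fst e, snd e, t)) =
      (\<Sum>(e, t)\<in>Sigma (XE) apexes. h (fst e, snd e, t))"
    by (intro sum.Sigma) simp_all
  also have "\<dots> = (\<Sum>t\<in>XF. h t)"
    by (rule sum.reindex_bij_witness[of _ "\<lambda>(x, y, t). ((x, y), t)" "\<lambda>((x, y), t). (x, y, t)"])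
      (auto simp: apexes_def edges_in_def faces_in_def dest: face_edges)
  finally show ?thesis .
qed

lemma apexes_eq_face_verts:
  assumes "(x, y) \<in> edges T" "a x \<noteq> 0 \<or> a y \<noteq> 0"
  shows "apexes (x, y) = face_verts T x y"
  using face_near_support(6)[of x y] assms(2) by (auto simp: apexes_def face_verts_iff)

text \<open>The face condition, integrated against g by grouping the faces over their leading
  edge.\<close>

lemma sum_kap_le:
  assumes "\<And>e. 0 \<le> g e"
  shows "(\<Sum>(x, y, t)\<in>XF. sw T (x, y, t) * (kap (x, y, t))\<^sup>2 * g (x, y))
    \<le> C * (\<Sum>e\<in>XE. rw T e * g e)"
proof -
  have "(\<Sum>(x, y, t)\<in>XF. sw T (x, y, t) * (kap (x, y, t))\<^sup>2 * g (x, y)) =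
      (\<Sum>e\<in>XE. \<Sum>t\<in>apexes e. sw T (fst e, snd e, t) * (kap (fst e, snd e, t))\<^sup>2 * g e)"
    using sum_apexes[of "\<lambda>(x, y, t). sw T (x, y, t) * (kap (x, y, t))\<^sup>2 * g (x, y)"] by simp
  also have "\<dots> \<le> (\<Sum>e\<in>XE. C * (rw T e * g e))"
  proof (rule sum_mono)
    fix e assume "e \<in> XE"
    then obtain x y where e: "e = (x, y)" "(x, y) \<in> edges T"
      by (auto simp: edges_in_def)
    have "(\<Sum>t\<in>apexes e. sw T (fst e, snd e, t) * (kap (fst e, snd e, t))\<^sup>2 * g e) =
        (\<Sum>t\<in>apexes e. sw T (x, y, t) * (kap (x, y, t))\<^sup>2) * g e"
      by (simp add: sum_distrib_right e)
    also have "\<dots> \<le> (\<Sum>t\<in>face_verts T x y. sw T (x, y, t) * (kap (x, y, t))\<^sup>2) * g e"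
    proof (intro mult_right_mono assms sum_mono2)
      show "0 \<le> sw T (x, y, t) * (kap (x, y, t))\<^sup>2" if "t \<in> face_verts T x y - apexes e" for t
        using that sw_pos[of "(x, y, t)"] by (simp add: face_verts_iff)
    qed (use e in \<open>auto simp: apexes_def face_verts_iff\<close>)
    also have "\<dots> \<le> C * rw T e * g e"
      using face_bound[OF e(2)] by (intro mult_right_mono assms) (simp add: kap_def e)
    finally show "(\<Sum>t\<in>apexes e. sw T (fst e, snd e, t) * (kap (fst e, snd e, t))\<^sup>2 * g e) \<le> C * (rw T e * g e)"
      by (simp add: mult.assoc)
  qed
  finally show ?thesis
    by (simp add: sum_distrib_left)
qed

lemma rw_nonneg: "e \<in> XE \<Longrightarrow> 0 \<le> rw T e"
  using rw_pos[of e] edges_in_subset[of T X] by force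

lemma sw_nonneg: "t \<in> XF \<Longrightarrow> 0 \<le> sw T t"
  using sw_pos[of t] faces_in_subset[of T X] by force

section \<open>Commutator estimates\<close>

text \<open>F and G stand for the moduli of the vertex and face components of u, and P for that of
  the edge component of T u. Hence P has to keep the factor \<open>mean\<close>, while F and G may
  appear without cutoff.\<close>

lemma even_commutator_bound:
  fixes F :: "'v \<Rightarrow> real" and P :: "'v \<times> 'v \<Rightarrow> real" and G :: "'v \<times> 'v \<times> 'v \<Rightarrow> real"
  assumes nonneg: "\<And>x. 0 \<le> F x" "\<And>e. 0 \<le> P e" "\<And>t. 0 \<le> G t"
  shows "(\<Sum>e\<in>XE. rw T e * \<bar>(a (snd e))\<^sup>2 - (mean e)\<^sup>2\<bar> * P e * F (snd e))
      + 1/2 * (\<Sum>(x, y, t)\<in>XF.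
          sw T (x, y, t) * \<bar>(med (x, y, t))\<^sup>2 - (mean (x, y))\<^sup>2\<bar> * P (x, y) * G (x, y, t))
    \<le> 1/4 * (\<Sum>e\<in>XE. rw T e * (mean e)\<^sup>2 * (P e)\<^sup>2)
      + 7 * C * ((\<Sum>x\<in>X. cw T x * (F x)\<^sup>2) + 1/6 * (\<Sum>t\<in>XF. sw T t * (G t)\<^sup>2))"
    (is "?L1 + 1/2 * ?L2 \<le> _")
proof -
  let ?M = "\<Sum>e\<in>XE. rw T e * (mean e)\<^sup>2 * (P e)\<^sup>2"
  have "?L1
      \<le> (\<Sum>e\<in>XE. 1/8 * (rw T e * (mean e)\<^sup>2 * (P e)\<^sup>2)
          + 9/2 * (rw T e * (diff e)\<^sup>2 * (F (snd e))\<^sup>2))"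
  proof (rule sum_mono)
    fix e assume e: "e \<in> XE"
    have "\<bar>(a (snd e))\<^sup>2 - (mean e)\<^sup>2\<bar> \<le> 3/2 * mean e * \<bar>diff e\<bar>"
      using mean_endpoint_bound[OF a_nonneg a_nonneg, of "snd e" "fst e"]
      by (simp add: mean_def diff_def add.commute)
    then have "\<bar>(a (snd e))\<^sup>2 - (mean e)\<^sup>2\<bar> * (P e * F (snd e)) \<le> 3/2 * mean e * \<bar>diff e\<bar> * (P e * F (snd e))"
      using nonneg by (intro mult_right_mono) auto
    also have "\<dots> = (mean e * P e) * (3/2 * (\<bar>diff e\<bar> * F (snd e)))"
      by simp
    \<comment> \<open>Edges and faces each spend 1/8 of the energy; the total 1/4 can be absorbed by
      the 1/2 in front of it.\<close>
    also have "\<dots> \<le> 1/8 * (mean e * P e)\<^sup>2 + (3/2 * (\<bar>diff e\<bar> * F (snd e)))\<^sup>2 / (4 * (1/8))"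
      by (rule young) simp
    also have "\<dots> = 1/8 * ((mean e)\<^sup>2 * (P e)\<^sup>2) + 9/2 * ((diff e)\<^sup>2 * (F (snd e))\<^sup>2)"
      by (simp add: power_mult_distrib power_divide)
    finally have "rw T e * (\<bar>(a (snd e))\<^sup>2 - (mean e)\<^sup>2\<bar> * (P e * F (snd e)))
        \<le> rw T e * (1/8 * ((mean e)\<^sup>2 * (P e)\<^sup>2) + 9/2 * ((diff e)\<^sup>2 * (F (snd e))\<^sup>2))"
      using rw_nonneg[OF e] by (intro mult_left_mono)
    then show "rw T e * \<bar>(a (snd e))\<^sup>2 - (mean e)\<^sup>2\<bar> * P e * F (snd e)
        \<le> 1/8 * (rw T e * (mean e)\<^sup>2 * (P e)\<^sup>2) + 9/2 * (rw T e * (diff e)\<^sup>2 * (F (snd e))\<^sup>2)"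
      by (simp add: algebra_simps)
  qed
  also have "\<dots> = 1/8 * ?M + 9/2 * (\<Sum>e\<in>XE. rw T e * (diff e)\<^sup>2 * (F (snd e))\<^sup>2)"
    by (simp add: sum.distrib sum_distrib_left)
  also have "\<dots> \<le> 1/8 * ?M + 9/2 * (C * (\<Sum>x\<in>X. cw T x * (F x)\<^sup>2))"
    using sum_diff_le[of "\<lambda>x. (F x)\<^sup>2"] by simp
  finally have edges: "?L1
      \<le> 1/8 * ?M + 9/2 * (C * (\<Sum>x\<in>X. cw T x * (F x)\<^sup>2))" .
  have "1/2 * ?L2
      \<le> (\<Sum>(x, y, t)\<in>XF.
          1/(8 * C) * (sw T (x, y, t) * (kap (x, y, t))\<^sup>2 * ((mean (x, y))\<^sup>2 * (P (x, y))\<^sup>2))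
          + 9/8 * C * (sw T (x, y, t) * (G (x, y, t))\<^sup>2))"
    unfolding sum_distrib_left
  proof (rule sum_mono, clarify)
    fix x y t assume t: "(x, y, t) \<in> XF"
    let ?D = "\<bar>(med (x, y, t))\<^sup>2 - (mean (x, y))\<^sup>2\<bar>"
    have "?D \<le> 3/2 * mean (x, y) * \<bar>kap (x, y, t)\<bar>"
      using median_mean_bound[OF a_nonneg a_nonneg a_nonneg, of x y t]
      by (simp add: med_def mean_def kap_def)
    then have "?D * (P (x, y) * G (x, y, t)) \<le> 3/2 * mean (x, y) * \<bar>kap (x, y, t)\<bar> * (P (x, y) * G (x, y, t))"
      using nonneg by (intro mult_right_mono) auto
    also have "\<dots> = 2 * ((\<bar>kap (x, y, t)\<bar> * (mean (x, y) * P (x, y))) * (3/4 * G (x, y, t)))"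
      by simp
    \<comment> \<open>The weight is divided by C, because summing the squared second differences
      gives back a factor C.\<close>
    also have "\<dots> \<le> 2 * (1/(8 * C) * (\<bar>kap (x, y, t)\<bar> * (mean (x, y) * P (x, y)))\<^sup>2
        + (3/4 * G (x, y, t))\<^sup>2 / (4 * (1/(8 * C))))"
      using C_pos by (intro mult_left_mono young) auto
    also have "\<dots> = 2 * (1/(8 * C) * ((kap (x, y, t))\<^sup>2 * ((mean (x, y))\<^sup>2 * (P (x, y))\<^sup>2))
        + 9/8 * C * (G (x, y, t))\<^sup>2)"
      using C_pos by (simp add: power_mult_distrib power_divide)
    finally have "sw T (x, y, t) * (?D * (P (x, y) * G (x, y, t))) \<le> sw T (x, y, t) *
        (2 * (1/(8 * C) * ((kap (x, y, t))\<^sup>2 * ((mean (x, y))\<^sup>2 * (P (x, y))\<^sup>2)) + 9/8 * C * (G (x, y, t))\<^sup>2))"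
      using sw_nonneg[OF t] by (intro mult_left_mono)
    then show "1/2 * (sw T (x, y, t) * ?D * P (x, y) * G (x, y, t))
        \<le> 1/(8 * C) * (sw T (x, y, t) * (kap (x, y, t))\<^sup>2 * ((mean (x, y))\<^sup>2 * (P (x, y))\<^sup>2))
          + 9/8 * C * (sw T (x, y, t) * (G (x, y, t))\<^sup>2)"
      by (simp add: algebra_simps)
  qed
  also have "\<dots> = 1/(8 * C) * (\<Sum>(x, y, t)\<in>XF.
        sw T (x, y, t) * (kap (x, y, t))\<^sup>2 * ((mean (x, y))\<^sup>2 * (P (x, y))\<^sup>2))
      + 9/8 * C * (\<Sum>t\<in>XF. sw T t * (G t)\<^sup>2)"
    by (simp add: case_prod_beta sum.distrib sum_distrib_left)
  also have "\<dots> \<le> 1/(8 * C) * (C * ?M) + 9/8 * C * (\<Sum>t\<in>XF. sw T t * (G t)\<^sup>2)"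
    using sum_kap_le[of "\<lambda>e. (mean e)\<^sup>2 * (P e)\<^sup>2"] C_pos
    by (intro add_mono mult_left_mono) (simp_all add: mult.assoc)
  also have "\<dots> = 1/8 * ?M + 9/8 * C * (\<Sum>t\<in>XF. sw T t * (G t)\<^sup>2)"
    using C_pos by simp
  finally have faces: "1/2 * ?L2
      \<le> 1/8 * ?M + 9/8 * C * (\<Sum>t\<in>XF. sw T t * (G t)\<^sup>2)" .
  \<comment> \<open>The constant 7 covers both 9/2 on vertices and 9/8 on faces, the latter because
    9/8 is below 7/6.\<close>
  have "0 \<le> C * (\<Sum>x\<in>X. cw T x * (F x)\<^sup>2)" "0 \<le> C * (\<Sum>t\<in>XF. sw T t * (G t)\<^sup>2)"
    using C_pos X_subset V.w_nonneg sw_nonneg by (auto intro!: mult_nonneg_nonneg sum_nonneg)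
  then have "9/2 * (C * (\<Sum>x\<in>X. cw T x * (F x)\<^sup>2)) + 9/8 * C * (\<Sum>t\<in>XF. sw T t * (G t)\<^sup>2)
      \<le> 7 * C * ((\<Sum>x\<in>X. cw T x * (F x)\<^sup>2) + 1/6 * (\<Sum>t\<in>XF. sw T t * (G t)\<^sup>2))"
    by (simp add: algebra_simps)
  then show ?thesis
    using edges faces by linarith
qed

text \<open>The roles are exchanged: P is the modulus of the square-summable edge component, F and G
  belong to T u and must keep a and \<open>avg\<close>. The remainder of
  \<open>endpoint_mean_bound\<close> cannot be written that way; Young's inequality with a free
  \<eta> splits it into the increment term and a norm of P on the edges where the cutoff
  varies.\<close>

lemma odd_commutator_bound:
  fixes F :: "'v \<Rightarrow> real" and P :: "'v \<times> 'v \<Rightarrow> real" and G :: "'v \<times> 'v \<times> 'v \<Rightarrow> real"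
  assumes nonneg: "\<And>x. 0 \<le> F x" "\<And>e. 0 \<le> P e" "\<And>t. 0 \<le> G t" and "\<eta> > 0"
  shows "(\<Sum>e\<in>XE. rw T e * \<bar>(a (snd e))\<^sup>2 - (mean e)\<^sup>2\<bar> * P e * F (snd e))
      + 1/2 * (\<Sum>(x, y, t)\<in>XF.
          sw T (x, y, t) * \<bar>(avg (x, y, t))\<^sup>2 - (mean (x, y))\<^sup>2\<bar> * P (x, y) * G (x, y, t))
    \<le> 1/4 * ((\<Sum>x\<in>X. cw T x * (a x * F x)\<^sup>2) + 1/6 * (\<Sum>t\<in>XF. sw T t * (avg t * G t)\<^sup>2))
      + 2 * C * (\<Sum>e\<in>XE. rw T e * (P e)\<^sup>2)
      + \<eta> * (\<Sum>e\<in>XE. rw T e * (max 0 (diff e)) ^ 4 * (F (snd e))\<^sup>2)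
      + 1/(64 * \<eta>) * (\<Sum>e\<in>XE. rw T e * (of_bool (diff e \<noteq> 0) * (P e)\<^sup>2))"
    (is "?L1 + 1/2 * ?L2 \<le> _")
proof -
  let ?P = "\<Sum>e\<in>XE. rw T e * (P e)\<^sup>2"
  let ?Z = "\<Sum>e\<in>XE. rw T e * (max 0 (diff e)) ^ 4 * (F (snd e))\<^sup>2"
  let ?Pd = "\<Sum>e\<in>XE. rw T e * (of_bool (diff e \<noteq> 0) * (P e)\<^sup>2)"
  have "?L1
      \<le> (\<Sum>e\<in>XE. 1/(4 * C) * (rw T e * (diff e)\<^sup>2 * (a (snd e) * F (snd e))\<^sup>2)
          + 25/16 * C * (rw T e * (P e)\<^sup>2)
          + \<eta> * (rw T e * (max 0 (diff e)) ^ 4 * (F (snd e))\<^sup>2)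
          + 1/(64 * \<eta>) * (rw T e * (of_bool (diff e \<noteq> 0) * (P e)\<^sup>2)))"
  proof (rule sum_mono)
    fix e assume e: "e \<in> XE"
    have bound: "\<bar>(a (snd e))\<^sup>2 - (mean e)\<^sup>2\<bar> \<le> 5/4 * a (snd e) * \<bar>diff e\<bar> + (max 0 (diff e))\<^sup>2 / 4"
      using endpoint_mean_bound[OF a_nonneg a_nonneg, of "snd e" "fst e"]
      by (simp add: mean_def diff_def add.commute)
    have "(\<bar>diff e\<bar> * (a (snd e) * F (snd e))) * (5/4 * P e)
        \<le> 1/(4 * C) * (\<bar>diff e\<bar> * (a (snd e) * F (snd e)))\<^sup>2 + (5/4 * P e)\<^sup>2 / (4 * (1/(4 * C)))"
      using C_pos by (intro young) simp
    then have near: "5/4 * a (snd e) * \<bar>diff e\<bar> * (P e * F (snd e))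
        \<le> 1/(4 * C) * ((diff e)\<^sup>2 * (a (snd e) * F (snd e))\<^sup>2) + 25/16 * C * (P e)\<^sup>2"
      by (simp add: power_mult_distrib power_divide algebra_simps)
    \<comment> \<open>For diff e = 0 the left-hand side vanishes, so the indicator may be inserted.
      It will confine this term to the tail of the norm; 1/64 is (1/4) squared divided by 4.\<close>
    have "((max 0 (diff e))\<^sup>2 * F (snd e)) * (1/4 * (of_bool (diff e \<noteq> 0) * P e))
        \<le> \<eta> * ((max 0 (diff e))\<^sup>2 * F (snd e))\<^sup>2 + (1/4 * (of_bool (diff e \<noteq> 0) * P e))\<^sup>2 / (4 * \<eta>)"
      using \<open>\<eta> > 0\<close> by (rule young)
    moreover have "((max 0 (diff e))\<^sup>2)\<^sup>2 = (max 0 (diff e)) ^ 4"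
      by (simp flip: power_mult)
    ultimately have far: "(max 0 (diff e))\<^sup>2 / 4 * (P e * F (snd e))
        \<le> \<eta> * ((max 0 (diff e)) ^ 4 * (F (snd e))\<^sup>2) + 1/(64 * \<eta>) * (of_bool (diff e \<noteq> 0) * (P e)\<^sup>2)"
      using \<open>\<eta> > 0\<close> by (cases "diff e = 0") (simp_all add: power_mult_distrib power_divide mult_ac)
    have "\<bar>(a (snd e))\<^sup>2 - (mean e)\<^sup>2\<bar> * (P e * F (snd e)) \<le>
        (5/4 * a (snd e) * \<bar>diff e\<bar> + (max 0 (diff e))\<^sup>2 / 4) * (P e * F (snd e))"
      using bound nonneg by (intro mult_right_mono) auto
    also have "\<dots> = 5/4 * a (snd e) * \<bar>diff e\<bar> * (P e * F (snd e)) + (max 0 (diff e))\<^sup>2 / 4 * (P e * F (snd e))"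
      by (rule distrib_right)
    also have "\<dots> \<le> (1/(4 * C) * ((diff e)\<^sup>2 * (a (snd e) * F (snd e))\<^sup>2) + 25/16 * C * (P e)\<^sup>2)
        + (\<eta> * ((max 0 (diff e)) ^ 4 * (F (snd e))\<^sup>2) + 1/(64 * \<eta>) * (of_bool (diff e \<noteq> 0) * (P e)\<^sup>2))"
      using near far by (rule add_mono)
    finally have "rw T e * (\<bar>(a (snd e))\<^sup>2 - (mean e)\<^sup>2\<bar> * (P e * F (snd e))) \<le> rw T e *
        ((1/(4 * C) * ((diff e)\<^sup>2 * (a (snd e) * F (snd e))\<^sup>2) + 25/16 * C * (P e)\<^sup>2)
        + (\<eta> * ((max 0 (diff e)) ^ 4 * (F (snd e))\<^sup>2) + 1/(64 * \<eta>) * (of_bool (diff e \<noteq> 0) * (P e)\<^sup>2)))"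
      using rw_nonneg[OF e] by (intro mult_left_mono)
    then show "rw T e * \<bar>(a (snd e))\<^sup>2 - (mean e)\<^sup>2\<bar> * P e * F (snd e)
        \<le> 1/(4 * C) * (rw T e * (diff e)\<^sup>2 * (a (snd e) * F (snd e))\<^sup>2) + 25/16 * C * (rw T e * (P e)\<^sup>2)
          + \<eta> * (rw T e * (max 0 (diff e)) ^ 4 * (F (snd e))\<^sup>2)
          + 1/(64 * \<eta>) * (rw T e * (of_bool (diff e \<noteq> 0) * (P e)\<^sup>2))"
      by (simp only: distrib_left mult_ac)
  qed
  also have "\<dots> = 1/(4 * C) * (\<Sum>e\<in>XE. rw T e * (diff e)\<^sup>2 * (a (snd e) * F (snd e))\<^sup>2)
      + 25/16 * C * ?P + \<eta> * ?Z + 1/(64 * \<eta>) * ?Pd"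
    by (simp only: sum.distrib sum_distrib_left)
  also have "\<dots> \<le> 1/(4 * C) * (C * (\<Sum>x\<in>X. cw T x * (a x * F x)\<^sup>2))
      + 25/16 * C * ?P + \<eta> * ?Z + 1/(64 * \<eta>) * ?Pd"
    using sum_diff_le[of "\<lambda>x. (a x * F x)\<^sup>2"] C_pos by (intro add_right_mono mult_left_mono) simp_all
  also have "1/(4 * C) * (C * (\<Sum>x\<in>X. cw T x * (a x * F x)\<^sup>2)) = 1/4 * (\<Sum>x\<in>X. cw T x * (a x * F x)\<^sup>2)"
    using C_pos by simp
  finally have edges: "?L1
      \<le> 1/4 * (\<Sum>x\<in>X. cw T x * (a x * F x)\<^sup>2) + 25/16 * C * ?P + \<eta> * ?Z + 1/(64 * \<eta>) * ?Pd" .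
  have "1/2 * ?L2
      \<le> (\<Sum>(x, y, t)\<in>XF. 1/24 * (sw T (x, y, t) * (avg (x, y, t) * G (x, y, t))\<^sup>2)
          + 3/8 * (sw T (x, y, t) * (kap (x, y, t))\<^sup>2 * (P (x, y))\<^sup>2))"
    unfolding sum_distrib_left
  proof (rule sum_mono, clarify)
    fix x y t assume t: "(x, y, t) \<in> XF"
    let ?D = "\<bar>(avg (x, y, t))\<^sup>2 - (mean (x, y))\<^sup>2\<bar>"
    have "?D \<le> 1/2 * avg (x, y, t) * \<bar>kap (x, y, t)\<bar>"
      using average_mean_bound[OF a_nonneg a_nonneg a_nonneg, of x y t]
      by (simp add: avg_def mean_def kap_def)
    then have "?D * (P (x, y) * G (x, y, t)) \<le> 1/2 * avg (x, y, t) * \<bar>kap (x, y, t)\<bar> * (P (x, y) * G (x, y, t))"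
      using nonneg by (intro mult_right_mono) auto
    also have "\<dots> = 2 * ((avg (x, y, t) * G (x, y, t)) * (1/4 * (\<bar>kap (x, y, t)\<bar> * P (x, y))))"
      by simp
    \<comment> \<open>1/24 is a quarter of the weight 1/6 that faces have in the energy, matching
      the quarter spent on vertices.\<close>
    also have "\<dots> \<le> 2 * (1/24 * (avg (x, y, t) * G (x, y, t))\<^sup>2
        + (1/4 * (\<bar>kap (x, y, t)\<bar> * P (x, y)))\<^sup>2 / (4 * (1/24)))"
      by (intro mult_left_mono young) auto
    also have "\<dots> = 2 * (1/24 * (avg (x, y, t) * G (x, y, t))\<^sup>2 + 3/8 * ((kap (x, y, t))\<^sup>2 * (P (x, y))\<^sup>2))"
      by (simp add: power_mult_distrib power_divide)
    finally have "sw T (x, y, t) * (?D * (P (x, y) * G (x, y, t))) \<le> sw T (x, y, t) *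
        (2 * (1/24 * (avg (x, y, t) * G (x, y, t))\<^sup>2 + 3/8 * ((kap (x, y, t))\<^sup>2 * (P (x, y))\<^sup>2)))"
      using sw_nonneg[OF t] by (intro mult_left_mono)
    then show "1/2 * (sw T (x, y, t) * ?D * P (x, y) * G (x, y, t))
        \<le> 1/24 * (sw T (x, y, t) * (avg (x, y, t) * G (x, y, t))\<^sup>2)
          + 3/8 * (sw T (x, y, t) * (kap (x, y, t))\<^sup>2 * (P (x, y))\<^sup>2)"
      by (simp add: algebra_simps)
  qed
  also have "\<dots> = 1/24 * (\<Sum>t\<in>XF. sw T t * (avg t * G t)\<^sup>2)
      + 3/8 * (\<Sum>(x, y, t)\<in>XF. sw T (x, y, t) * (kap (x, y, t))\<^sup>2 * (P (x, y))\<^sup>2)"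
    by (simp add: case_prod_beta sum.distrib sum_distrib_left)
  also have "\<dots> \<le> 1/24 * (\<Sum>t\<in>XF. sw T t * (avg t * G t)\<^sup>2) + 3/8 * (C * ?P)"
    using sum_kap_le[of "\<lambda>e. (P e)\<^sup>2"] by simp
  finally have faces: "1/2 * ?L2
      \<le> 1/24 * (\<Sum>t\<in>XF. sw T t * (avg t * G t)\<^sup>2) + 3/8 * (C * ?P)" .
  \<comment> \<open>The coefficients of C P add up to 25/16 + 3/8 = 31/16, rounded up to 2.\<close>
  have "0 \<le> C * ?P"
    using C_pos rw_nonneg by (auto intro!: mult_nonneg_nonneg sum_nonneg)
  then have "25/16 * C * ?P + 3/8 * (C * ?P) \<le> 2 * C * ?P"
    by simp
  then show ?thesis
    using edges faces by (simp only: distrib_left mult.assoc[symmetric])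
qed

section \<open>The increment term at lower vertices\<close>

text \<open>Heavy adjacent faces let r be traded for a squared increment times their weight, and the
  sixth power is split face by face. Both resulting terms are again fourth powers of an increment
  times a squared second difference: on the edge (y, x) itself and on (t, x). The lower vertex x,
  hence f, is the same for both.\<close>

lemma rigid_edge_bound:
  assumes e: "(y, x) \<in> edges T" and pos: "0 < a y - a x" and "0 \<le> f"
    and rigid: "2056 * C * rw T (y, x) \<le> (a y - a x)\<^sup>2 * (\<Sum>t\<in>face_verts T y x. sw T (y, x, t))"
  shows "2056 * C * (rw T (y, x) * (a y - a x) ^ 4 * f) \<le> (\<Sum>t\<in>face_verts T y x. sw T (y, x, t) *
    (4 * ((a y - a x) ^ 4 * f) * (kap (y, x, t))\<^sup>2 + 1024 * ((max 0 (a t - a x)) ^ 4 * f) * (kap (t, x, y))\<^sup>2))"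
proof -
  let ?d = "a y - a x"
  have "2056 * C * (rw T (y, x) * ?d ^ 4 * f) = 2056 * C * rw T (y, x) * (?d ^ 4 * f)"
    by simp
  also have "\<dots> \<le> ?d\<^sup>2 * (\<Sum>t\<in>face_verts T y x. sw T (y, x, t)) * (?d ^ 4 * f)"
    using rigid \<open>0 \<le> f\<close> by (intro mult_right_mono) auto
  also have "\<dots> = (\<Sum>t\<in>face_verts T y x. sw T (y, x, t) * (?d ^ 6 * f))"
    by (simp add: sum_distrib_left sum_distrib_right power_add[symmetric] flip: power_add)
      (simp add: eval_nat_numeral mult_ac)
  also have "\<dots> \<le> (\<Sum>t\<in>face_verts T y x. sw T (y, x, t) *
    (4 * (?d ^ 4 * f) * (kap (y, x, t))\<^sup>2 + 1024 * ((max 0 (a t - a x)) ^ 4 * f) * (kap (t, x, y))\<^sup>2))"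
  proof (intro sum_mono mult_left_mono)
    fix t assume "t \<in> face_verts T y x"
    then show "0 \<le> sw T (y, x, t)"
      using sw_pos[of "(y, x, t)"] by (simp add: face_verts_iff)
    \<comment> \<open>Heights are measured from the lower vertex x: d for y and \<tau> = a t - a x
      for the apex.\<close>
    have "kap (y, x, t) = ?d - 2 * (a t - a x)" "kap (t, x, y) = (a t - a x) - 2 * ?d"
      by (simp_all add: kap_def)
    then have "?d ^ 6 \<le> 4 * ?d ^ 4 * (kap (y, x, t))\<^sup>2 + 1024 * (max 0 (a t - a x)) ^ 4 * (kap (t, x, y))\<^sup>2"
      using midpoint_dichotomy[OF pos, of "a t - a x"] by simp
    from mult_right_mono[OF this \<open>0 \<le> f\<close>]
    show "?d ^ 6 * f \<le> 4 * (?d ^ 4 * f) * (kap (y, x, t))\<^sup>2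
        + 1024 * ((max 0 (a t - a x)) ^ 4 * f) * (kap (t, x, y))\<^sup>2"
      by (simp add: algebra_simps)
  qed
  finally show ?thesis .
qed

text \<open>With light adjacent faces the equation on the edge may be used: f at the lower vertex is
  bounded by the value f' at the upper vertex, the edge value p and a weighted sum over faces.
  Powers of the increment serve as the cutoff that the lower vertex lacks.\<close>

lemma flexible_edge_bound:
  assumes e: "(y, x) \<in> edges T" and pos: "0 < a y - a x"
    and flexible: "(a y - a x)\<^sup>2 * (\<Sum>t\<in>face_verts T y x. sw T (y, x, t)) \<le> A * rw T (y, x)"
    and nonneg: "0 \<le> A" "0 \<le> f" "0 \<le> f'" "0 \<le> p" "\<And>t. 0 \<le> G t"
    and f: "f \<le> p + f' + (\<Sum>t\<in>face_verts T y x. sw T (y, x, t) * G (y, x, t)) / rw T (y, x)"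
  shows "rw T (y, x) * (a y - a x) ^ 4 * f\<^sup>2 \<le> 3 * (rw T (y, x) * p\<^sup>2)
    + 3 * (rw T (y, x) * (a y - a x)\<^sup>2 * (a y * f')\<^sup>2)
    + 27 * A * (\<Sum>t\<in>face_verts T y x. sw T (y, x, t) * (avg (y, x, t) * G (y, x, t))\<^sup>2)"
proof -
  let ?d = "a y - a x" and ?r = "rw T (y, x)"
  let ?s = "\<lambda>t. sw T (y, x, t)"
  define Q where "Q = (\<Sum>t\<in>face_verts T y x. ?s t)"
  define B where "B = (\<Sum>t\<in>face_verts T y x. ?s t * G (y, x, t))"
  define G2 where "G2 = (\<Sum>t\<in>face_verts T y x. ?s t * (G (y, x, t))\<^sup>2)"
  define H2 where "H2 = (\<Sum>t\<in>face_verts T y x. ?s t * (avg (y, x, t) * G (y, x, t))\<^sup>2)"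
  have r: "?r > 0"
    using rw_pos[OF e] .
  have s: "0 \<le> ?s t" if "t \<in> face_verts T y x" for t
    using that sw_pos[of "(y, x, t)"] by (simp add: face_verts_iff)
  \<comment> \<open>Since a x is nonnegative, the increment is dominated by the cutoff at the upper
    vertex, and so by three times the face average.\<close>
  have d: "?d \<le> 1" "?d \<le> a y"
    using a_le_1[of y] a_nonneg[of x] by simp_all
  have G2: "0 \<le> G2"
    unfolding G2_def using s by (intro sum_nonneg) simp
  have "f\<^sup>2 \<le> (p + f' + B / ?r)\<^sup>2"
    using f nonneg by (intro power_mono) (simp_all add: B_def)
  also have "\<dots> \<le> 3 * (p\<^sup>2 + f'\<^sup>2 + (B / ?r)\<^sup>2)"
    by (rule sum_three_squares_le)
  finally have "?r * ?d ^ 4 * f\<^sup>2 \<le> ?r * ?d ^ 4 * (3 * (p\<^sup>2 + f'\<^sup>2 + (B / ?r)\<^sup>2))"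
    using r by (intro mult_left_mono) auto
  then have main: "?r * ?d ^ 4 * f\<^sup>2 \<le> 3 * (?r * (?d ^ 4 * p\<^sup>2)) + 3 * (?r * (?d ^ 4 * f'\<^sup>2))
      + 3 * (?d ^ 4 * (?r * (B / ?r)\<^sup>2))"
    by (simp add: algebra_simps)
  have "?d ^ 4 \<le> 1"
    using d pos by (intro power_le_one) auto
  then have p: "?r * (?d ^ 4 * p\<^sup>2) \<le> ?r * p\<^sup>2"
    using r by (intro mult_left_mono mult_left_le_one_le) auto
  have "?d ^ 4 = ?d\<^sup>2 * ?d\<^sup>2"
    by (simp flip: power_add)
  also have "\<dots> \<le> ?d\<^sup>2 * (a y)\<^sup>2"
    using d pos by (intro mult_left_mono power_mono) auto
  finally have "?d ^ 4 * f'\<^sup>2 \<le> ?d\<^sup>2 * (a y)\<^sup>2 * f'\<^sup>2"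
    by (intro mult_right_mono) auto
  then have f': "?r * (?d ^ 4 * f'\<^sup>2) \<le> ?r * ?d\<^sup>2 * (a y * f')\<^sup>2"
    using r by (simp add: power_mult_distrib mult.assoc)
  have "B\<^sup>2 \<le> Q * G2"
    unfolding B_def Q_def G2_def using s by (rule weighted_Cauchy_Schwarz)
  then have "?r * (B / ?r)\<^sup>2 \<le> Q * G2 / ?r"
    using r by (simp add: power_divide power2_eq_square divide_right_mono)
  then have "?d ^ 4 * (?r * (B / ?r)\<^sup>2) \<le> ?d ^ 4 * (Q * G2 / ?r)"
    by (intro mult_left_mono) auto
  \<comment> \<open>Of the four powers of the increment, two go with the total face weight Q and are
    bounded by \<open>A * ?r\<close>, two go with G2 and become the squared face cutoff.\<close>
  also have "\<dots> = (?d\<^sup>2 * Q) * (?d\<^sup>2 * G2) / ?r"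
    by (simp add: eval_nat_numeral mult_ac)
  also have "\<dots> \<le> (A * ?r) * (?d\<^sup>2 * G2) / ?r"
    using flexible r G2 by (intro divide_right_mono mult_right_mono) (simp_all add: Q_def)
  also have "\<dots> = A * (?d\<^sup>2 * G2)"
    using r by simp
  also have "\<dots> \<le> A * (9 * H2)"
  proof (rule mult_left_mono[OF _ nonneg(1)])
    have "?d\<^sup>2 * (?s t * (G (y, x, t))\<^sup>2) \<le> 9 * (?s t * (avg (y, x, t) * G (y, x, t))\<^sup>2)"
      if t: "t \<in> face_verts T y x" for t
    proof -
      have "?d \<le> 3 * avg (y, x, t)"
        using d a_nonneg[of x] a_nonneg[of t] by (simp add: avg_def)
      then have "?d\<^sup>2 \<le> (3 * avg (y, x, t))\<^sup>2"
        using pos by (intro power_mono) auto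
      then have "?d\<^sup>2 * (?s t * (G (y, x, t))\<^sup>2) \<le> (3 * avg (y, x, t))\<^sup>2 * (?s t * (G (y, x, t))\<^sup>2)"
        using s[OF t] by (intro mult_right_mono) auto
      then show ?thesis
        by (simp add: power_mult_distrib mult_ac)
    qed
    then show "?d\<^sup>2 * G2 \<le> 9 * H2"
      unfolding G2_def H2_def sum_distrib_left by (intro sum_mono)
  qed
  finally have B: "?d ^ 4 * (?r * (B / ?r)\<^sup>2) \<le> 9 * (A * H2)"
    by simp
  show ?thesis
    using main p f' B by (simp add: H2_def)
qed

text \<open>The two edge bounds are summed. The rigid edges reproduce at most half of the left-hand
  side, which is a finite sum and can be subtracted.\<close>

lemma increment_bound:
  fixes F :: "'v \<Rightarrow> real" and P :: "'v \<times> 'v \<Rightarrow> real" and G :: "'v \<times> 'v \<times> 'v \<Rightarrow> real"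
  assumes nonneg: "\<And>x. 0 \<le> F x" "\<And>e. 0 \<le> P e" "\<And>t. 0 \<le> G t"
    and F: "\<And>x y. (y, x) \<in> edges T \<Longrightarrow>
      F x \<le> P (y, x) + F y + (\<Sum>t\<in>face_verts T y x. sw T (y, x, t) * G (y, x, t)) / rw T (y, x)"
  shows "(\<Sum>e\<in>XE. rw T e * (max 0 (diff e)) ^ 4 * (F (snd e))\<^sup>2)
    \<le> 6 * (\<Sum>e\<in>XE. rw T e * (of_bool (diff e \<noteq> 0) * (P e)\<^sup>2))
      + 700000 * C * ((\<Sum>x\<in>X. cw T x * (a x * F x)\<^sup>2) + 1/6 * (\<Sum>t\<in>XF. sw T t * (avg t * G t)\<^sup>2))"
proof -
  let ?Z = "\<Sum>e\<in>XE. rw T e * (max 0 (diff e)) ^ 4 * (F (snd e))\<^sup>2"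
  let ?Pd = "\<Sum>e\<in>XE. rw T e * (of_bool (diff e \<noteq> 0) * (P e)\<^sup>2)"
  let ?V = "\<Sum>x\<in>X. cw T x * (a x * F x)\<^sup>2"
  let ?W = "\<Sum>t\<in>XF. sw T t * (avg t * G t)\<^sup>2"
  let ?A = "2056 * C"
  define z where "z e = (max 0 (diff e)) ^ 4 * (F (snd e))\<^sup>2" for e
  have z: "0 \<le> z e" for e
    by (simp add: z_def)
  define h1 where "h1 = (\<lambda>(y, x, t). sw T (y, x, t) * (kap (y, x, t))\<^sup>2 * z (y, x))"
  define h2 where "h2 = (\<lambda>(y, x, t). sw T (y, x, t) * (kap (t, x, y))\<^sup>2 * z (t, x))"
  define h3 where "h3 t = sw T t * (avg t * G t)\<^sup>2" for t
  have h_nonneg: "0 \<le> h1 (y, x, t)" "0 \<le> h2 (y, x, t)" "0 \<le> h3 (y, x, t)" if "(y, x, t) \<in> XF" for y x t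
    using sw_nonneg[OF that] z by (simp_all add: h1_def h2_def h3_def)
  \<comment> \<open>The right-hand side adds the bounds of both cases instead of choosing one, so
    that it can be summed over all edges at once.\<close>
  have per_edge: "rw T e * z e \<le> (\<Sum>t\<in>apexes e. 1/?A * (4 * h1 (fst e, snd e, t) + 1024 * h2 (fst e, snd e, t)))
      + (3 * (rw T e * (of_bool (diff e \<noteq> 0) * (P e)\<^sup>2)) + 3 * (rw T e * (diff e)\<^sup>2 * (a (fst e) * F (fst e))\<^sup>2))
      + (\<Sum>t\<in>apexes e. 27 * ?A * h3 (fst e, snd e, t))"
    if e: "e \<in> XE" for e
  proof -
    obtain y x where yx: "e = (y, x)" "(y, x) \<in> edges T" "y \<in> X" "x \<in> X"
      using e by (auto simp: edges_in_def)
    have faces: "(y, x, t) \<in> XF" if "t \<in> apexes e" for t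
      using that yx by (simp add: apexes_def faces_in_def)
    have 1: "0 \<le> (\<Sum>t\<in>apexes e. 1/?A * (4 * h1 (fst e, snd e, t) + 1024 * h2 (fst e, snd e, t)))"
      using h_nonneg faces C_pos unfolding yx(1) by (intro sum_nonneg) (simp add: yx(1))
    have 2: "0 \<le> 3 * (rw T e * (of_bool (diff e \<noteq> 0) * (P e)\<^sup>2)) + 3 * (rw T e * (diff e)\<^sup>2 * (a (fst e) * F (fst e))\<^sup>2)"
      using rw_nonneg[OF e] by simp
    have 3: "0 \<le> (\<Sum>t\<in>apexes e. 27 * ?A * h3 (fst e, snd e, t))"
      using h_nonneg faces C_pos unfolding yx(1) by (intro sum_nonneg) (simp add: yx(1))
    show ?thesis
    proof (cases "a y - a x > 0")
      case False
      then have "z e = 0"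
        by (simp add: z_def yx(1) diff_def max_def)
      then show ?thesis
        using 1 2 3 by simp
    next
      case pos: True
      have ay: "a y \<noteq> 0"
        using pos a_nonneg[of x] by auto
      have apexes: "apexes e = face_verts T y x"
        unfolding yx(1) using yx(2) ay by (intro apexes_eq_face_verts) auto
      have ze: "z e = (a y - a x) ^ 4 * (F x)\<^sup>2"
        using pos by (simp add: z_def yx(1) diff_def)
      show ?thesis
      proof (cases "?A * rw T (y, x) \<le> (a y - a x)\<^sup>2 * (\<Sum>t\<in>face_verts T y x. sw T (y, x, t))")
        case True
        have "?A * (rw T e * z e) \<le> (\<Sum>t\<in>face_verts T y x. sw T (y, x, t) *
            (4 * ((a y - a x) ^ 4 * (F x)\<^sup>2) * (kap (y, x, t))\<^sup>2
            + 1024 * ((max 0 (a t - a x)) ^ 4 * (F x)\<^sup>2) * (kap (t, x, y))\<^sup>2))"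
          using rigid_edge_bound[OF yx(2) pos _ True, of "(F x)\<^sup>2"] ze by (simp add: yx(1) mult_ac)
        also have "\<dots> = (\<Sum>t\<in>apexes e. 4 * h1 (fst e, snd e, t) + 1024 * h2 (fst e, snd e, t))"
          unfolding apexes
        proof (rule sum.cong[OF refl])
          fix t
          have "z (y, x) = (a y - a x) ^ 4 * (F x)\<^sup>2" "z (t, x) = (max 0 (a t - a x)) ^ 4 * (F x)\<^sup>2"
            using ze by (simp_all add: z_def yx(1) diff_def)
          then show "sw T (y, x, t) * (4 * ((a y - a x) ^ 4 * (F x)\<^sup>2) * (kap (y, x, t))\<^sup>2
              + 1024 * ((max 0 (a t - a x)) ^ 4 * (F x)\<^sup>2) * (kap (t, x, y))\<^sup>2)
              = 4 * h1 (fst e, snd e, t) + 1024 * h2 (fst e, snd e, t)"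
            by (simp add: h1_def h2_def yx(1) distrib_left mult_ac)
        qed
        finally have "rw T e * z e \<le> 1/?A * (\<Sum>t\<in>apexes e. 4 * h1 (fst e, snd e, t) + 1024 * h2 (fst e, snd e, t))"
          using C_pos by (simp add: pos_le_divide_eq mult_ac)
        then show ?thesis
          using 2 3 unfolding sum_distrib_left by linarith
      next
        case False
        have "rw T (y, x) * (a y - a x) ^ 4 * (F x)\<^sup>2 \<le> 3 * (rw T (y, x) * (P (y, x))\<^sup>2)
            + 3 * (rw T (y, x) * (a y - a x)\<^sup>2 * (a y * F y)\<^sup>2)
            + 27 * ?A * (\<Sum>t\<in>face_verts T y x. sw T (y, x, t) * (avg (y, x, t) * G (y, x, t))\<^sup>2)"
          using False C_pos nonneg F[OF yx(2)] by (intro flexible_edge_bound yx(2) pos) auto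
        then have "rw T e * z e \<le> 3 * (rw T e * (of_bool (diff e \<noteq> 0) * (P e)\<^sup>2))
            + 3 * (rw T e * (diff e)\<^sup>2 * (a (fst e) * F (fst e))\<^sup>2)
            + (\<Sum>t\<in>apexes e. 27 * ?A * h3 (fst e, snd e, t))"
          using pos unfolding apexes ze by (simp add: yx(1) diff_def h3_def sum_distrib_left mult.assoc)
        then show ?thesis
          using 1 by linarith
      qed
    qed
  qed
  have "?Z = (\<Sum>e\<in>XE. rw T e * z e)"
    by (simp add: z_def mult.assoc)
  also have "\<dots> \<le> (\<Sum>e\<in>XE.
        (\<Sum>t\<in>apexes e. 1/?A * (4 * h1 (fst e, snd e, t) + 1024 * h2 (fst e, snd e, t)))
      + (3 * (rw T e * (of_bool (diff e \<noteq> 0) * (P e)\<^sup>2)) + 3 * (rw T e * (diff e)\<^sup>2 * (a (fst e) * F (fst e))\<^sup>2))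
      + (\<Sum>t\<in>apexes e. 27 * ?A * h3 (fst e, snd e, t)))"
    by (intro sum_mono per_edge)
  also have "\<dots> = (\<Sum>t\<in>XF. 1/?A * (4 * h1 t + 1024 * h2 t))
      + (3 * ?Pd + 3 * (\<Sum>e\<in>XE. rw T e * (diff e)\<^sup>2 * (a (fst e) * F (fst e))\<^sup>2))
      + (\<Sum>t\<in>XF. 27 * ?A * h3 t)"
    using sum_apexes[of "\<lambda>t. 1/?A * (4 * h1 t + 1024 * h2 t)"] sum_apexes[of "\<lambda>t. 27 * ?A * h3 t"]
    by (simp only: sum.distrib sum_distrib_left)
  also have "\<dots> = 1/?A * (4 * (\<Sum>t\<in>XF. h1 t) + 1024 * (\<Sum>t\<in>XF. h2 t))
      + (3 * ?Pd + 3 * (\<Sum>e\<in>XE. rw T e * (diff e)\<^sup>2 * (a (fst e) * F (fst e))\<^sup>2)) + 27 * ?A * ?W"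
    by (simp only: sum.distrib sum_distrib_left[symmetric] h3_def)
  finally have Z: "?Z \<le> 1/?A * (4 * (\<Sum>t\<in>XF. h1 t) + 1024 * (\<Sum>t\<in>XF. h2 t))
      + (3 * ?Pd + 3 * (\<Sum>e\<in>XE. rw T e * (diff e)\<^sup>2 * (a (fst e) * F (fst e))\<^sup>2)) + 27 * ?A * ?W" .
  have h1: "(\<Sum>t\<in>XF. h1 t) \<le> C * ?Z"
    using sum_kap_le[of z] z by (simp add: h1_def case_prod_beta z_def mult.assoc)
  \<comment> \<open>Exchanging the upper vertex y with the apex t keeps x in place and turns the
    second kind of term into the other one.\<close>
  have "(\<Sum>t\<in>XF. h2 t) = (\<Sum>t\<in>XF. h1 t)"
  proof (rule sum.reindex_bij_witness[of _ "\<lambda>(y, x, t). (t, x, y)" "\<lambda>(y, x, t). (t, x, y)"])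
    fix u assume u: "u \<in> XF"
    obtain y x t where u_eq: "u = (y, x, t)"
      by (cases u)
    have t: "(y, x, t) \<in> faces T"
      using u by (simp add: u_eq faces_in_def)
    have "sw T (t, x, y) = sw T (y, x, t)"
      using sw_cycle[OF face_perm(1)[OF t]] sw_cycle[OF face_perm(4)[OF t]] sw_swap[OF t] sw_swap[OF face_perm(2)[OF t]]
        sw_cycle[OF t] by simp
    then show "h1 (case u of (y, x, t) \<Rightarrow> (t, x, y)) = h2 u"
      by (simp add: u_eq h1_def h2_def)
    show "(case u of (y, x, t) \<Rightarrow> (t, x, y)) \<in> XF"
      using faces_in_perm(5)[of y x t X] u by (simp add: u_eq)
    show "(case u of (y, x, t) \<Rightarrow> (t, x, y)) \<in> XF"
      using faces_in_perm(5)[of y x t X] u by (simp add: u_eq)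
  qed auto
  then have h2: "(\<Sum>t\<in>XF. h2 t) \<le> C * ?Z"
    using h1 by simp
  \<comment> \<open>Here (4 + 1024) / 2056 = 1/2; this is the origin of the threshold between rigid
    and flexible edges.\<close>
  have "1/?A * (4 * (\<Sum>t\<in>XF. h1 t) + 1024 * (\<Sum>t\<in>XF. h2 t)) \<le> 1/?A * (4 * (C * ?Z) + 1024 * (C * ?Z))"
    using h1 h2 C_pos by (intro mult_left_mono add_mono) auto
  also have "\<dots> = 1/2 * ?Z"
    using C_pos by simp
  finally have half: "1/?A * (4 * (\<Sum>t\<in>XF. h1 t) + 1024 * (\<Sum>t\<in>XF. h2 t)) \<le> 1/2 * ?Z" .
  have "(\<Sum>e\<in>XE. rw T e * (diff e)\<^sup>2 * (a (fst e) * F (fst e))\<^sup>2) =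
      (\<Sum>e\<in>XE. rw T e * (diff e)\<^sup>2 * (a (snd e) * F (snd e))\<^sup>2)"
  proof -
    have "rw T (snd e, fst e) * (diff (snd e, fst e))\<^sup>2 = rw T e * (diff e)\<^sup>2" if "e \<in> XE" for e
      using that rw_sym[of "fst e" "snd e"] by (auto simp: edges_in_def diff_def power2_commute)
    then show ?thesis
      using sum_edges_in_swap[of "\<lambda>e. rw T e * (diff e)\<^sup>2 * (a (fst e) * F (fst e))\<^sup>2" X] by simp
  qed
  also have "\<dots> \<le> C * ?V"
    by (rule sum_diff_le) simp
  finally have V: "(\<Sum>e\<in>XE. rw T e * (diff e)\<^sup>2 * (a (fst e) * F (fst e))\<^sup>2) \<le> C * ?V" .
  have "0 \<le> C * ?V" "0 \<le> C * ?W"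
    using C_pos X_subset V.w_nonneg sw_nonneg by (auto intro!: mult_nonneg_nonneg sum_nonneg)
  \<comment> \<open>Doubling after the absorption gives 54 times 2056 on faces; multiplied by 6
    because of the weight 1/6 this is 666144, below 700000.\<close>
  then have "6 * (C * ?V) + 54 * ?A * ?W \<le> 700000 * C * (?V + 1/6 * ?W)"
    by (simp add: algebra_simps)
  then show ?thesis
    using Z half V by linarith
qed

section \<open>Cut-off energy inequalities\<close>

lemma mean_nonzero: "(x, y) \<in> edges T \<Longrightarrow> mean (x, y) \<noteq> 0 \<Longrightarrow> a x \<noteq> 0 \<or> a y \<noteq> 0"
  by (auto simp: mean_def)

text \<open>The odd part. Testing with the cut-off edge component produces sums U with the cutoff on
  \<phi>; placing the cutoff on T u instead produces sums V equal to its energy J. The difference is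
  the commutator, and J is absorbed entirely, leaving only norms of \<phi>.\<close>

lemma edge_energy_bound:
  fixes u :: "'v cochain" and \<mu> :: real
  defines "\<phi> \<equiv> fst (snd u)"
  assumes u: "u \<in> C_triang T" and \<mu>: "2800000 * C \<le> \<mu>"
    and weak: "weak_eigen \<mu> u"
    and eqn: "\<And>e. e \<in> edges T \<Longrightarrow>
      d0_mag T (delta0_mag T \<phi>) e + delta1_mag T (d1_mag T \<phi>) e = - complex_of_real \<mu> * \<phi> e"
  shows "\<mu> * (1/2 * (\<Sum>e\<in>XE. rw T e * (mean e)\<^sup>2 * (cmod (\<phi> e))\<^sup>2))
    \<le> 2 * C * (\<Sum>e\<in>XE. rw T e * (cmod (\<phi> e))\<^sup>2)
      + 7 * \<mu> * (\<Sum>e\<in>XE. rw T e * (of_bool (diff e \<noteq> 0) * (cmod (\<phi> e))\<^sup>2))"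
proof -
  obtain f0 \<psi>0 where u_eq: "u = (f0, \<phi>, \<psi>0)"
    by (cases u) (simp add: \<phi>_def)
  have \<phi>: "\<phi> \<in> C_edges T"
    using u by (simp add: C_triang_def u_eq)
  have \<mu>_pos: "\<mu> > 0"
    using \<mu> C_pos by linarith
  define f where "f = delta0_mag T \<phi>"
  define \<psi> where "\<psi> = d1_mag T \<phi>"
  have \<psi>: "\<psi> \<in> C_faces T"
    unfolding \<psi>_def by (rule d1_mag_C[OF \<phi>])
  let ?r = "\<lambda>e. complex_of_real (rw T e)" and ?s = "\<lambda>t. complex_of_real (sw T t)"
  define \<theta> where "\<theta> e = complex_of_real ((mean e)\<^sup>2)" for e
  define \<phi>' where "\<phi>' e = \<theta> e * \<phi> e" for e
  have \<phi>': "\<phi>' \<in> C_edges T"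
    unfolding \<phi>'_def by (rule C_edges_mult[OF \<phi>]) (simp add: \<theta>_def mean_def add.commute)
  have \<phi>'_supp: "(x, y) \<in> edges T \<and> x \<in> S \<and> y \<in> S \<and> x \<in> X \<and> y \<in> X" if "\<phi>' (x, y) \<noteq> 0" for x y
  proof -
    have e: "(x, y) \<in> edges T"
      using that C_off(2)[OF \<phi>', of "(x, y)"] by blast
    moreover have "a x \<noteq> 0 \<or> a y \<noteq> 0"
      using that by (intro mean_nonzero[OF e]) (simp add: \<phi>'_def \<theta>_def)
    ultimately show ?thesis
      using near_support[OF e] by blast
  qed
  define w where "w = (0 :: 'v \<Rightarrow> complex, \<phi>', 0 :: 'v \<times> 'v \<times> 'v \<Rightarrow> complex)"
  have wC: "w \<in> C_triang T"
    using \<phi>' zero_in_C by (simp add: w_def C_triang_def)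
  have wS: "supported_in S w"
    using \<phi>'_supp by (simp add: supported_in_def w_def)
  have wX: "supported_in X w"
    using \<phi>'_supp by (simp add: supported_in_def w_def)
  have TwX: "supported_in X (gauss_bonnet T w)"
    unfolding X_def by (rule supported_in_gauss_bonnet[OF wC wS])
  have "w \<in> Cc_triang T"
    using wC wS finite_S unfolding Cc_triang_iff by blast
  note weak_w = weak[unfolded weak_eigen_def, rule_format, OF this]
  \<comment> \<open>The test cochain lives on edges, so its image lives on vertices and faces;
    \<open>f0\<close> and \<open>\<psi>0\<close> of u drop out of both sides of the weak
    equation.\<close>
  define U1 where "U1 = (\<Sum>e\<in>XE. ?r e * edge_phase T e * \<phi>' e * cnj (f (snd e)))"
  define U2 where "U2 = (\<Sum>(x, y, t)\<in>XF.
    ?s (x, y, t) * cnj (face_phase T x y t) * \<phi>' (x, y) * cnj (\<psi> (x, y, t)))"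
  define \<psi>' where "\<psi>' t = complex_of_real ((avg t)\<^sup>2) * \<psi> t" for t
  define V1 where "V1 = (\<Sum>e\<in>XE. ?r e * edge_phase T e * \<phi> e * (complex_of_real ((a (snd e))\<^sup>2) * cnj (f (snd e))))"
  define V2 where "V2 = (\<Sum>(x, y, t)\<in>XF.
    ?s (x, y, t) * cnj (face_phase T x y t) * \<phi> (x, y) * cnj (\<psi>' (x, y, t)))"
  define J where "J = (\<Sum>x\<in>X. cw T x * (a x * cmod (f x))\<^sup>2) + 1/6 * (\<Sum>t\<in>XF. sw T t * (avg t * cmod (\<psi> t))\<^sup>2)"
  define M where "M = (\<Sum>e\<in>XE. rw T e * (mean e)\<^sup>2 * (cmod (\<phi> e))\<^sup>2)"
  have \<psi>': "\<psi>' \<in> C_faces T"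
    unfolding \<psi>'_def by (rule C_faces_mult[OF \<psi>]) (simp add: avg_def algebra_simps)
  have "(\<Sum>x\<in>X. complex_of_real (cw T x) * delta0_mag T \<phi>' x * cnj (f x)) = U1"
    unfolding U1_def using \<phi>'_supp by (intro sum_delta0_mag X_subset) auto
  moreover have "(\<Sum>t\<in>XF. ?s t * d1_mag T \<phi>' t * cnj (\<psi> t)) = 3 * U2"
    unfolding U2_def by (rule sum_d1_mag[OF \<psi>])
  ultimately have "ip_triang T (gauss_bonnet T w) (gauss_bonnet T u) = U1 + 1/2 * U2"
    using ip_triang_supported[OF gauss_bonnet_C[OF wC] TwX finite_X X_subset, of "gauss_bonnet T u"]
    by (simp add: w_def u_eq f_def \<psi>_def)
  moreover have "ip_triang T w u = complex_of_real (1/2 * M)"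
  proof -
    have "ip_triang T w u = 1/2 * (\<Sum>e\<in>XE. ?r e * \<phi>' e * cnj (\<phi> e))"
      using ip_triang_supported[OF wC wX finite_X X_subset, of u] by (simp add: w_def u_eq)
    also have "(\<Sum>e\<in>XE. ?r e * \<phi>' e * cnj (\<phi> e)) = complex_of_real M"
      unfolding M_def of_real_sum by (intro sum.cong refl) (simp add: \<phi>'_def \<theta>_def of_real_cmod_square mult_ac)
    finally show ?thesis
      by simp
  qed
  ultimately have U: "U1 + 1/2 * U2 = - complex_of_real (\<mu> * (1/2 * M))"
    using weak_w by simp
  have "V1 = (\<Sum>x\<in>X. complex_of_real (cw T x) * delta0_mag T \<phi> x * (complex_of_real ((a x)\<^sup>2) * cnj (f x)))"
    unfolding V1_def
  proof (rule sum_delta0_mag[symmetric, OF finite_X X_subset])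
    show "\<phi> (x, y) * (complex_of_real ((a y)\<^sup>2) * cnj (f y)) = 0" if "(x, y) \<in> edges T" "x \<notin> X" for x y
      using near_support(3)[OF that(1)] that(2) by auto
  qed
  also have "\<dots> = complex_of_real (\<Sum>x\<in>X. cw T x * (a x * cmod (f x))\<^sup>2)"
    unfolding of_real_sum
    by (intro sum.cong refl) (simp add: f_def[symmetric] power_mult_distrib of_real_cmod_square mult_ac)
  finally have V1: "V1 = complex_of_real (\<Sum>x\<in>X. cw T x * (a x * cmod (f x))\<^sup>2)" .
  have "3 * V2 = (\<Sum>t\<in>XF. ?s t * d1_mag T \<phi> t * cnj (\<psi>' t))"
    unfolding V2_def by (rule sum_d1_mag[OF \<psi>', symmetric])
  also have "\<dots> = complex_of_real (\<Sum>t\<in>XF. sw T t * (avg t * cmod (\<psi> t))\<^sup>2)"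
    unfolding of_real_sum
    by (intro sum.cong refl) (simp add: \<psi>_def[symmetric] \<psi>'_def power_mult_distrib of_real_cmod_square mult_ac)
  finally have V2: "3 * V2 = complex_of_real (\<Sum>t\<in>XF. sw T t * (avg t * cmod (\<psi> t))\<^sup>2)" .
  have "complex_of_real J = V1 + 1/6 * (3 * V2)"
    unfolding V1 V2 J_def by simp
  then have "complex_of_real (J + \<mu> * (1/2 * M)) = (V1 - U1) + 1/2 * (V2 - U2)"
    using U by (simp add: algebra_simps add_divide_distrib diff_divide_distrib eq_neg_iff_add_eq_0)
  from le_cmod_complex_of_real[OF this]
  have "J + \<mu> * (1/2 * M) \<le> cmod (V1 - U1) + 1/2 * cmod (V2 - U2)"
    using norm_triangle_ineq[of "V1 - U1" "1/2 * (V2 - U2)"] by (simp add: norm_mult norm_divide)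
  also have "cmod (V1 - U1) \<le> (\<Sum>e\<in>XE. rw T e * \<bar>(a (snd e))\<^sup>2 - (mean e)\<^sup>2\<bar> * cmod (\<phi> e) * cmod (f (snd e)))"
    unfolding V1_def U1_def
  proof (rule norm_diff_sums, goal_cases)
    case (1 e)
    have eq: "?r e * edge_phase T e * \<phi> e * (complex_of_real ((a (snd e))\<^sup>2) * cnj (f (snd e)))
        - ?r e * edge_phase T e * \<phi>' e * cnj (f (snd e))
      = ?r e * edge_phase T e * complex_of_real ((a (snd e))\<^sup>2 - (mean e)\<^sup>2) * \<phi> e * cnj (f (snd e))"
      by (simp add: \<phi>'_def \<theta>_def algebra_simps)
    show ?case
      unfolding eq using rw_nonneg[OF 1] by (simp only: norm_mult norm_of_real norm_edge_phase complex_mod_cnj)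
  qed
  also have "cmod (V2 - U2) \<le> (\<Sum>(x, y, t)\<in>XF.
      sw T (x, y, t) * \<bar>(avg (x, y, t))\<^sup>2 - (mean (x, y))\<^sup>2\<bar> * cmod (\<phi> (x, y)) * cmod (\<psi> (x, y, t)))"
    unfolding V2_def U2_def
  proof (rule norm_diff_sums, clarify, goal_cases)
    case (1 x y t)
    have eq: "?s (x, y, t) * cnj (face_phase T x y t) * \<phi> (x, y) * cnj (\<psi>' (x, y, t))
        - ?s (x, y, t) * cnj (face_phase T x y t) * \<phi>' (x, y) * cnj (\<psi> (x, y, t))
      = ?s (x, y, t) * cnj (face_phase T x y t) * complex_of_real ((avg (x, y, t))\<^sup>2 - (mean (x, y))\<^sup>2)
          * \<phi> (x, y) * cnj (\<psi> (x, y, t))"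
      by (simp add: \<phi>'_def \<psi>'_def \<theta>_def algebra_simps)
    show ?case
      unfolding eq using sw_nonneg[OF 1] by (simp only: norm_mult norm_of_real norm_face_phase complex_mod_cnj)
  qed
  finally have main: "J + \<mu> * (1/2 * M) \<le>
      (\<Sum>e\<in>XE. rw T e * \<bar>(a (snd e))\<^sup>2 - (mean e)\<^sup>2\<bar> * cmod (\<phi> e) * cmod (f (snd e)))
      + 1/2 * (\<Sum>(x, y, t)\<in>XF.
      sw T (x, y, t) * \<bar>(avg (x, y, t))\<^sup>2 - (mean (x, y))\<^sup>2\<bar> * cmod (\<phi> (x, y)) * cmod (\<psi> (x, y, t)))"
    by simp
  let ?Z = "\<Sum>e\<in>XE. rw T e * (max 0 (diff e)) ^ 4 * (cmod (f (snd e)))\<^sup>2"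
  let ?P = "\<Sum>e\<in>XE. rw T e * (cmod (\<phi> e))\<^sup>2"
  let ?Pd = "\<Sum>e\<in>XE. rw T e * (of_bool (diff e \<noteq> 0) * (cmod (\<phi> e))\<^sup>2)"
  \<comment> \<open>The choice \<eta> = 1/\<mu> balances the increment term: the equation brings in
    \<mu> \<phi>, whose square divided by \<mu> is of the same order as the other remainder.\<close>
  have "J + \<mu> * (1/2 * M) \<le> 1/4 * J + 2 * C * ?P + 1/\<mu> * ?Z + 1/(64 * (1/\<mu>)) * ?Pd"
    using main odd_commutator_bound[of "\<lambda>x. cmod (f x)" "\<lambda>e. cmod (\<phi> e)" "\<lambda>t. cmod (\<psi> t)" "1/\<mu>"] \<mu>_pos
    unfolding J_def by simp
  moreover have "?Z \<le> 6 * (\<mu>\<^sup>2 * ?Pd) + 700000 * C * J"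
  proof -
    have "cmod (f x) \<le> \<mu> * cmod (\<phi> (y, x)) + cmod (f y)
        + (\<Sum>t\<in>face_verts T y x. sw T (y, x, t) * cmod (\<psi> (y, x, t))) / rw T (y, x)"
      if e: "(y, x) \<in> edges T" for x y
    proof -
      have r: "rw T (y, x) > 0"
        by (rule rw_pos[OF e])
      let ?p = "edge_phase T (y, x)"
      \<comment> \<open>The eigenvalue equation on the edge, solved for the value at the lower
        vertex; phases have modulus one and disappear in the norm.\<close>
      have "cnj ?p * f x = - complex_of_real \<mu> * \<phi> (y, x) + ?p * f y - delta1_mag T \<psi> (y, x)"
        using eqn[OF e] by (simp add: f_def[symmetric] \<psi>_def[symmetric] d0_mag_eq[OF e] algebra_simps)
      then have "cmod (cnj ?p * f x) \<le> cmod (- complex_of_real \<mu> * \<phi> (y, x)) + cmod (?p * f y) + cmod (delta1_mag T \<psi> (y, x))"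
        by (metis (no_types, opaque_lifting) add_right_mono norm_triangle_ineq norm_triangle_ineq4 order_trans)
      then have "cmod (f x) \<le> \<mu> * cmod (\<phi> (y, x)) + cmod (f y) + cmod (delta1_mag T \<psi> (y, x))"
        using \<mu>_pos by (simp add: norm_mult)
      moreover have "cmod (delta1_mag T \<psi> (y, x)) \<le>
          (\<Sum>t\<in>face_verts T y x. sw T (y, x, t) * cmod (\<psi> (y, x, t))) / rw T (y, x)"
      proof -
        have "rw T (y, x) * cmod (delta1_mag T \<psi> (y, x)) = cmod (?r (y, x) * delta1_mag T \<psi> (y, x))"
          using r by (simp add: norm_mult)
        also have "\<dots> \<le> (\<Sum>t\<in>face_verts T y x. sw T (y, x, t) * cmod (\<psi> (y, x, t)))"
          unfolding delta1_mag_eq[OF e]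
        proof (rule sum_norm_le)
          fix t assume "t \<in> face_verts T y x"
          then have "0 < sw T (y, x, t)"
            by (intro sw_pos) (simp add: face_verts_iff)
          then show "cmod (?s (y, x, t) * face_phase T y x t * \<psi> (y, x, t)) \<le> sw T (y, x, t) * cmod (\<psi> (y, x, t))"
            by (simp add: norm_mult)
        qed
        finally show ?thesis
          using r by (simp add: pos_le_divide_eq mult.commute)
      qed
      ultimately show ?thesis
        by linarith
    qed
    then have "?Z \<le> 6 * (\<Sum>e\<in>XE. rw T e * (of_bool (diff e \<noteq> 0) * (\<mu> * cmod (\<phi> e))\<^sup>2)) + 700000 * C * J"
      using \<mu>_pos unfolding J_def
      by (intro increment_bound[where P = "\<lambda>e. \<mu> * cmod (\<phi> e)" and G = "\<lambda>t. cmod (\<psi> t)"]) auto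
    also have "(\<Sum>e\<in>XE. rw T e * (of_bool (diff e \<noteq> 0) * (\<mu> * cmod (\<phi> e))\<^sup>2)) = \<mu>\<^sup>2 * ?Pd"
      by (simp add: sum_distrib_left power_mult_distrib mult_ac)
    finally show ?thesis .
  qed
  then have "1/\<mu> * ?Z \<le> 1/\<mu> * (6 * (\<mu>\<^sup>2 * ?Pd) + 700000 * C * J)"
    using \<mu>_pos by (intro mult_left_mono) auto
  moreover have "1/\<mu> * (6 * (\<mu>\<^sup>2 * ?Pd) + 700000 * C * J) = 6 * \<mu> * ?Pd + 700000 * C / \<mu> * J"
    using \<mu>_pos by (simp add: field_simps power2_eq_square)
  moreover have J: "0 \<le> J"
    unfolding J_def using X_subset V.w_nonneg sw_nonneg by (auto intro!: add_nonneg_nonneg sum_nonneg)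
  \<comment> \<open>This is where \<mu> has to be at least 4 times 700000 C.\<close>
  moreover have "700000 * C / \<mu> * J \<le> 1/4 * J"
    using J \<mu> \<mu>_pos by (intro mult_right_mono) (simp_all add: divide_le_eq)
  moreover have "1/(64 * (1/\<mu>)) * ?Pd = \<mu> * ?Pd / 64"
    by simp
  moreover have "0 \<le> \<mu> * ?Pd"
    using \<mu>_pos rw_nonneg by (auto intro!: mult_nonneg_nonneg sum_nonneg)
  \<comment> \<open>J is bounded by half of itself and is discarded; 7 covers 6 + 1/64.\<close>
  ultimately have "\<mu> * (1/2 * M) \<le> 2 * C * ?P + 7 * (\<mu> * ?Pd)"
    by linarith
  then show ?thesis
    by (simp add: M_def mult.assoc)
qed

text \<open>The even part. The energy M now sits on edges and the cutoff of u on vertices and faces.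
  Half of M stands on the left and a quarter on the right, so M disappears without any use of the
  pointwise equation.\<close>

lemma vertex_face_energy_bound:
  fixes u :: "'v cochain" and \<mu> :: real
  defines "f \<equiv> fst u" and "\<psi> \<equiv> snd (snd u)"
  assumes u: "u \<in> C_triang T"
    and weak: "weak_eigen \<mu> u"
  shows "\<mu> * ((\<Sum>x\<in>X. cw T x * (a x * cmod (f x))\<^sup>2) + 1/6 * (\<Sum>t\<in>XF. sw T t * (med t * cmod (\<psi> t))\<^sup>2))
    \<le> 7 * C * ((\<Sum>x\<in>X. cw T x * (cmod (f x))\<^sup>2) + 1/6 * (\<Sum>t\<in>XF. sw T t * (cmod (\<psi> t))\<^sup>2))"
proof -
  obtain \<phi>0 where u_eq: "u = (f, \<phi>0, \<psi>)"
    by (cases u) (simp add: f_def \<psi>_def)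
  have f: "f \<in> C_verts T" and \<psi>: "\<psi> \<in> C_faces T"
    using u by (simp_all add: C_triang_def u_eq)
  \<comment> \<open>The edge component of T u. The edge component of u itself,
    \<open>\<phi>0\<close>, does not interact with a test cochain supported on vertices and
    faces.\<close>
  define \<phi> where "\<phi> e = d0_mag T f e + delta1_mag T \<psi> e" for e
  have \<phi>: "\<phi> \<in> C_edges T"
    using C_edges_add[OF d0_mag_C delta1_mag_C[OF \<psi>], of f] by (simp add: \<phi>_def[abs_def] plus_fun_def)
  let ?r = "\<lambda>e. complex_of_real (rw T e)" and ?s = "\<lambda>t. complex_of_real (sw T t)"
  define f' where "f' x = complex_of_real ((a x)\<^sup>2) * f x" for x
  define \<psi>' where "\<psi>' t = complex_of_real ((med t)\<^sup>2) * \<psi> t" for t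
  define \<phi>' where "\<phi>' e = complex_of_real ((mean e)\<^sup>2) * \<phi> e" for e
  have f': "f' \<in> C_verts T"
    using f by (simp add: C_verts_def f'_def)
  have \<psi>': "\<psi>' \<in> C_faces T"
    unfolding \<psi>'_def by (rule C_faces_mult[OF \<psi>]) (simp add: med_def median_perm)
  have \<phi>': "\<phi>' \<in> C_edges T"
    unfolding \<phi>'_def by (rule C_edges_mult[OF \<phi>]) (simp add: mean_def add.commute)
  have f'_supp: "x \<in> S \<and> x \<in> X" if "f' x \<noteq> 0" for x
  proof -
    have "a x \<noteq> 0" "x \<in> verts T"
      using that C_off(1)[OF f', of x] by (auto simp: f'_def)
    then show ?thesis
      by (auto simp: S_def X_def neighbourhood_def)
  qed
  have \<psi>'_supp: "(x \<in> S \<and> y \<in> S \<and> t \<in> S) \<and> x \<in> X \<and> y \<in> X \<and> t \<in> X" if "\<psi>' (x, y, t) \<noteq> 0" for x y t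
  proof -
    have t: "(x, y, t) \<in> faces T"
      using that C_off(3)[OF \<psi>', of "(x, y, t)"] by blast
    have "med (x, y, t) \<noteq> 0"
      using that by (auto simp: \<psi>'_def)
    then have "a x \<noteq> 0 \<or> a y \<noteq> 0 \<or> a t \<noteq> 0"
      by (auto simp: med_def median_def)
    then show ?thesis
      using face_near_support[OF t] by blast
  qed
  define w where "w = (f', 0 :: 'v \<times> 'v \<Rightarrow> complex, \<psi>')"
  have wC: "w \<in> C_triang T"
    using f' \<psi>' zero_in_C by (simp add: w_def C_triang_def)
  have wS: "supported_in S w"
    using f'_supp \<psi>'_supp by (simp add: supported_in_def w_def)
  have wX: "supported_in X w"
    using f'_supp \<psi>'_supp by (simp add: supported_in_def w_def)
  have TwX: "supported_in X (gauss_bonnet T w)"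
    unfolding X_def by (rule supported_in_gauss_bonnet[OF wC wS])
  have "w \<in> Cc_triang T"
    using wC wS finite_S unfolding Cc_triang_iff by blast
  note weak_w = weak[unfolded weak_eigen_def, rule_format, OF this]
  define U1 where "U1 = (\<Sum>e\<in>XE. ?r e * edge_phase T e * \<phi> e * cnj (f' (snd e)))"
  define U2 where "U2 = (\<Sum>(x, y, t)\<in>XF.
    ?s (x, y, t) * face_phase T x y t * \<psi>' (x, y, t) * cnj (\<phi> (x, y)))"
  define V1 where "V1 = (\<Sum>e\<in>XE. ?r e * edge_phase T e * \<phi>' e * cnj (f (snd e)))"
  define V2 where "V2 = (\<Sum>(x, y, t)\<in>XF.
    ?s (x, y, t) * face_phase T x y t * \<psi> (x, y, t) * cnj (\<phi>' (x, y)))"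
  define N where "N = (\<Sum>x\<in>X. cw T x * (a x * cmod (f x))\<^sup>2) + 1/6 * (\<Sum>t\<in>XF. sw T t * (med t * cmod (\<psi> t))\<^sup>2)"
  define M where "M = (\<Sum>e\<in>XE. rw T e * (mean e)\<^sup>2 * (cmod (\<phi> e))\<^sup>2)"
  have d0_f': "(\<Sum>e\<in>XE. ?r e * \<phi> e * cnj (d0_mag T f' e)) = 2 * U1"
    unfolding U1_def by (rule sum_d0_mag[OF \<phi>])
  have delta1_\<psi>': "(\<Sum>e\<in>XE. ?r e * delta1_mag T \<psi>' e * cnj (\<phi> e)) = U2"
    unfolding U2_def using \<psi>'_supp by (intro sum_delta1_mag finite_X) auto
  have "ip_triang T (gauss_bonnet T w) (gauss_bonnet T u) =
      1/2 * (\<Sum>e\<in>XE. ?r e * (d0_mag T f' e + delta1_mag T \<psi>' e) * cnj (\<phi> e))"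
    using ip_triang_supported[OF gauss_bonnet_C[OF wC] TwX finite_X X_subset, of "gauss_bonnet T u"]
    by (simp add: w_def u_eq \<phi>_def)
  also have "(\<Sum>e\<in>XE. ?r e * (d0_mag T f' e + delta1_mag T \<psi>' e) * cnj (\<phi> e)) = cnj (2 * U1) + U2"
    unfolding d0_f'[symmetric] delta1_\<psi>'[symmetric] by (simp add: sum.distrib[symmetric] algebra_simps)
  finally have lhs: "ip_triang T (gauss_bonnet T w) (gauss_bonnet T u) = cnj U1 + 1/2 * U2"
    by (simp add: add_divide_distrib)
  have "ip_triang T w u = complex_of_real N"
  proof -
    have "ip_triang T w u = (\<Sum>x\<in>X. complex_of_real (cw T x) * f' x * cnj (f x))
        + 1/6 * (\<Sum>t\<in>XF. ?s t * \<psi>' t * cnj (\<psi> t))"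
      using ip_triang_supported[OF wC wX finite_X X_subset, of u] by (simp add: w_def u_eq)
    also have "(\<Sum>x\<in>X. complex_of_real (cw T x) * f' x * cnj (f x)) = complex_of_real (\<Sum>x\<in>X. cw T x * (a x * cmod (f x))\<^sup>2)"
      unfolding of_real_sum
      by (intro sum.cong refl) (simp add: f'_def power_mult_distrib of_real_cmod_square mult_ac)
    also have "(\<Sum>t\<in>XF. ?s t * \<psi>' t * cnj (\<psi> t)) = complex_of_real (\<Sum>t\<in>XF. sw T t * (med t * cmod (\<psi> t))\<^sup>2)"
      unfolding of_real_sum
      by (intro sum.cong refl) (simp add: \<psi>'_def power_mult_distrib of_real_cmod_square mult_ac)
    finally show ?thesis
      by (simp add: N_def)
  qed
  then have U: "cnj U1 + 1/2 * U2 = - complex_of_real (\<mu> * N)"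
    using weak_w lhs by simp
  have d0_f: "(\<Sum>e\<in>XE. ?r e * \<phi>' e * cnj (d0_mag T f e)) = 2 * V1"
    unfolding V1_def by (rule sum_d0_mag[OF \<phi>'])
  have delta1_\<psi>: "(\<Sum>e\<in>XE. ?r e * delta1_mag T \<psi> e * cnj (\<phi>' e)) = V2"
    unfolding V2_def
  proof (rule sum_delta1_mag[OF finite_X])
    show "\<psi> (x, y, t) * cnj (\<phi>' (x, y)) = 0" if "(x, y, t) \<in> faces T" "t \<notin> X" for x y t
      using face_near_support(6)[OF that(1)] that(2)
      by (cases "a x = 0 \<and> a y = 0") (auto simp: \<phi>'_def mean_def)
  qed
  have "complex_of_real M = (\<Sum>e\<in>XE. ?r e * (d0_mag T f e + delta1_mag T \<psi> e) * cnj (\<phi>' e))"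
    unfolding M_def of_real_sum \<phi>_def[symmetric]
    by (intro sum.cong refl) (simp add: \<phi>'_def of_real_cmod_square mult_ac)
  also have "\<dots> = cnj (2 * V1) + V2"
    unfolding d0_f[symmetric] delta1_\<psi>[symmetric] by (simp add: sum.distrib[symmetric] algebra_simps)
  finally have M: "complex_of_real (1/2 * M) = cnj V1 + 1/2 * V2"
    by (simp add: add_divide_distrib)
  have N: "complex_of_real (\<mu> * N) = - (cnj U1 + 1/2 * U2)"
    unfolding U by simp
  have "complex_of_real (1/2 * M + \<mu> * N) = cnj (V1 - U1) + 1/2 * (V2 - U2)"
    unfolding of_real_add M N by (simp add: algebra_simps diff_divide_distrib)
  from le_cmod_complex_of_real[OF this]
  have "1/2 * M + \<mu> * N \<le> cmod (V1 - U1) + 1/2 * cmod (V2 - U2)"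
    using norm_triangle_ineq[of "cnj (V1 - U1)" "1/2 * (V2 - U2)"]
    by (simp add: norm_mult norm_divide del: complex_cnj_diff)
  also have "cmod (V1 - U1) \<le> (\<Sum>e\<in>XE. rw T e * \<bar>(a (snd e))\<^sup>2 - (mean e)\<^sup>2\<bar> * cmod (\<phi> e) * cmod (f (snd e)))"
    unfolding V1_def U1_def
  proof (rule norm_diff_sums, goal_cases)
    case (1 e)
    have eq: "?r e * edge_phase T e * \<phi>' e * cnj (f (snd e)) - ?r e * edge_phase T e * \<phi> e * cnj (f' (snd e))
      = ?r e * edge_phase T e * complex_of_real ((mean e)\<^sup>2 - (a (snd e))\<^sup>2) * \<phi> e * cnj (f (snd e))"
      by (simp add: \<phi>'_def f'_def algebra_simps)
    show ?case
      unfolding eq using rw_nonneg[OF 1]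
      by (simp only: norm_mult norm_of_real norm_edge_phase complex_mod_cnj) (simp add: abs_minus_commute)
  qed
  also have "cmod (V2 - U2) \<le> (\<Sum>(x, y, t)\<in>XF.
      sw T (x, y, t) * \<bar>(med (x, y, t))\<^sup>2 - (mean (x, y))\<^sup>2\<bar> * cmod (\<phi> (x, y)) * cmod (\<psi> (x, y, t)))"
    unfolding V2_def U2_def
  proof (rule norm_diff_sums, clarify, goal_cases)
    case (1 x y t)
    have eq: "?s (x, y, t) * face_phase T x y t * \<psi> (x, y, t) * cnj (\<phi>' (x, y))
        - ?s (x, y, t) * face_phase T x y t * \<psi>' (x, y, t) * cnj (\<phi> (x, y))
      = ?s (x, y, t) * face_phase T x y t * complex_of_real ((mean (x, y))\<^sup>2 - (med (x, y, t))\<^sup>2)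
          * cnj (\<phi> (x, y)) * \<psi> (x, y, t)"
      by (simp add: \<phi>'_def \<psi>'_def algebra_simps)
    show ?case
      unfolding eq using sw_nonneg[OF 1]
      by (simp only: norm_mult norm_of_real norm_face_phase complex_mod_cnj) (simp add: abs_minus_commute)
  qed
  finally have "1/2 * M + \<mu> * N \<le> 1/4 * M
      + 7 * C * ((\<Sum>x\<in>X. cw T x * (cmod (f x))\<^sup>2) + 1/6 * (\<Sum>t\<in>XF. sw T t * (cmod (\<psi> t))\<^sup>2))"
    using even_commutator_bound[of "\<lambda>x. cmod (f x)" "\<lambda>e. cmod (\<phi> e)" "\<lambda>t. cmod (\<psi> t)"]
    unfolding M_def by simp
  moreover have "0 \<le> M"
    unfolding M_def using rw_nonneg by (intro sum_nonneg) simp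
  ultimately show ?thesis
    unfolding N_def by linarith
qed

end

section \<open>Triviality of the deficiency space\<close>

lemma finite_subset_incseq:
  assumes "incseq B" "finite Y" "Y \<subseteq> (\<Union>n::nat. B n)"
  shows "\<exists>n. Y \<subseteq> B n"
  using assms(2,3)
proof (induction Y)
  case (insert y Y)
  then obtain m n where "Y \<subseteq> B m" "y \<in> B n"
    by auto
  then have "insert y Y \<subseteq> B (max m n)"
    using monoD[OF assms(1), of m "max m n"] monoD[OF assms(1), of n "max m n"] by auto
  then show ?case by blast
qed simp

lemma nonpos_of_mult_le:
  assumes "\<mu> * K \<le> b * K" "b < \<mu>"
  shows "K \<le> (0::real)"
proof (rule ccontr)
  assume "\<not> K \<le> 0"
  then have "b * K < \<mu> * K"
    using assms(2) by (intro mult_strict_right_mono) auto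
  then show False
    using assms(1) by linarith
qed

lemma le_of_epsilon_bound:
  assumes "\<And>\<epsilon>. \<epsilon> > 0 \<Longrightarrow> \<mu> * (K - m * \<epsilon>) \<le> b" and "\<mu> > 0" "m > (0::real)"
  shows "\<mu> * K \<le> (b::real)"
proof (rule field_le_epsilon)
  fix d :: real assume "d > 0"
  then show "\<mu> * K \<le> b + d"
    using assms(1)[of "d / (\<mu> * m)"] assms(2,3) by (simp add: right_diff_distrib)
qed

context weighted_magnetic_triangulation
begin

section \<open>The pointwise equation on edges\<close>

text \<open>The skew unit mass at an edge: its two orientations contribute equally and cancel the
  1/2 of the inner product.\<close>

lemma ip_edge_delta:
  assumes e: "(x, y) \<in> edges T" and v: "v \<in> C_triang T"
  defines "w \<equiv> (0, \<lambda>e. of_bool (e = (x, y)) - of_bool (e = (y, x)), 0)"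
  shows "w \<in> Cc_triang T"
    and "ip_triang T w v = complex_of_real (rw T (x, y)) * cnj (fst (snd v) (x, y))"
proof -
  have xy: "x \<noteq> y" "(y, x) \<in> edges T" "x \<in> verts T" "y \<in> verts T"
    using e no_loops edge_swap edge_verts by (auto simp: irrefl_def)
  let ?\<chi> = "\<lambda>e. of_bool (e = (x, y)) - of_bool (e = (y, x)) :: complex"
  have "?\<chi> \<in> C_edges T"
    using e xy by (auto simp: C_edges_def)
  then have wC: "w \<in> C_triang T"
    using zero_in_C by (simp add: w_def C_triang_def)
  have supp: "supported_in {x, y} w"
    using xy by (auto simp: supported_in_def w_def of_bool_def split: if_splits)
  show "w \<in> Cc_triang T"
    unfolding Cc_triang_iff using wC supp by (intro conjI exI[of _ "{x, y}"]) auto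
  have edges: "edges_in T {x, y} = {(x, y), (y, x)}"
    using e xy no_loops by (auto simp: edges_in_def irrefl_def)
  have "fst (snd v) (y, x) = - fst (snd v) (x, y)"
    using v by (intro C_edges_skew) (auto simp: C_triang_def)
  then show "ip_triang T w v = complex_of_real (rw T (x, y)) * cnj (fst (snd v) (x, y))"
    using ip_triang_supported[OF wC supp, of v] xy rw_sym[OF e] by (simp add: edges w_def)
qed

text \<open>Formal symmetry holds against every cochain, so the second Gauss-Bonnet operator can be
  moved to u too, and a skew unit mass then reads off the value on the edge. This is the equation
  solved for the lower vertex in \<open>edge_energy_bound\<close>.\<close>

lemma laplacian_eigen_edges:
  assumes u: "u \<in> C_triang T" and e: "e \<in> edges T"
    and weak: "weak_eigen \<mu> u"
  shows "d0_mag T (delta0_mag T (fst (snd u))) e + delta1_mag T (d1_mag T (fst (snd u))) e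
    = - complex_of_real \<mu> * fst (snd u) e"
proof -
  obtain x y where xy: "e = (x, y)" "(x, y) \<in> edges T"
    using e by (cases e) auto
  define w where "w = (0 :: 'v \<Rightarrow> complex, \<lambda>e. of_bool (e = (x, y)) - of_bool (e = (y, x)) :: complex,
    0 :: 'v \<times> 'v \<times> 'v \<Rightarrow> complex)"
  define v where "v = gauss_bonnet T (gauss_bonnet T u)"
  have Tu: "gauss_bonnet T u \<in> C_triang T"
    by (rule gauss_bonnet_C[OF u])
  have v: "v \<in> C_triang T"
    unfolding v_def by (rule gauss_bonnet_C[OF Tu])
  have w: "w \<in> Cc_triang T"
    unfolding w_def by (rule ip_edge_delta(1)[OF xy(2) v])
  have "ip_triang T w v = - complex_of_real \<mu> * ip_triang T w u"
    using gauss_bonnet_formally_symmetric[OF w Tu] weak w by (simp add: v_def weak_eigen_def)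
  then have "complex_of_real (rw T (x, y)) * cnj (fst (snd v) (x, y)) =
      complex_of_real (rw T (x, y)) * cnj (- complex_of_real \<mu> * fst (snd u) (x, y))"
    unfolding w_def ip_edge_delta(2)[OF xy(2) v] ip_edge_delta(2)[OF xy(2) u] by simp
  then have "fst (snd v) (x, y) = - complex_of_real \<mu> * fst (snd u) (x, y)"
    using rw_pos[OF xy(2)] by (metis complex_cnj_cnj less_irrefl mult_cancel_left of_real_eq_0_iff)
  then show ?thesis
    by (cases u) (simp add: v_def xy(1))
qed

section \<open>Exhaustion and vanishing of the deficiency space\<close>

text \<open>The form in which \<chi>-completeness is used: one constant C for all finite sets, with
  the cutoff depending on the set.\<close>

definition exhausting_cutoffs :: "real \<Rightarrow> bool" where
  "exhausting_cutoffs C \<longleftrightarrow> C > 0 \<and> (\<forall>Y. finite Y \<longrightarrow> Y \<subseteq> verts T \<longrightarrow> (\<exists>a. cutoff T a C \<and> (\<forall>x\<in>Y. a x = 1)))"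

lemma chi_complete_cutoffs:
  assumes "chi_complete T"
  shows "\<exists>C. exhausting_cutoffs C"
proof -
  obtain C and B :: "nat \<Rightarrow> 'v set" and chi where C: "C > 0" and B: "incseq B" "verts T = (\<Union>n. B n)"
    and all: "\<forall>n. chi n \<in> Cc_verts T \<and> (\<forall>x\<in>verts T. chi n x \<in> complex_of_real ` {0..1}) \<and>
          (\<forall>x\<in>B n. chi n x = 1) \<and>
          (\<forall>x\<in>verts T. 1 / cw T x *
             (\<Sum>e\<in>{e \<in> edges T. snd e = x}. rw T e * (cmod (d0 (chi n) e))\<^sup>2) \<le> C) \<and>
          (\<forall>(x, y)\<in>edges T. 1 / rw T (x, y) *
             (\<Sum>t\<in>face_verts T x y.
                sw T (x, y, t) * (cmod (d0 (chi n) (t, x) + d0 (chi n) (t, y)))\<^sup>2) \<le> C)"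
    using assms unfolding chi_complete_def by (elim exE conjE) (rule that)
  have chi: "chi n \<in> Cc_verts T" "x \<in> verts T \<Longrightarrow> chi n x \<in> complex_of_real ` {0..1}"
      "x \<in> B n \<Longrightarrow> chi n x = 1"
      "x \<in> verts T \<Longrightarrow> 1 / cw T x *
             (\<Sum>e\<in>{e \<in> edges T. snd e = x}. rw T e * (cmod (d0 (chi n) e))\<^sup>2) \<le> C" for n x
    using all by blast+
  have chi_edges: "1 / rw T (x, y) * (\<Sum>t\<in>face_verts T x y.
      sw T (x, y, t) * (cmod (d0 (chi n) (t, x) + d0 (chi n) (t, y)))\<^sup>2) \<le> C"
    if e: "(x, y) \<in> edges T" for n x y
  proof -
    have "\<forall>(x, y)\<in>edges T. 1 / rw T (x, y) * (\<Sum>t\<in>face_verts T x y.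
        sw T (x, y, t) * (cmod (d0 (chi n) (t, x) + d0 (chi n) (t, y)))\<^sup>2) \<le> C"
      using all by blast
    from bspec[OF this e] show ?thesis
      by (simp only: case_prod_conv)
  qed
  define a where "a n x = Re (chi n x)" for n x
  have a: "chi n x = complex_of_real (a n x)" "0 \<le> a n x" "a n x \<le> 1" for n x
  proof -
    \<comment> \<open>The range condition is known only on vertices; elsewhere \<open>chi n\<close>
      vanishes, which is in the range as well.\<close>
    have "chi n x \<in> complex_of_real ` {0..1}"
    proof (cases "x \<in> verts T")
      case False
      then have "chi n x = 0"
        using chi(1)[of n] by (auto simp: Cc_verts_def C_verts_def)
      then show ?thesis
        by (auto intro!: image_eqI[of _ _ 0])
    qed (rule chi(2))
    then show "chi n x = complex_of_real (a n x)" "0 \<le> a n x" "a n x \<le> 1"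
      by (auto simp: a_def)
  qed
  have "cutoff T (a n) C" for n
  proof
    show "finite {x. a n x \<noteq> 0}"
      using chi(1)[of n] by (simp add: Cc_verts_def finitely_supported_def a(1))
    show "(\<Sum>e\<in>{e \<in> edges T. snd e = x}. rw T e * (a n (fst e) - a n (snd e))\<^sup>2) \<le> C * cw T x"
      if x: "x \<in> verts T" for x
    proof -
      have "(cmod (d0 (chi n) e))\<^sup>2 = (a n (fst e) - a n (snd e))\<^sup>2" for e
        by (cases e) (simp add: d0_def a(1) power2_commute flip: of_real_diff)
      then show ?thesis
        using chi(4)[OF x, of n] cw_pos[OF x] by (simp add: divide_le_eq)
    qed
    show "(\<Sum>t\<in>face_verts T x y. sw T (x, y, t) * (a n x + a n y - 2 * a n t)\<^sup>2) \<le> C * rw T (x, y)"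
      if e: "(x, y) \<in> edges T" for x y
    proof -
      have "d0 (chi n) (t, x) + d0 (chi n) (t, y) = complex_of_real (a n x + a n y - 2 * a n t)" for t
        by (simp add: d0_def a(1))
      then have "(cmod (d0 (chi n) (t, x) + d0 (chi n) (t, y)))\<^sup>2 = (a n x + a n y - 2 * a n t)\<^sup>2" for t
        by (simp only: norm_of_real power2_abs)
      then show ?thesis
        using chi_edges[OF e, of n] rw_pos[OF e] by (simp add: divide_le_eq)
    qed
  qed (use a C in auto)
  note cutoffs = this
  have "\<exists>a. cutoff T a C \<and> (\<forall>x\<in>Y. a x = 1)" if Y: "finite Y" "Y \<subseteq> verts T" for Y
  proof -
    obtain n where "Y \<subseteq> B n"
      using finite_subset_incseq[OF B(1) Y(1)] Y(2) B(2) by auto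
    then have "\<forall>x\<in>Y. a n x = 1"
      using chi(3) by (auto simp: a_def)
    then show ?thesis
      using cutoffs by (intro exI[of _ "a n"] conjI)
  qed
  then have "exhausting_cutoffs C"
    using C by (simp add: exhausting_cutoffs_def)
  then show ?thesis ..
qed

text \<open>When the cutoffs exhaust the triangulation, the left-hand side of the energy bound tends
  to \<mu> times the squared norm of the even part, while the right-hand side stays below 7 C times
  it. The tails of the two components account for the 2 in front of \<epsilon>.\<close>

lemma vertex_face_components_zero:
  assumes cutoffs: "exhausting_cutoffs C" and u: "u \<in> l2_triang T" and \<mu>: "7 * C < \<mu>"
    and weak: "weak_eigen \<mu> u"
  shows "sqV (fst u) = 0" "sqF (snd (snd u)) = 0"
proof -
  let ?f = "fst u" and ?\<psi> = "snd (snd u)"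
  let ?Kf = "sqV ?f" and ?K\<psi> = "sqF ?\<psi>"
  have C: "C > 0"
    using cutoffs by (simp add: exhausting_cutoffs_def)
  have uC: "u \<in> C_triang T"
    using u l2_subset_C by blast
  have f: "?f \<in> wl2 (cw T) (verts T)" and \<psi>: "?\<psi> \<in> wl2 (\<lambda>t. sw T t / 6) (faces T)"
    using u by (simp_all add: l2_triang_iff)
  have "\<mu> * ((?Kf + ?K\<psi>) - 2 * \<epsilon>) \<le> 7 * C * (?Kf + ?K\<psi>)" if \<epsilon>: "\<epsilon> > 0" for \<epsilon>
  proof -
    obtain V0 where V0: "finite V0" "V0 \<subseteq> verts T"
        "?Kf - \<epsilon> < (\<Sum>i\<in>V0. cw T i * (cmod (?f i))\<^sup>2)"
      using V.wl2_tail[OF f \<epsilon>] by blast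
    obtain F0 where F0: "finite F0" "F0 \<subseteq> faces T"
        "?K\<psi> - \<epsilon> < (\<Sum>i\<in>F0. sw T i / 6 * (cmod (?\<psi> i))\<^sup>2)"
      using F.wl2_tail[OF \<psi> \<epsilon>] by blast
    define Y where "Y = V0 \<union> (\<Union>(x, y, z)\<in>F0. {x, y, z})"
    have "finite Y"
      using V0 F0 by (auto simp: Y_def)
    moreover have "Y \<subseteq> verts T"
    proof -
      have "x \<in> verts T \<and> y \<in> verts T \<and> z \<in> verts T" if "(x, y, z) \<in> F0" for x y z
        using that F0(2) face_edges(1,2)[of x y z] edge_verts[of x y] edge_verts[of y z] by blast
      then show ?thesis
        using V0(2) by (auto simp: Y_def)
    qed
    ultimately obtain a where "cutoff T a C" and a: "\<And>x. x \<in> Y \<Longrightarrow> a x = 1"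
      using cutoffs by (auto simp: exhausting_cutoffs_def)
    then interpret cutoff T a C
      by simp
    have YX: "x \<in> X" if "x \<in> Y" for x
      using a[OF that] that \<open>Y \<subseteq> verts T\<close> by (auto simp: X_def S_def neighbourhood_def)
    have "V0 \<subseteq> X"
      using YX by (auto simp: Y_def)
    have F0Y: "x \<in> Y \<and> y \<in> Y \<and> z \<in> Y" if "(x, y, z) \<in> F0" for x y z
      unfolding Y_def by (intro conjI UnI2 UN_I[OF that]) auto
    have "F0 \<subseteq> XF"
    proof
      fix t assume t: "t \<in> F0"
      obtain x y z where "t = (x, y, z)"
        by (cases t)
      then show "t \<in> XF"
        using t F0(2) F0Y[of x y z] YX by (auto simp: faces_in_def)
    qed
    have med: "med t = 1" if t: "t \<in> F0" for t
    proof -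
      obtain x y z where "t = (x, y, z)"
        by (cases t)
      then show ?thesis
        using t F0Y[of x y z] a by (simp add: med_def median_def)
    qed
    have "?Kf - \<epsilon> \<le> (\<Sum>x\<in>V0. cw T x * (a x * cmod (?f x))\<^sup>2)"
      using V0(3) a by (simp add: Y_def)
    also have "\<dots> \<le> (\<Sum>x\<in>X. cw T x * (a x * cmod (?f x))\<^sup>2)"
      using \<open>V0 \<subseteq> X\<close> X_subset V.w_nonneg by (intro sum_mono2) auto
    finally have 1: "?Kf - \<epsilon> \<le> (\<Sum>x\<in>X. cw T x * (a x * cmod (?f x))\<^sup>2)" .
    have "?K\<psi> - \<epsilon> \<le> (\<Sum>t\<in>F0. 1/6 * (sw T t * (med t * cmod (?\<psi> t))\<^sup>2))"
      using F0(3) med by simp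
    also have "\<dots> \<le> (\<Sum>t\<in>XF. 1/6 * (sw T t * (med t * cmod (?\<psi> t))\<^sup>2))"
      using \<open>F0 \<subseteq> XF\<close> sw_nonneg by (intro sum_mono2) auto
    finally have 2: "?K\<psi> - \<epsilon> \<le> 1/6 * (\<Sum>t\<in>XF. sw T t * (med t * cmod (?\<psi> t))\<^sup>2)"
      by (simp only: sum_distrib_left)
    have 3: "(\<Sum>x\<in>X. cw T x * (cmod (?f x))\<^sup>2) \<le> ?Kf"
      using X_subset by (intro V.sum_le_wsq f) auto
    have "(\<Sum>t\<in>XF. sw T t / 6 * (cmod (?\<psi> t))\<^sup>2) \<le> ?K\<psi>"
      using faces_in_subset by (intro F.sum_le_wsq \<psi>) auto
    then have 4: "1/6 * (\<Sum>t\<in>XF. sw T t * (cmod (?\<psi> t))\<^sup>2) \<le> ?K\<psi>"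
      by (simp add: sum_distrib_left)
    have "\<mu> * ((?Kf + ?K\<psi>) - 2 * \<epsilon>) \<le> \<mu> * ((\<Sum>x\<in>X. cw T x * (a x * cmod (?f x))\<^sup>2)
        + 1/6 * (\<Sum>t\<in>XF. sw T t * (med t * cmod (?\<psi> t))\<^sup>2))"
      using 1 2 \<mu> C by (intro mult_left_mono) linarith+
    also have "\<dots> \<le> 7 * C * ((\<Sum>x\<in>X. cw T x * (cmod (?f x))\<^sup>2)
        + 1/6 * (\<Sum>t\<in>XF. sw T t * (cmod (?\<psi> t))\<^sup>2))"
      by (rule vertex_face_energy_bound[OF uC weak])
    also have "\<dots> \<le> 7 * C * (?Kf + ?K\<psi>)"
      using 3 4 C by (intro mult_left_mono add_mono) auto
    finally show ?thesis .
  qed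
  note eps = this
  have "\<mu> > 0"
    using \<mu> C by linarith
  from le_of_epsilon_bound[OF eps this] have "\<mu> * (?Kf + ?K\<psi>) \<le> 7 * C * (?Kf + ?K\<psi>)"
    by simp
  then have "?Kf + ?K\<psi> \<le> 0"
    using \<mu> by (rule nonpos_of_mult_le)
  then show "?Kf = 0" "?K\<psi> = 0"
    using V.wsq_nonneg[of ?f] F.wsq_nonneg[of ?\<psi>] by linarith+
qed

text \<open>The bound contains a term with coefficient \<mu>, which no choice of \<mu> can beat. It
  lives on edges where the cutoff varies; those avoid the finite set carrying almost all of the
  norm, so the term is arbitrarily small.\<close>

lemma edge_component_zero:
  assumes cutoffs: "exhausting_cutoffs C" and u: "u \<in> l2_triang T" and \<mu>: "2800000 * C \<le> \<mu>"
    and weak: "weak_eigen \<mu> u"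
  shows "sqE (fst (snd u)) = 0"
proof -
  let ?\<phi> = "fst (snd u)"
  let ?K = "sqE ?\<phi>"
  have C: "C > 0"
    using cutoffs by (simp add: exhausting_cutoffs_def)
  then have \<mu>_pos: "\<mu> > 0"
    using \<mu> by linarith
  have uC: "u \<in> C_triang T"
    using u l2_subset_C by blast
  have \<phi>: "?\<phi> \<in> wl2 (\<lambda>e. rw T e / 2) (edges T)"
    using u by (simp add: l2_triang_iff)
  \<comment> \<open>15 = 1 + 14: one \<epsilon> is lost in the main term, and the coefficient 7
    multiplies a tail of 2 \<epsilon>. The doubling stems from \<open>?K\<close> counting each
    orientation with weight 1/2.\<close>
  have "\<mu> * (?K - 15 * \<epsilon>) \<le> 4 * C * ?K" if \<epsilon>: "\<epsilon> > 0" for \<epsilon>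
  proof -
    obtain E0 where E0: "finite E0" "E0 \<subseteq> edges T"
        "?K - \<epsilon> < (\<Sum>e\<in>E0. rw T e / 2 * (cmod (?\<phi> e))\<^sup>2)"
      using E.wl2_tail[OF \<phi> \<epsilon>] by blast
    define Y where "Y = fst ` E0 \<union> snd ` E0"
    have "finite Y"
      using E0 by (simp add: Y_def)
    moreover have "Y \<subseteq> verts T"
      using E0 edges_subset by (force simp: Y_def)
    ultimately obtain a where "cutoff T a C" and a: "\<And>x. x \<in> Y \<Longrightarrow> a x = 1"
      using cutoffs by (auto simp: exhausting_cutoffs_def)
    then interpret cutoff T a C
      by simp
    have YX: "x \<in> X" if "x \<in> Y" for x
      using a[OF that] that \<open>Y \<subseteq> verts T\<close> by (auto simp: X_def S_def neighbourhood_def)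
    have E0X: "E0 \<subseteq> XE"
      using YX E0(2) by (force simp: Y_def edges_in_def)
    have mean: "mean e = 1" "diff e = 0" if "e \<in> E0" for e
      using that a[of "fst e"] a[of "snd e"] by (simp_all add: Y_def mean_def diff_def)
    let ?P = "\<Sum>e\<in>XE. rw T e * (cmod (?\<phi> e))\<^sup>2"
    let ?D = "\<Sum>e\<in>XE. rw T e * (of_bool (diff e \<noteq> 0) * (cmod (?\<phi> e))\<^sup>2)"
    let ?M = "\<Sum>e\<in>XE. rw T e * (mean e)\<^sup>2 * (cmod (?\<phi> e))\<^sup>2"
    let ?Q = "\<Sum>e\<in>E0. rw T e * (cmod (?\<phi> e))\<^sup>2"
    have P: "?P \<le> 2 * ?K"
      using E.sum_le_wsq[OF \<phi>, of "XE"] edges_in_subset[of T X]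
      by (simp add: sum_divide_distrib[symmetric])
    have P0: "2 * (?K - \<epsilon>) \<le> ?Q"
      using E0(3) by (simp add: sum_divide_distrib[symmetric])
    have "?Q = (\<Sum>e\<in>E0. rw T e * (mean e)\<^sup>2 * (cmod (?\<phi> e))\<^sup>2)"
      using mean by (intro sum.cong) auto
    also have "\<dots> \<le> ?M"
      using E0X rw_nonneg by (intro sum_mono2) auto
    finally have "2 * (?K - \<epsilon>) \<le> ?M"
      by (rule order_trans[OF P0])
    then have M: "?K - \<epsilon> \<le> 1/2 * ?M"
      by simp
    have "?D =
        (\<Sum>e\<in>XE - E0. rw T e * (of_bool (diff e \<noteq> 0) * (cmod (?\<phi> e))\<^sup>2))"
      using mean by (intro sum.mono_neutral_right) auto
    also have "\<dots> \<le> (\<Sum>e\<in>XE - E0. rw T e * (cmod (?\<phi> e))\<^sup>2)"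
      using rw_nonneg by (intro sum_mono mult_left_mono) auto
    also have "\<dots> = ?P - ?Q"
      using E0X by (intro sum_diff) auto
    finally have diff_PQ: "?D \<le> ?P - ?Q" .
    have "?P - ?Q \<le> 2 * ?K - 2 * (?K - \<epsilon>)"
      using P P0 by (rule diff_mono)
    also have "\<dots> = 2 * \<epsilon>"
      by simp
    finally have Pd: "?D \<le> 2 * \<epsilon>"
      by (rule order_trans[OF diff_PQ])
    have "\<mu> * (?K - \<epsilon>) \<le> \<mu> * (1/2 * ?M)"
      using M \<mu>_pos by (intro mult_left_mono) auto
    also have "\<dots> \<le> 2 * C * ?P
        + 7 * \<mu> * ?D"
      by (rule edge_energy_bound[OF uC \<mu> weak laplacian_eigen_edges[OF uC _ weak]])
    also have "\<dots> \<le> 2 * C * (2 * ?K) + 7 * \<mu> * (2 * \<epsilon>)"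
      using P Pd C \<mu>_pos by (intro add_mono mult_left_mono) auto
    finally show ?thesis
      by (simp add: algebra_simps)
  qed
  note eps = this
  from le_of_epsilon_bound[OF eps \<mu>_pos] have "\<mu> * ?K \<le> 4 * C * ?K"
    by simp
  moreover have "4 * C < \<mu>"
    using \<mu> C by linarith
  ultimately have "?K \<le> 0"
    by (rule nonpos_of_mult_le)
  then show ?thesis
    using E.wsq_nonneg[of ?\<phi>] by linarith
qed

end

theorem corollary2:
  fixes T :: "'v triangulation"
  assumes "weighted_magnetic_triangulation T"
    and "chi_complete T"
  shows "essentially_self_adjoint (l2_triang T) (ip_triang T) (Cc_triang T) (magnetic_laplacian T)"
proof -
  interpret weighted_magnetic_triangulation T
    by (rule assms(1))
  interpret hilbert_space_on scale_cochain "l2_triang T" "ip_triang T"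
    by (rule hilbert_space_on_triang)
  obtain C where cutoffs: "exhausting_cutoffs C"
    using chi_complete_cutoffs[OF assms(2)] by blast
  then have C: "C > 0"
    by (simp add: exhausting_cutoffs_def)
  show ?thesis
  \<comment> \<open>The value demanded by the odd part, which exceeds the 7 C demanded by the even
    part.\<close>
  proof (rule essentially_self_adjoint_magnetic_laplacianI[of "2800000 * C"])
    fix u assume u: "u \<in> l2_triang T" and weak: "weak_eigen (2800000 * C) u"
    have "sqnorm u = 0"
      using vertex_face_components_zero[OF cutoffs u _ weak] edge_component_zero[OF cutoffs u _ weak] C
      by (simp add: sqnorm_def)
    then show "u = 0"
      using u by (intro ip_self_zero) (simp_all add: ip_triang_self)
  qed (use C in simp)
qed

end
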